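(* Consider the planar Newtonian four-body problem with masses $m_1=m_2=1$, $m_3=m_4=m>0$. Let $q>2$ be an integer, let $L$ be the least common multiple of $2$ and $q$, and let $\widetilde G=D_L\times\mathbb{Z}_2$, where $D_L$ (dihedral of order $2L$) has generators $h_1,h_2$ and $\mathbb{Z}_2$ is generated by $h_3$, act with $\sigma(h_1)=(1\,2)(3\,4)$, $\sigma(h_2)=(1\,2)$, $\sigma(h_3)=(1\,2)(3\,4)$, with $\rho(h_1)$, $\rho(h_2)$ the reflections of the plane along lines $l_1,l_2$ through the origin meeting at the angle $\pi/q$, and $\rho(h_3)$ the rotation of angle $\pi$. Assume that all local minima of $\mathcal{A}^{\widetilde G}$ in $\Lambda^{\widetilde G}$ are collision-free. Then $\mathcal{A}^{\widetilde G}$ attains its minimum on $\Lambda^{\widetilde G}$, and a minimizer is a collision-free $T$-periodic solution which is not homographic.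
   Context: Let $T>0$, $T^1=\mathbb{R}/T\mathbb{Z}$, $\mathcal{X}=\{x\in(\mathbb{R}^2)^4:\sum_im_ix_i=0\}$, $\Lambda=H^1(T^1,\mathcal{X})$. The generators act on time by $h_1t=-t$, $h_2t=\frac TL-t$ and $h_3t=t$; $\rho\colon\widetilde G\to O(2)$ is the action on the plane and $\sigma\colon\widetilde G\to\Sigma_4$ the action on the indices. $\widetilde G$ acts on $\mathcal{X}$ by $(gx)_i=\rho(g)x_{\sigma(g)^{-1}(i)}$ and on $\Lambda$ by $(g\cdot x)(t)=g\,x(g^{-1}t)$; $\Lambda^{\widetilde G}$ is the set of loops fixed by $\widetilde G$. $\mathcal{A}(x)=\int_0^T\big(\sum_i\frac12m_i|\dot x_i|^2+\sum_{i<j}\frac{m_im_j}{|x_i-x_j|}\big)dt$, $\mathcal{A}^{\widetilde G}=\mathcal{A}|_{\Lambda^{\widetilde G}}$. A loop is collision-free if $x_i(t)\neq x_j(t)$ for all $t$ and $i\ne j$. A solution is a solution of Newton's equations. It is homographic if, identifying the plane with $\mathbb{C}$, $x(t)=s(t)x(0)$ for a $\mathbb{C}$-valued function $s$. *)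

theory Defs
  imports
    "HOL-Analysis.Analysis"
    "HOL-Algebra.Bij"
    "HOL-Algebra.Elementary_Groups"
    "HOL-Combinatorics.Transposition"
    "HOL-Library.Real_Mod"
begin

section \<open>The group and the groups it is represented in\<close>

text \<open>The pair \<open>(k, b)\<close> stands for \<open>r\<^sup>k f\<^sup>b\<close> with \<open>r\<close> of order \<open>L\<close>, \<open>f\<close> an involution and
  \<open>f r = r\<^sup>-\<^sup>1 f\<close>.\<close>

definition dihedral_group :: "nat \<Rightarrow> (int \<times> bool) monoid" where
  "dihedral_group L =
     \<lparr>carrier = {0..<int L} \<times> UNIV,
      monoid.mult = (\<lambda>(k, b) (l, c). ((k + (if b then - l else l)) mod int L, b \<noteq> c)),
      one = (0, False)\<rparr>"

definition sym_grp :: "nat \<Rightarrow> ((int \<times> bool) \<times> int) monoid" where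
  "sym_grp L = dihedral_group L \<times>\<times> integer_mod_group 2"

text \<open>\<open>h1 = f\<close> and \<open>h1 h2 = r\<close>, hence \<open>h2 = f r = r\<^sup>-\<^sup>1 f\<close>. The lemma
  \<open>sym_grp_universal\<close> below confirms the presentation.\<close>

definition h1 :: "nat \<Rightarrow> (int \<times> bool) \<times> int" where
  "h1 L = ((0, True), 0)"

definition h2 :: "nat \<Rightarrow> (int \<times> bool) \<times> int" where
  "h2 L = ((-1 mod int L, True), 0)"

definition h3 :: "nat \<Rightarrow> (int \<times> bool) \<times> int" where
  "h3 L = ((0, False), 1)"

text \<open>The plane is \<^typ>\<open>complex\<close> with its Euclidean structure over the reals.\<close>

definition O2 :: "(complex \<Rightarrow> complex) monoid" where
  "O2 = \<lparr>carrier = {f. orthogonal_transformation f}, monoid.mult = (\<circ>), one = id\<rparr>"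

text \<open>\<open>\<real>/T\<int>\<close> is represented by the fundamental domain \<open>[0, T)\<close>; the class of \<open>t\<close> is \<open>t rmod T\<close>.\<close>

definition circle :: "real \<Rightarrow> real set" where
  "circle T = {0..<T}"

definition line_through_origin :: "complex set \<Rightarrow> bool" where
  "line_through_origin l \<longleftrightarrow> subspace l \<and> dim l = 1"

definition lines_meet_at_angle :: "complex set \<Rightarrow> complex set \<Rightarrow> real \<Rightarrow> bool" where
  "lines_meet_at_angle l l' \<alpha> \<longleftrightarrow>
     (\<exists>u\<in>l. \<exists>v\<in>l'. norm u = 1 \<and> norm v = 1 \<and> arccos (u \<bullet> v) = \<alpha>)"

definition reflection_along :: "complex set \<Rightarrow> (complex \<Rightarrow> complex) \<Rightarrow> bool" where
  "reflection_along l f \<longleftrightarrow>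
     linear f \<and> (\<forall>z\<in>l. f z = z) \<and> (\<forall>z. (\<forall>w\<in>l. w \<bullet> z = 0) \<longrightarrow> f z = - z)"

section \<open>Configurations and loops\<close>

text \<open>Bodies are indexed by \<^typ>\<open>4\<close>, where \<open>4 = 0\<close>.\<close>

definition mass :: "real \<Rightarrow> 4 \<Rightarrow> real" where
  "mass m i = (if i = 1 \<or> i = 2 then 1 else m)"

definition configurations :: "real \<Rightarrow> (complex^4) set" where
  "configurations m = {x. (\<Sum>i\<in>UNIV. mass m i *\<^sub>R x $ i) = 0}"

definition has_weak_derivative :: "(real \<Rightarrow> complex^4) \<Rightarrow> (real \<Rightarrow> complex^4) \<Rightarrow> bool" where
  "has_weak_derivative x v \<longleftrightarrow>
     (\<forall>a b. a \<le> b \<longrightarrow>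
        set_integrable lborel {a..b} v \<and> x b - x a = (LINT t:{a..b}|lborel. v t))"

text \<open>Determined up to a null set, for functions that have a weak derivative.\<close>

definition weak_derivative :: "(real \<Rightarrow> complex^4) \<Rightarrow> real \<Rightarrow> complex^4" where
  "weak_derivative x = (SOME v. has_weak_derivative x v)"

text \<open>\<open>H\<^sup>1(\<real>/T\<int>, \<X>)\<close>: the continuous representatives, as \<open>T\<close>-periodic functions on the line.\<close>

definition loops :: "real \<Rightarrow> real \<Rightarrow> (real \<Rightarrow> complex^4) set" where
  "loops T m = {x. (\<forall>t. x t \<in> configurations m) \<and> (\<forall>t. x (t + T) = x t) \<and>
     (\<exists>v. has_weak_derivative x v \<and> set_integrable lborel {0..T} (\<lambda>t. (norm (v t))\<^sup>2))}"

definition sobolev_norm :: "real \<Rightarrow> (real \<Rightarrow> complex^4) \<Rightarrow> real" where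
  "sobolev_norm T x =
     sqrt (LINT t:{0..T}|lborel. (norm (x t))\<^sup>2 + (norm (weak_derivative x t))\<^sup>2)"

text \<open>The action takes the value \<open>\<infinity>\<close> where the integral diverges. The division is that of
  \<^typ>\<open>ennreal\<close>, so the potential is \<open>\<infinity>\<close> at a collision.\<close>

definition action :: "real \<Rightarrow> real \<Rightarrow> (real \<Rightarrow> complex^4) \<Rightarrow> ennreal" where
  "action T m x =
     (\<integral>\<^sup>+t\<in>{0..T}.
        ((\<Sum>i\<in>UNIV. ennreal (1/2 * mass m i * (norm (weak_derivative x t $ i))\<^sup>2)) +
         (\<Sum>(i, j)\<in>{(i, j). i < j}.
            ennreal (mass m i * mass m j) / ennreal (norm (x t $ i - x t $ j)))) \<partial>lborel)"

section \<open>Group actions on configurations and on loops\<close>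

definition conf_act ::
    "('g \<Rightarrow> complex \<Rightarrow> complex) \<Rightarrow> ('g \<Rightarrow> 4 \<Rightarrow> 4) \<Rightarrow> 'g \<Rightarrow> complex^4 \<Rightarrow> complex^4" where
  "conf_act \<rho> \<sigma> g x = (\<chi> i. \<rho> g (x $ (inv_into UNIV (\<sigma> g) i)))"

definition loop_act ::
    "real \<Rightarrow> ('g, 'e) monoid_scheme \<Rightarrow> ('g \<Rightarrow> real \<Rightarrow> real) \<Rightarrow> ('g \<Rightarrow> complex \<Rightarrow> complex) \<Rightarrow>
     ('g \<Rightarrow> 4 \<Rightarrow> 4) \<Rightarrow> 'g \<Rightarrow> (real \<Rightarrow> complex^4) \<Rightarrow> real \<Rightarrow> complex^4" where
  "loop_act T G \<tau> \<rho> \<sigma> g x t = conf_act \<rho> \<sigma> g (x (\<tau> (inv\<^bsub>G\<^esub> g) (t rmod T)))"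

definition fixed_loops ::
    "real \<Rightarrow> real \<Rightarrow> ('g, 'e) monoid_scheme \<Rightarrow> ('g \<Rightarrow> real \<Rightarrow> real) \<Rightarrow>
     ('g \<Rightarrow> complex \<Rightarrow> complex) \<Rightarrow> ('g \<Rightarrow> 4 \<Rightarrow> 4) \<Rightarrow> (real \<Rightarrow> complex^4) set" where
  "fixed_loops T m G \<tau> \<rho> \<sigma> =
     {x \<in> loops T m. \<forall>g\<in>carrier G. loop_act T G \<tau> \<rho> \<sigma> g x = x}"

section \<open>Minimizers and solutions\<close>

definition local_minimum_on ::
    "real \<Rightarrow> real \<Rightarrow> (real \<Rightarrow> complex^4) set \<Rightarrow> (real \<Rightarrow> complex^4) \<Rightarrow> bool" where
  "local_minimum_on T m S x \<longleftrightarrow>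
     x \<in> S \<and> (\<exists>\<epsilon>>0. \<forall>y\<in>S. sobolev_norm T (\<lambda>t. y t - x t) < \<epsilon> \<longrightarrow> action T m x \<le> action T m y)"

definition minimizer_on ::
    "real \<Rightarrow> real \<Rightarrow> (real \<Rightarrow> complex^4) set \<Rightarrow> (real \<Rightarrow> complex^4) \<Rightarrow> bool" where
  "minimizer_on T m S x \<longleftrightarrow> x \<in> S \<and> (\<forall>y\<in>S. action T m x \<le> action T m y)"

definition collision_free :: "(real \<Rightarrow> complex^4) \<Rightarrow> bool" where
  "collision_free x \<longleftrightarrow> (\<forall>t i j. i \<noteq> j \<longrightarrow> x t $ i \<noteq> x t $ j)"

text \<open>Only meaningful together with \<^const>\<open>collision_free\<close>, because \<open>z / 0 = 0\<close>.\<close>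

definition newton_solution :: "real \<Rightarrow> (real \<Rightarrow> complex^4) \<Rightarrow> bool" where
  "newton_solution m x \<longleftrightarrow>
     (\<exists>v a. (\<forall>t. (x has_vector_derivative v t) (at t)) \<and>
            (\<forall>t. (v has_vector_derivative a t) (at t)) \<and>
            (\<forall>t i. mass m i *\<^sub>R a t $ i =
               (\<Sum>j\<in>UNIV - {i}. (mass m i * mass m j / (norm (x t $ j - x t $ i)) ^ 3) *\<^sub>R
                                  (x t $ j - x t $ i))))"

definition homographic :: "(real \<Rightarrow> complex^4) \<Rightarrow> bool" where
  "homographic x \<longleftrightarrow> (\<exists>s :: real \<Rightarrow> complex. \<forall>t i. x t $ i = s t * x 0 $ i)"

section \<open>The presentation of the group\<close>

lemma group_dihedral_group:
  assumes "L > 0"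
  shows "group (dihedral_group L)"
proof (rule groupI)
  fix x assume "x \<in> carrier (dihedral_group L)"
  then obtain k b where x: "x = (k, b)" "0 \<le> k" "k < int L"
    by (auto simp: dihedral_group_def)
  let ?y = "((if b then k else (- k) mod int L), b)"
  show "\<exists>y\<in>carrier (dihedral_group L). y \<otimes>\<^bsub>dihedral_group L\<^esub> x = \<one>\<^bsub>dihedral_group L\<^esub>"
    by (rule bexI[of _ ?y]) (use assms x in \<open>auto simp: dihedral_group_def mod_simps\<close>)
next
  fix x y z assume "x \<in> carrier (dihedral_group L)" "y \<in> carrier (dihedral_group L)"
    "z \<in> carrier (dihedral_group L)"
  then show "x \<otimes>\<^bsub>dihedral_group L\<^esub> y \<otimes>\<^bsub>dihedral_group L\<^esub> z =
        x \<otimes>\<^bsub>dihedral_group L\<^esub> (y \<otimes>\<^bsub>dihedral_group L\<^esub> z)"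
    by (auto simp: dihedral_group_def mod_simps algebra_simps)
qed (use assms in \<open>auto simp: dihedral_group_def\<close>)

lemma group_sym_grp: "L > 0 \<Longrightarrow> group (sym_grp L)"
  unfolding sym_grp_def
  by (intro DirProd_group group_dihedral_group) auto

lemma order_sym_grp: "L > 0 \<Longrightarrow> order (sym_grp L) = 2 * (2 * L)"
  by (simp add: sym_grp_def order_def dihedral_group_def DirProd_def carrier_integer_mod_group
      card_cartesian_product)

lemma h_in_carrier:
  assumes "L > 0"
  shows "h1 L \<in> carrier (sym_grp L)" "h2 L \<in> carrier (sym_grp L)" "h3 L \<in> carrier (sym_grp L)"
  using assms
  by (auto simp: h1_def h2_def h3_def sym_grp_def dihedral_group_def carrier_integer_mod_group)

lemma sym_grp_universal:
  fixes H (structure)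
  assumes "group H" "L > 0" and ab: "a \<in> carrier H" "b \<in> carrier H" "c \<in> carrier H"
    and aa: "a \<otimes> a = \<one>" and bb: "b \<otimes> b = \<one>" and cc: "c \<otimes> c = \<one>"
    and abL: "(a \<otimes> b) [^] L = \<one>"
    and ca: "c \<otimes> a = a \<otimes> c" and cb: "c \<otimes> b = b \<otimes> c"
  shows "\<exists>\<phi>\<in>hom (sym_grp L) H. \<phi> (h1 L) = a \<and> \<phi> (h2 L) = b \<and> \<phi> (h3 L) = c"
proof -
  interpret group H by fact
  define r where "r = a \<otimes> b"
  have r: "r \<in> carrier H" using ab by (simp add: r_def)
  have inv_a: "inv a = a" and inv_b: "inv b = b"
    using aa bb ab by (auto intro: inv_equality)
  have rL: "r [^] (k mod int L) = r [^] k" for k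
  proof -
    have "r [^] k = r [^] (int L * (k div int L) + k mod int L)" by simp
    also have "\<dots> = r [^] (int L * (k div int L)) \<otimes> r [^] (k mod int L)"
      using r by (rule int_pow_mult)
    also have "r [^] (int L * (k div int L)) = (r [^] int L) [^] (k div int L)"
      using r by (simp add: int_pow_pow)
    also have "r [^] int L = \<one>" using abL r by (simp add: int_pow_int r_def)
    finally show ?thesis using r by simp
  qed
  have inv_r: "inv r = b \<otimes> a" using ab inv_a inv_b by (simp add: r_def inv_mult_group)
  have "a \<otimes> r = b" using ab aa by (simp add: r_def flip: m_assoc)
  then have ara: "a \<otimes> r \<otimes> a = inv r" by (simp only: inv_r)
  have ar: "a \<otimes> r [^] k = r [^] (- k) \<otimes> a" for k :: int
  proof -
    have conj: "(\<lambda>x. a \<otimes> x \<otimes> a) \<in> hom H H"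
    proof (rule homI)
      fix x y assume xy: "x \<in> carrier H" "y \<in> carrier H"
      have "a \<otimes> x \<otimes> a \<otimes> (a \<otimes> y \<otimes> a) = a \<otimes> x \<otimes> (a \<otimes> a) \<otimes> y \<otimes> a"
        using ab xy by (simp add: m_assoc)
      then show "a \<otimes> (x \<otimes> y) \<otimes> a = a \<otimes> x \<otimes> a \<otimes> (a \<otimes> y \<otimes> a)"
        using ab xy aa by (simp add: m_assoc)
    qed (use ab in auto)
    interpret c: group_hom H H "\<lambda>x. a \<otimes> x \<otimes> a"
      by unfold_locales (rule conj)
    have "a \<otimes> r [^] k \<otimes> a = (a \<otimes> r \<otimes> a) [^] k"
      using r c.hom_int_pow by simp
    also have "\<dots> = r [^] (- k)"
      using r by (simp add: ara int_pow_inv int_pow_neg)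
    finally have "a \<otimes> r [^] k \<otimes> a \<otimes> a = r [^] (- k) \<otimes> a" by simp
    then show ?thesis using ab r aa by (simp add: m_assoc)
  qed
  have cr: "c \<otimes> r [^] k = r [^] k \<otimes> c" for k :: int
  proof -
    have "c \<otimes> r = a \<otimes> c \<otimes> b" using ab ca by (simp add: r_def flip: m_assoc)
    also have "\<dots> = r \<otimes> c" using ab cb by (simp add: r_def m_assoc)
    finally have crc: "c \<otimes> r = r \<otimes> c" .
    have conj: "(\<lambda>x. c \<otimes> x \<otimes> c) \<in> hom H H"
    proof (rule homI)
      fix x y assume xy: "x \<in> carrier H" "y \<in> carrier H"
      have "c \<otimes> x \<otimes> c \<otimes> (c \<otimes> y \<otimes> c) = c \<otimes> x \<otimes> (c \<otimes> c) \<otimes> y \<otimes> c"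
        using ab xy by (simp add: m_assoc)
      then show "c \<otimes> (x \<otimes> y) \<otimes> c = c \<otimes> x \<otimes> c \<otimes> (c \<otimes> y \<otimes> c)"
        using ab xy cc by (simp add: m_assoc)
    qed (use ab in auto)
    interpret c: group_hom H H "\<lambda>x. c \<otimes> x \<otimes> c"
      by unfold_locales (rule conj)
    have "c \<otimes> r [^] k \<otimes> c = (c \<otimes> r \<otimes> c) [^] k"
      using r c.hom_int_pow by simp
    also have "c \<otimes> r \<otimes> c = r" using crc r ab cc by (simp add: m_assoc)
    finally have "c \<otimes> r [^] k \<otimes> c \<otimes> c = r [^] k \<otimes> c" by simp
    then show ?thesis using ab r cc by (simp add: m_assoc)
  qed
  define A where "A e = (if e then a else \<one>)" for e
  define C where "C (d::int) = (if d = 1 then c else \<one>)" for d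
  define \<phi> where "\<phi> = (\<lambda>((k, e), d). r [^] (k::int) \<otimes> A e \<otimes> C d)"
  have A: "A e \<in> carrier H" for e using ab by (simp add: A_def)
  have C: "C d \<in> carrier H" for d using ab by (simp add: C_def)
  have Ar: "A e \<otimes> r [^] k = r [^] (if e then - k else k) \<otimes> A e" for e and k :: int
    using ar r by (simp add: A_def)
  have Cr: "C d \<otimes> r [^] k = r [^] k \<otimes> C d" for d and k :: int
    using cr r by (simp add: C_def)
  have CA: "C d \<otimes> A e = A e \<otimes> C d" for d e
    using ca ab by (simp add: C_def A_def)
  have AA: "A e \<otimes> A e' = A (e \<noteq> e')" for e e'
    using aa ab by (auto simp: A_def)
  have CC: "C d \<otimes> C d' = C ((d + d') mod 2)" if "d \<in> {0..<2}" "d' \<in> {0..<2}" for d d'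
  proof -
    have "d = 0 \<or> d = 1" "d' = 0 \<or> d' = 1" using that by auto
    then show ?thesis using cc ab by (auto simp: C_def)
  qed
  have "\<phi> \<in> hom (sym_grp L) H"
  proof (rule homI)
    fix x assume "x \<in> carrier (sym_grp L)"
    show "\<phi> x \<in> carrier H" using r A C by (auto simp: \<phi>_def split: prod.splits)
  next
    fix x y assume "x \<in> carrier (sym_grp L)" "y \<in> carrier (sym_grp L)"
    then obtain k e d k' e' d' where xy: "x = ((k, e), d)" "y = ((k', e'), d')"
      and d: "d \<in> {0..<2}" "d' \<in> {0..<2}"
      by (auto simp: sym_grp_def dihedral_group_def carrier_integer_mod_group)
    let ?k = "if e then - k' else k'"
    have "\<phi> x \<otimes> \<phi> y = r [^] k \<otimes> A e \<otimes> (C d \<otimes> r [^] k') \<otimes> A e' \<otimes> C d'"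
      using r A C by (simp add: \<phi>_def xy m_assoc)
    also have "\<dots> = r [^] k \<otimes> (A e \<otimes> r [^] k') \<otimes> (C d \<otimes> A e') \<otimes> C d'"
      unfolding Cr using r A C by (simp add: m_assoc)
    also have "\<dots> = (r [^] k \<otimes> r [^] ?k) \<otimes> (A e \<otimes> A e') \<otimes> (C d \<otimes> C d')"
      unfolding Ar CA using r A C by (simp add: m_assoc)
    also have "\<dots> = r [^] ((k + ?k) mod int L) \<otimes> A (e \<noteq> e') \<otimes> C ((d + d') mod 2)"
      unfolding rL AA CC[OF d] using r by (simp only: int_pow_mult)
    also have "\<dots> = \<phi> (x \<otimes>\<^bsub>sym_grp L\<^esub> y)"
      by (simp add: \<phi>_def xy sym_grp_def dihedral_group_def mult_integer_mod_group)
    finally show "\<phi> (x \<otimes>\<^bsub>sym_grp L\<^esub> y) = \<phi> x \<otimes> \<phi> y" by simp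
  qed
  moreover have "\<phi> (h1 L) = a" "\<phi> (h3 L) = c"
    using ab r by (simp_all add: \<phi>_def h1_def h3_def A_def C_def)
  moreover have "\<phi> (h2 L) = b"
  proof -
    have "\<phi> (h2 L) = inv r \<otimes> a"
      using ab r rL[of "-1"] by (simp add: \<phi>_def h2_def A_def C_def int_pow_neg)
    also have "\<dots> = b" using ab aa by (simp add: inv_r m_assoc)
    finally show ?thesis .
  qed
  ultimately show ?thesis by blast
qed

end

(*
A loop fixed by h3 is a parallelogram configuration, x2 = -x1 and x4 = -x3, and h1 h2 forces
x1(t + T/L) = d x1(t), x3(t + T/L) = -d x3(t) with d a rotation by twice the angle pi/q, so that
neither d nor -d is 1. Hence no homographic loop is symmetric (d and -d would coincide), and the
size of a symmetric loop is bounded by its oscillation, which makes the action coercive.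

A minimizing sequence converges uniformly along a subsequence (Arzela-Ascoli). The kinetic part is
lower semicontinuous because near-minimizers of the energy among functions uniformly close to the
limit form an L2-Cauchy sequence (parallelogram law); for the potential part use Fatou. If all
actions were infinite, the zero loop would be a local minimum with collisions.

Neither symmetric criticality nor du Bois-Reymond is needed for Newton's equations: if F'' is the
acceleration along a collision-free minimizer x, with F periodic and of mean zero, then F inherits
the symmetry, and the variation of x in the direction F - x gives that the kinetic energy of x - F
has integral at most 0.
*)

theory Submission
  imports Defs "HOL-Complex_Analysis.Great_Picard"
begin

section \<open>Lower semicontinuity of the energy\<close>

text \<open>Both halves of the proof rest on one estimate for centrally symmetric configurations:
  \<open>norm y\<close> is at most a constant times \<open>norm (A2 (A1 y) - y)\<close>, because the
  composite rotates one pair of bodies by \<open>d\<close> and the other by \<open>- d\<close>, and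
  neither is 1. For loops it gives coercivity. For the mean of the acceleration over a period it
  gives zero, and this is why the antiderivative F' of the acceleration is periodic at all. The
  direction F - x is chosen because integration by parts against F' turns the first variation of the
  action into minus twice the integral of the kinetic energy of x - F, while minimality makes it
  nonnegative. So x' and F' agree almost everywhere, x differs from F by a constant, and regularity
  and Newton's equations come out together. The symmetry of F keeps the competitors inside the class
  in which x is minimal. The potential occurs in two versions: with values in \<open>ennreal\<close>
  and continuous through collisions for existence, real-valued for the variation.\<close>

lemma le_weighted_square:
  fixes a l :: real
  assumes "l > 0"
  shows "a \<le> (l * a\<^sup>2 + 1 / l) / 2"
proof -
  have "0 \<le> (l * a - 1)\<^sup>2 / l" using assms by simp
  also have "\<dots> = l * a\<^sup>2 + 1 / l - 2 * a"
    using assms by (simp add: power2_eq_square field_simps)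
  finally show ?thesis by simp
qed

lemma parallelogram_law:
  fixes u v :: "'a::real_inner"
  shows "(norm (u + v))\<^sup>2 + (norm (u - v))\<^sup>2 = 2 * ((norm u)\<^sup>2 + (norm v)\<^sup>2)"
  by (simp add: power2_norm_eq_inner inner_simps inner_commute)

text \<open>The Riesz-Fischer argument: the telescoping series of differences converges absolutely
  almost everywhere with an integrable majorant \<open>g\<close>, so dominated convergence yields
  the integrals and Fatou the bound on the square norm. Integrals over sets are what is needed later
  to pass to the limit in an equation between a function and the integral of its derivative.\<close>

lemma L2_limit_of_fast_Cauchy:
  fixes w :: "nat \<Rightarrow> 'b \<Rightarrow> 'a::euclidean_space"
  assumes "finite_measure M"
    and w: "\<And>n. integrable M (w n)"
    and w2: "\<And>n. integrable M (\<lambda>x. (norm (w n x))\<^sup>2)"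
    and cauchy: "\<And>n. (\<integral>x. (norm (w (Suc n) x - w n x))\<^sup>2 \<partial>M) \<le> (1/4) ^ n"
    and bound: "\<And>n. (\<integral>x. (norm (w n x))\<^sup>2 \<partial>M) \<le> c n" and c: "c \<longlonglongrightarrow> C"
  obtains u where "integrable M u" "integrable M (\<lambda>x. (norm (u x))\<^sup>2)"
    "(\<integral>x. (norm (u x))\<^sup>2 \<partial>M) \<le> C"
    "\<And>A. A \<in> sets M \<Longrightarrow> (\<lambda>n. \<integral>x\<in>A. w n x \<partial>M) \<longlonglongrightarrow> (\<integral>x\<in>A. u x \<partial>M)"
proof -
  interpret finite_measure M by fact
  define d where "d n x = w (Suc n) x - w n x" for n x
  have d: "integrable M (d n)" for n unfolding d_def using w by auto
  have [measurable]: "w n \<in> borel_measurable M" "d n \<in> borel_measurable M" for n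
    using w d by auto
  have d2: "integrable M (\<lambda>x. (norm (d n x))\<^sup>2)" for n
  proof (rule Bochner_Integration.integrable_bound)
    show "integrable M (\<lambda>x. 2 * ((norm (w (Suc n) x))\<^sup>2 + (norm (w n x))\<^sup>2))" using w2 by auto
    have "(norm (d n x))\<^sup>2 \<le> 2 * ((norm (w (Suc n) x))\<^sup>2 + (norm (w n x))\<^sup>2)" for x
      using parallelogram_law[of "w (Suc n) x" "w n x"] zero_le_power2[of "norm (w (Suc n) x + w n x)"]
      unfolding d_def by linarith
    then show "AE x in M. norm ((norm (d n x))\<^sup>2) \<le> norm (2 * ((norm (w (Suc n) x))\<^sup>2 + (norm (w n x))\<^sup>2))"
      by auto
  qed auto
  define \<mu> where "\<mu> = measure M (space M)"
  have dn: "(\<integral>x. norm (d n x) \<partial>M) \<le> (1 + \<mu>) * (1/2) ^ n" for n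
  proof -
    \<comment> \<open>Young's inequality with weight \<open>2^n\<close> balances the squared
      distance, at most \<open>(1/4)^n\<close>, against the total mass \<open>\<mu>\<close>; both
      terms become multiples of \<open>(1/2)^n\<close>.\<close>
    have "(\<integral>x. norm (d n x) \<partial>M) \<le> (\<integral>x. (2^n * (norm (d n x))\<^sup>2 + 1 / 2^n) / 2 \<partial>M)"
      by (intro integral_mono) (use d d2 le_weighted_square[of "2^n"] in auto)
    also have "\<dots> = (2^n * (\<integral>x. (norm (d n x))\<^sup>2 \<partial>M) + \<mu> / 2^n) / 2"
      using d2 by (simp add: \<mu>_def)
    also have "\<dots> \<le> (2^n * (1/4)^n + \<mu> / 2^n) / 2"
      using cauchy[of n] by (simp add: d_def)
    also have "\<dots> = (1 + \<mu>) * (1/2) ^ n / 2"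
    proof -
      have "(2::real)^n * (1/4)^n = (1/2)^n" by (simp flip: power_mult_distrib)
      then show ?thesis by (simp add: field_simps)
    qed
    also have "\<dots> \<le> (1 + \<mu>) * (1/2) ^ n" by (simp add: \<mu>_def)
    finally show ?thesis .
  qed
  have sumd: "summable (\<lambda>n. \<integral>x. norm (d n x) \<partial>M)"
    by (rule summable_comparison_test'[of "\<lambda>n. (1 + \<mu>) * (1/2) ^ n" 0]) (use dn in auto)
  have AEs: "AE x in M. summable (\<lambda>n. norm (d n x))"
  proof -
    have "(\<integral>\<^sup>+x. (\<Sum>n. ennreal (norm (d n x))) \<partial>M) = (\<Sum>n. \<integral>\<^sup>+x. ennreal (norm (d n x)) \<partial>M)"
      by (intro nn_integral_suminf) auto
    also have "\<dots> = (\<Sum>n. ennreal (\<integral>x. norm (d n x) \<partial>M))"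
      using d by (subst nn_integral_eq_integral) auto
    also have "\<dots> \<noteq> \<infinity>" using sumd by (subst suminf_ennreal2) auto
    finally have "AE x in M. (\<Sum>n. ennreal (norm (d n x))) \<noteq> \<infinity>"
      by (intro nn_integral_noteq_infinite) auto
    then show ?thesis
      by eventually_elim (auto intro: summable_suminf_not_top)
  qed
  define u where "u x = w 0 x + (\<Sum>n. d n x)" for x
  define g where "g x = norm (w 0 x) + (\<Sum>n. norm (d n x))" for x
  have u: "integrable M u" unfolding u_def
    by (intro Bochner_Integration.integrable_add w integrable_suminf d AEs sumd)
  have g: "integrable M g" unfolding g_def
    by (intro Bochner_Integration.integrable_add integrable_norm w integrable_suminf d)
       (use AEs sumd in auto)
  have wsum: "w n x = w 0 x + (\<Sum>i<n. d i x)" for n x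
    by (induction n) (simp_all add: d_def algebra_simps)
  have lim: "AE x in M. (\<lambda>n. w n x) \<longlonglongrightarrow> u x" using AEs
  proof eventually_elim
    case (elim x)
    then have "(\<lambda>n. \<Sum>i<n. d i x) \<longlonglongrightarrow> (\<Sum>n. d n x)"
      by (rule summable_LIMSEQ[OF summable_norm_cancel])
    then have "(\<lambda>n. w 0 x + (\<Sum>i<n. d i x)) \<longlonglongrightarrow> w 0 x + (\<Sum>n. d n x)"
      by (intro tendsto_add tendsto_const)
    moreover have "(\<lambda>n. w n x) \<longlonglongrightarrow> w 0 x + (\<Sum>n. d n x) \<longleftrightarrow>
        (\<lambda>n. w 0 x + (\<Sum>i<n. d i x)) \<longlonglongrightarrow> w 0 x + (\<Sum>n. d n x)"
      by (intro tendsto_cong always_eventually allI wsum)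
    ultimately show ?case unfolding u_def by blast
  qed
  have dom: "AE x in M. norm (w n x) \<le> g x" for n using AEs
  proof eventually_elim
    case (elim x)
    have "norm (w n x) = norm (w 0 x + (\<Sum>i<n. d i x))"
      by (rule arg_cong[OF wsum])
    also have "\<dots> \<le> norm (w 0 x) + norm (\<Sum>i<n. d i x)" by (rule norm_triangle_ineq)
    also have "norm (\<Sum>i<n. d i x) \<le> (\<Sum>i<n. norm (d i x))" by (rule norm_sum)
    also have "\<dots> \<le> (\<Sum>i. norm (d i x))" by (rule sum_le_suminf) (use elim in auto)
    finally show ?case by (simp add: g_def)
  qed
  have [measurable]: "u \<in> borel_measurable M" using u by auto
  have conv: "(\<lambda>n. \<integral>x\<in>A. w n x \<partial>M) \<longlonglongrightarrow> (\<integral>x\<in>A. u x \<partial>M)" if [measurable]: "A \<in> sets M" for A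
    unfolding set_lebesgue_integral_def
  proof (rule integral_dominated_convergence[where w = g])
    show "AE x in M. (\<lambda>n. indicator A x *\<^sub>R w n x) \<longlonglongrightarrow> indicator A x *\<^sub>R u x"
      using lim by eventually_elim (intro tendsto_intros)
    show "AE x in M. norm (indicator A x *\<^sub>R w n x) \<le> g x" for n
      using dom[of n] by eventually_elim (auto simp: indicator_def intro: order_trans[OF norm_ge_zero])
  qed (use g in auto)
  \<comment> \<open>\<open>ennreal\<close> sends negative reals to 0, so the Fatou estimate below
    says something about \<open>C\<close> only if \<open>C \<ge> 0\<close>.\<close>
  have C: "C \<ge> 0"
    by (rule LIMSEQ_le_const[OF c])
       (use bound in \<open>auto intro!: exI[of _ 0] order_trans[OF integral_nonneg_AE bound]\<close>)
  have "(\<integral>\<^sup>+x. ennreal ((norm (u x))\<^sup>2) \<partial>M) \<le> (\<integral>\<^sup>+x. liminf (\<lambda>n. ennreal ((norm (w n x))\<^sup>2)) \<partial>M)"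
  proof (rule nn_integral_mono_AE)
    show "AE x in M. ennreal ((norm (u x))\<^sup>2) \<le> liminf (\<lambda>n. ennreal ((norm (w n x))\<^sup>2))"
      using lim
    proof eventually_elim
      case (elim x)
      then have "(\<lambda>n. ennreal ((norm (w n x))\<^sup>2)) \<longlonglongrightarrow> ennreal ((norm (u x))\<^sup>2)"
        by (intro tendsto_intros)
      then show ?case using lim_imp_Liminf[of sequentially] by fastforce
    qed
  qed
  also have "\<dots> \<le> liminf (\<lambda>n. \<integral>\<^sup>+x. ennreal ((norm (w n x))\<^sup>2) \<partial>M)"
    by (rule nn_integral_liminf) auto
  also have "\<dots> = liminf (\<lambda>n. ennreal (\<integral>x. (norm (w n x))\<^sup>2 \<partial>M))"
    using w2 by (subst nn_integral_eq_integral) auto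
  also have "\<dots> \<le> liminf (\<lambda>n. ennreal (c n))"
    by (intro Liminf_mono) (auto intro!: always_eventually ennreal_leI bound)
  also have "\<dots> = ennreal C"
    by (intro lim_imp_Liminf tendsto_ennrealI c) auto
  finally have fat: "(\<integral>\<^sup>+x. ennreal ((norm (u x))\<^sup>2) \<partial>M) \<le> ennreal C" .
  have u2: "integrable M (\<lambda>x. (norm (u x))\<^sup>2)"
    by (rule integrableI_bounded) (use fat in \<open>auto simp: less_top[symmetric] top_unique\<close>)
  have "(\<integral>x. (norm (u x))\<^sup>2 \<partial>M) \<le> C"
    using fat C u2 by (subst (asm) nn_integral_eq_integral) auto
  then show ?thesis using that u u2 conv by blast
qed

text \<open>Weak compactness in L2 is replaced by a minimization. The derivative of \<open>y\<close>
  is the strong limit of functions \<open>w k\<close> of nearly least energy; these need not be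
  related to the given \<open>u n\<close>, whose role is to show that the admissible sets are
  nonempty and that their least energy is at most \<open>C\<close>.\<close>

theorem weak_derivative_lower_semicontinuous:
  fixes y :: "real \<Rightarrow> 'a::euclidean_space" and z u :: "nat \<Rightarrow> real \<Rightarrow> 'a"
  assumes T: "T > 0"
    and u: "\<And>n. set_integrable lborel {0..T} (u n)"
    and u2: "\<And>n. set_integrable lborel {0..T} (\<lambda>t. (norm (u n t))\<^sup>2)"
    and z: "\<And>n t. t \<in> {0..T} \<Longrightarrow> z n t = z n 0 + (LINT s:{0..t}|lborel. u n s)"
    and bound: "\<And>n. (LINT t:{0..T}|lborel. (norm (u n t))\<^sup>2) \<le> c n" and c: "c \<longlonglongrightarrow> C"
    and unif: "\<And>e. e > 0 \<Longrightarrow> \<exists>N. \<forall>n\<ge>N. \<forall>t\<in>{0..T}. norm (z n t - y t) \<le> e"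
  obtains v where "set_integrable lborel {0..T} v"
    "set_integrable lborel {0..T} (\<lambda>t. (norm (v t))\<^sup>2)"
    "(LINT t:{0..T}|lborel. (norm (v t))\<^sup>2) \<le> C"
    "\<And>t. t \<in> {0..T} \<Longrightarrow> y t = y 0 + (LINT s:{0..t}|lborel. v s)"
proof -
  define M where "M = restrict_space lborel {0..T}"
  have int_M: "integrable M f \<longleftrightarrow> set_integrable lborel {0..T} f" for f :: "real \<Rightarrow> 'b::{banach, second_countable_topology}"
    by (simp add: M_def integrable_restrict_space set_integrable_def)
  have LINT_M: "integral\<^sup>L M f = (LINT t:{0..T}|lborel. f t)" for f :: "real \<Rightarrow> 'b::{banach, second_countable_topology}"
    by (simp add: M_def integral_restrict_space set_lebesgue_integral_def)
  have LINT_A: "(LINT t:A|M. f t) = (LINT t:A|lborel. f t)" if "A \<subseteq> {0..T}"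
    for A and f :: "real \<Rightarrow> 'b::{banach, second_countable_topology}"
    using that unfolding M_def set_lebesgue_integral_def
    by (subst integral_restrict_space)
       (auto intro!: Bochner_Integration.integral_cong simp: indicator_def)
  have fin: "finite_measure M"
    unfolding M_def using T
    by (intro finite_measureI) (simp add: emeasure_restrict_space space_restrict_space)
  have sets_M: "{0..t} \<in> sets M" if "t \<in> {0..T}" for t
    using that by (auto simp: M_def sets_restrict_space intro!: image_eqI[of _ _ "{0..t}"])
  define I where "I w = (\<integral>t. (norm (w t))\<^sup>2 \<partial>M)" for w :: "real \<Rightarrow> 'a"
  define B where "B t w = (LINT s:{0..t}|M. w s)" for t and w :: "real \<Rightarrow> 'a"
  \<comment> \<open>Candidate derivatives whose primitive, with a free starting value
    \<open>p\<close>, stays within \<open>e\<close> of \<open>y\<close>. The condition is convex and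
    tightens as \<open>e\<close> decreases, so \<open>J e\<close> can only grow.\<close>
  define Z where "Z e = {w. integrable M w \<and> integrable M (\<lambda>t. (norm (w t))\<^sup>2) \<and>
      (\<exists>p. \<forall>t\<in>{0..T}. norm (p + B t w - y t) \<le> e)}" for e :: real
  define J where "J e = Inf (I ` Z e)" for e
  have I0: "I w \<ge> 0" for w by (simp add: I_def)
  have bdd: "bdd_below (I ` Z e)" for e by (intro bdd_belowI2[of _ 0] I0)
  have J_le: "J e \<le> I w" if "w \<in> Z e" for e w
    unfolding J_def using that bdd by (auto intro: cInf_lower)
  have uZ: "\<exists>N. \<forall>n\<ge>N. u n \<in> Z e" if e: "e > 0" for e
  proof -
    obtain N where N: "\<forall>n\<ge>N. \<forall>t\<in>{0..T}. norm (z n t - y t) \<le> e" using unif[OF e] by blast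
    have "u n \<in> Z e" if "n \<ge> N" for n
    proof -
      have "norm (z n 0 + B t (u n) - y t) \<le> e" if "t \<in> {0..T}" for t
      proof -
        have "z n 0 + B t (u n) = z n t" using that z[of t n] by (simp add: B_def LINT_A)
        then show ?thesis using N \<open>n \<ge> N\<close> that by metis
      qed
      then show ?thesis using u u2 unfolding Z_def int_M by blast
    qed
    then show ?thesis by blast
  qed
  have Zne: "Z e \<noteq> {}" if "e > 0" for e using uZ[OF that] by auto
  have J_C: "J e \<le> C" if "e > 0" for e
  proof (rule LIMSEQ_le_const[OF c])
    obtain N where "\<forall>n\<ge>N. u n \<in> Z e" using uZ[OF \<open>e > 0\<close>] by blast
    then have "\<forall>n\<ge>N. J e \<le> c n"
      using J_le bound by (fastforce simp: I_def LINT_M intro: order_trans)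
    then show "\<exists>N. \<forall>n\<ge>N. J e \<le> c n" by blast
  qed
  define e where "e k = inverse (real (Suc k))" for k
  have e0: "e k > 0" for k by (simp add: e_def)
  have e_lim: "e \<longlonglongrightarrow> 0" unfolding e_def by (rule LIMSEQ_inverse_real_of_nat)
  have e_mono: "e j \<le> e k" if "k \<le> j" for j k
    using that by (simp add: e_def field_simps)
  have Z_mono: "Z a \<subseteq> Z b" if "a \<le> b" for a b
  proof
    fix w assume w: "w \<in> Z a"
    then obtain p where "\<forall>t\<in>{0..T}. norm (p + B t w - y t) \<le> a" by (auto simp: Z_def)
    then have "\<forall>t\<in>{0..T}. norm (p + B t w - y t) \<le> b" using that by force
    then show "w \<in> Z b" using w unfolding Z_def by blast
  qed
  have J_mono: "J (e k) \<le> J (e j)" if "k \<le> j" for j k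
    unfolding J_def using Z_mono[OF e_mono[OF that]] Zne e0 bdd
    by (intro cInf_superset_mono) auto
  define Ji where "Ji = (SUP k. J (e k))"
  have Ji: "(\<lambda>k. J (e k)) \<longlonglongrightarrow> Ji"
    unfolding Ji_def
    by (rule LIMSEQ_incseq_SUP) (use J_C e0 J_mono in \<open>auto intro!: bdd_aboveI2 monoI\<close>)
  have J_Ji: "J (e k) \<le> Ji" for k
    by (rule incseq_le[OF _ Ji]) (use J_mono in \<open>auto intro: monoI\<close>)
  have "\<exists>w. w \<in> Z (e k) \<and> I w < J (e k) + e k" for k
  proof -
    have "J (e k) < J (e k) + e k" using e0 by simp
    then show ?thesis unfolding J_def using cInf_lessD[of "I ` Z (e k)"] Zne e0 by blast
  qed
  then obtain w where wZ: "\<And>k. w k \<in> Z (e k)" and wI: "\<And>k. I (w k) < J (e k) + e k" by metis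
  have wi: "integrable M (w k)" and wi2: "integrable M (\<lambda>t. (norm (w k t))\<^sup>2)" for k
    using wZ[of k] by (auto simp: Z_def)
  obtain p where p: "\<And>k t. t \<in> {0..T} \<Longrightarrow> norm (p k + B t (w k) - y t) \<le> e k"
  proof -
    have "\<forall>k. \<exists>p. \<forall>t\<in>{0..T}. norm (p + B t (w k) - y t) \<le> e k" using wZ by (auto simp: Z_def)
    then show ?thesis using that by metis
  qed
  \<comment> \<open>The midpoint of two admissible functions is admissible, so the parallelogram law makes
    a minimizing sequence Cauchy.\<close>
  have par: "(\<integral>t. (norm (w j t - w k t))\<^sup>2 \<partial>M) \<le> 2 * (Ji - J (e k)) + 4 * e k"
    if jk: "k \<le> j" for j k
  proof -
    define h where "h t = (1/2) *\<^sub>R (w j t + w k t)" for t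
    have h: "integrable M h" unfolding h_def using wi by auto
    have [measurable]: "w i \<in> borel_measurable M" for i using wi by auto
    have sum_dom: "(norm (w j t + w k t))\<^sup>2 \<le> 2 * ((norm (w j t))\<^sup>2 + (norm (w k t))\<^sup>2)"
      "(norm (w j t - w k t))\<^sup>2 \<le> 2 * ((norm (w j t))\<^sup>2 + (norm (w k t))\<^sup>2)" for t
      using parallelogram_law[of "w j t" "w k t"] zero_le_power2[of "norm (w j t + w k t)"]
        zero_le_power2[of "norm (w j t - w k t)"] by linarith+
    have i1: "integrable M (\<lambda>t. (norm (w j t + w k t))\<^sup>2)"
      and i2: "integrable M (\<lambda>t. (norm (w j t - w k t))\<^sup>2)"
      by (rule Bochner_Integration.integrable_bound[of _ "\<lambda>t. 2 * ((norm (w j t))\<^sup>2 + (norm (w k t))\<^sup>2)"];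
          use wi2 sum_dom in auto)+
    have h_norm: "(norm (h t))\<^sup>2 = (norm (w j t + w k t))\<^sup>2 / 4" for t
      by (simp add: h_def power_divide)
    have h2: "integrable M (\<lambda>t. (norm (h t))\<^sup>2)" unfolding h_norm using i1 by simp
    have "norm ((1/2) *\<^sub>R (p j + p k) + B t h - y t) \<le> e k" if t: "t \<in> {0..T}" for t
    proof -
      have si: "set_integrable M {0..t} (w i)" for i
        using wi sets_M[OF t] unfolding set_integrable_def by (intro integrable_mult_indicator) auto
      have "B t h = (1/2) *\<^sub>R (B t (w j) + B t (w k))"
        unfolding B_def h_def using si by (subst set_integral_scaleR_right, subst set_integral_add) auto
      then have "(1/2) *\<^sub>R (p j + p k) + B t h - y t =
          (1/2) *\<^sub>R (p j + B t (w j) - y t) + (1/2) *\<^sub>R (p k + B t (w k) - y t)"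
        by (simp add: algebra_simps flip: scaleR_add_left)
      also have "norm \<dots> \<le> (1/2) * norm (p j + B t (w j) - y t) + (1/2) * norm (p k + B t (w k) - y t)"
        by (rule order_trans[OF norm_triangle_ineq]) simp
      also have "\<dots> \<le> e k" using p[OF t, of j] p[OF t, of k] e_mono[OF jk] by simp
      finally show ?thesis .
    qed
    then have "h \<in> Z (e k)" using h h2 unfolding Z_def by blast
    then have "J (e k) \<le> I h" by (rule J_le)
    also have "I h = (\<integral>t. (norm (w j t + w k t))\<^sup>2 \<partial>M) / 4"
      unfolding I_def h_norm by simp
    finally have 1: "4 * J (e k) \<le> (\<integral>t. (norm (w j t + w k t))\<^sup>2 \<partial>M)" by simp
    have "(\<integral>t. (norm (w j t + w k t))\<^sup>2 \<partial>M) + (\<integral>t. (norm (w j t - w k t))\<^sup>2 \<partial>M) =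
        (\<integral>t. (norm (w j t + w k t))\<^sup>2 + (norm (w j t - w k t))\<^sup>2 \<partial>M)"
      using i1 i2 by simp
    also have "\<dots> = 2 * (I (w j) + I (w k))"
      unfolding parallelogram_law I_def using wi2 by simp
    finally show ?thesis
      using 1 wI[of j] wI[of k] e_mono[OF jk] J_Ji[of j] by (simp add: algebra_simps)
  qed
  define r where "r k = 2 * (Ji - J (e k)) + 4 * e k" for k
  have "r \<longlonglongrightarrow> 2 * (Ji - Ji) + 4 * 0"
    unfolding r_def by (intro tendsto_intros Ji e_lim)
  then have "\<forall>n. \<exists>K. \<forall>k\<ge>K. norm (r k - 0) < (1/4) ^ n"
    by (intro allI LIMSEQ_D) auto
  then obtain K where K: "\<And>n k. k \<ge> K n \<Longrightarrow> r k \<le> (1/4) ^ n"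
    by (metis abs_le_D1 diff_zero less_imp_le real_norm_def)
  \<comment> \<open>Adding up all previous thresholds makes \<open>s\<close> strictly increasing and
    keeps \<open>s n \<ge> K n\<close>.\<close>
  define s where "s n = (\<Sum>i\<le>n. K i) + n" for n
  have s: "strict_mono s" unfolding s_def by (rule strict_monoI_Suc) simp
  have sK: "s n \<ge> K n" for n by (simp add: s_def sum.remove[of _ n])
  have "(\<lambda>n. J (e (s n)) + e (s n)) \<longlonglongrightarrow> Ji + 0"
    using LIMSEQ_subseq_LIMSEQ[OF Ji s] LIMSEQ_subseq_LIMSEQ[OF e_lim s]
    by (intro tendsto_add) (auto simp: o_def)
  then have lim: "(\<lambda>n. J (e (s n)) + e (s n)) \<longlonglongrightarrow> Ji" by simp
  obtain v where v: "integrable M v" "integrable M (\<lambda>t. (norm (v t))\<^sup>2)" "I v \<le> Ji"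
    and conv: "\<And>A. A \<in> sets M \<Longrightarrow> (\<lambda>n. LINT t:A|M. w (s n) t) \<longlonglongrightarrow> (LINT t:A|M. v t)"
    unfolding I_def
  proof (rule L2_limit_of_fast_Cauchy[OF fin _ _ _ _ lim, of "\<lambda>n. w (s n)"])
    show "(\<integral>t. (norm (w (s (Suc n)) t - w (s n) t))\<^sup>2 \<partial>M) \<le> (1/4) ^ n" for n
      using order_trans[OF par[of "s n" "s (Suc n)"] K[OF sK, unfolded r_def]]
        strict_mono_less_eq[OF s] by simp
    show "(\<integral>t. (norm (w (s n) t))\<^sup>2 \<partial>M) \<le> J (e (s n)) + e (s n)" for n
      using wI[of "s n"] by (simp add: I_def)
  qed (use wi wi2 in auto)
  have yB: "(\<lambda>n. p (s n) + B t (w (s n))) \<longlonglongrightarrow> y t" if "t \<in> {0..T}" for t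
  proof (rule Lim_null[THEN iffD2], rule Lim_null_comparison)
    show "\<forall>\<^sub>F n in sequentially. norm (p (s n) + B t (w (s n)) - y t) \<le> e (s n)"
      using p[OF that] by simp
    show "(\<lambda>n. e (s n)) \<longlonglongrightarrow> 0" using LIMSEQ_subseq_LIMSEQ[OF e_lim s] by (simp add: o_def)
  qed
  have B0: "B 0 f = 0" for f
  proof -
    have "(\<lambda>t. indicator {0..0} t *\<^sub>R f t) = (\<lambda>t. indicator {0} t *\<^sub>R f 0)"
      by (auto simp: fun_eq_iff indicator_def)
    then have "B 0 f = (\<integral>t. indicator {0} t *\<^sub>R f 0 \<partial>lborel)"
      unfolding B_def using T by (subst LINT_A) (auto simp: set_lebesgue_integral_def)
    then show ?thesis by simp
  qed
  \<comment> \<open>At \<open>t = 0\<close> the integral vanishes, which forces the free starting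
    values to converge to \<open>y 0\<close>.\<close>
  have p_lim: "(\<lambda>n. p (s n)) \<longlonglongrightarrow> y 0" using yB[of 0] T by (simp add: B0)
  have y: "y t = y 0 + (LINT s:{0..t}|lborel. v s)" if t: "t \<in> {0..T}" for t
  proof (rule LIMSEQ_unique[OF yB[OF t]])
    have "(\<lambda>n. p (s n) + B t (w (s n))) \<longlonglongrightarrow> y 0 + B t v"
      unfolding B_def by (intro tendsto_add p_lim conv sets_M t)
    then show "(\<lambda>n. p (s n) + B t (w (s n))) \<longlonglongrightarrow> y 0 + (LINT s:{0..t}|lborel. v s)"
      using t by (simp add: B_def LINT_A)
  qed
  have "Ji \<le> C" by (rule LIMSEQ_le_const2[OF Ji]) (use J_C e0 in auto)
  then have "(LINT t:{0..T}|lborel. (norm (v t))\<^sup>2) \<le> C" using v(3) by (simp add: I_def LINT_M)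
  with v(1,2) show ?thesis using y unfolding int_M by (rule that)
qed

section \<open>Weak derivatives\<close>

text \<open>Half-lines form an intersection-stable generator of the Borel sets, so vanishing
  integrals spread from them to all Borel sets. Truncation to \<open>{-N..N}\<close> comes first
  because \<open>h\<close> is only locally integrable.\<close>

lemma AE_zero_of_integral_zero_on_intervals:
  fixes h :: "real \<Rightarrow> real"
  assumes int: "\<And>a b. a \<le> b \<Longrightarrow> set_integrable lborel {a..b} h"
    and zero: "\<And>a b. a \<le> b \<Longrightarrow> (LINT t:{a..b}|lborel. h t) = 0"
  shows "AE t in lborel. h t = 0"
proof -
  have "AE t in lborel. indicator {-real N..real N} t *\<^sub>R h t = 0" for N :: nat
  proof -
    define f where "f t = indicator {-real N..real N} t *\<^sub>R h t" for t
    have f: "integrable lborel f" using int[of "-real N" "real N"] by (simp add: f_def[abs_def] set_integrable_def)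
    have sf: "set_integrable lborel A f" if "A \<in> sets borel" for A
      using f that unfolding set_integrable_def by (intro integrable_mult_indicator) auto
    have atMost: "(LINT t:{..a}|lborel. f t) = 0" for a
    proof -
      have "(LINT t:{..a}|lborel. f t) = (LINT t:{-real N..min a (real N)}|lborel. h t)"
        unfolding set_lebesgue_integral_def f_def
        by (intro Bochner_Integration.integral_cong) (auto simp: indicator_def)
      also have "\<dots> = 0"
        by (cases "-real N \<le> min a (real N)") (use zero in \<open>auto simp: set_lebesgue_integral_def\<close>)
      finally show ?thesis .
    qed
    have whole: "(\<integral>t. f t \<partial>lborel) = 0"
      using zero[of "-real N" "real N"] by (simp add: f_def[abs_def] set_lebesgue_integral_def)
    have "(LINT t:A|lborel. f t) = 0" if "A \<in> sigma_sets UNIV (range atMost)" for A :: "real set"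
    proof -
      have "Int_stable (range (atMost :: real \<Rightarrow> _))" by (auto simp: Int_stable_def)
      moreover have "range (atMost :: real \<Rightarrow> _) \<subseteq> Pow UNIV" by simp
      ultimately show ?thesis using that
      proof (induction rule: sigma_sets_induct_disjoint)
        case (compl A)
        then have A: "A \<in> sets borel"
          by (simp add: borel_eq_atMost)
        have "(LINT t:A \<union> (UNIV - A)|lborel. f t) = (LINT t:A|lborel. f t) + (LINT t:UNIV - A|lborel. f t)"
          by (rule set_integral_Un) (use A in \<open>auto intro!: sf\<close>)
        then show ?case using compl whole by (simp add: set_lebesgue_integral_def)
      next
        case (union A)
        then have A: "A i \<in> sets borel" for i
          by (auto simp: borel_eq_atMost)
        have "(LINT t:(\<Union>i. A i)|lborel. f t) = (\<Sum>i. LINT t:A i|lborel. f t)"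
          by (rule lebesgue_integral_countable_add)
             (use union A in \<open>auto intro!: sf simp: disjoint_family_on_def\<close>)
        then show ?case using union by simp
      next
        case (basic A)
        then show ?case using atMost by auto
      next
        case empty
        show ?case by (simp add: set_lebesgue_integral_def)
      qed
    qed
    then have "(LINT t:A|lborel. f t) = 0" if "A \<in> sets lborel" for A
      using that by (simp add: borel_eq_atMost)
    then have "AE t in lborel. f t = 0"
      by (intro density_unique_real f) (auto simp: set_lebesgue_integral_def)
    then show ?thesis by (simp add: f_def)
  qed
  then have "AE t in lborel. \<forall>N. indicator {-real N..real N} t *\<^sub>R h t = 0"
    by (subst AE_all_countable) blast
  then show ?thesis
  proof eventually_elim
    case (elim t)
    obtain N where "\<bar>t\<bar> \<le> real N" using real_arch_simple by blast
    then show ?case using elim[rule_format, of N] by (auto simp: indicator_def)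
  qed
qed

text \<open>This makes the choice in \<open>weak_derivative\<close> harmless: the action and square
  integrability may be computed with any weak derivative.\<close>

lemma has_weak_derivative_unique:
  assumes "has_weak_derivative x v" "has_weak_derivative x w"
  shows "AE t in lborel. v t = w t"
proof -
  have int: "set_integrable lborel {a..b} (\<lambda>t. v t - w t)"
    and zero: "(LINT t:{a..b}|lborel. v t - w t) = 0" if "a \<le> b" for a b
    using assms that unfolding has_weak_derivative_def by (auto simp: set_integral_diff)
  have "AE t in lborel. (v t - w t) \<bullet> k = 0" for k
  proof (rule AE_zero_of_integral_zero_on_intervals)
    fix a b :: real assume ab: "a \<le> b"
    show "set_integrable lborel {a..b} (\<lambda>t. (v t - w t) \<bullet> k)"
      using integrable_inner_left[OF int[OF ab, unfolded set_integrable_def], of k]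
      by (simp add: set_integrable_def)
    have "(LINT t:{a..b}|lborel. (v t - w t) \<bullet> k) = (LINT t:{a..b}|lborel. v t - w t) \<bullet> k"
      using integral_inner_left[OF int[OF ab, unfolded set_integrable_def], of k]
      by (simp add: set_lebesgue_integral_def)
    then show "(LINT t:{a..b}|lborel. (v t - w t) \<bullet> k) = 0" using zero[OF ab] by simp
  qed
  then have "AE t in lborel. \<forall>k\<in>Basis. (v t - w t) \<bullet> k = 0"
    by (intro AE_finite_allI) auto
  then show ?thesis by eventually_elim (metis eq_iff_diff_eq_0 euclidean_all_zero_iff)
qed

lemma has_weak_derivative_weak_derivative:
  "has_weak_derivative x v \<Longrightarrow> has_weak_derivative x (weak_derivative x)"
  unfolding weak_derivative_def by (rule someI[of "has_weak_derivative x"])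

lemma has_weak_derivative_linear_combination:
  assumes "has_weak_derivative x v" "has_weak_derivative y w"
  shows "has_weak_derivative (\<lambda>t. x t + c *\<^sub>R y t) (\<lambda>t. v t + c *\<^sub>R w t)"
  unfolding has_weak_derivative_def
proof (intro allI impI conjI)
  fix a b :: real assume ab: "a \<le> b"
  have v: "set_integrable lborel {a..b} v" and w: "set_integrable lborel {a..b} (\<lambda>t. c *\<^sub>R w t)"
    and e: "x b - x a = (LINT t:{a..b}|lborel. v t)" "y b - y a = (LINT t:{a..b}|lborel. w t)"
    using assms ab by (auto simp: has_weak_derivative_def)
  show "set_integrable lborel {a..b} (\<lambda>t. v t + c *\<^sub>R w t)" using v w by simp
  have "x b + c *\<^sub>R y b - (x a + c *\<^sub>R y a) = (x b - x a) + c *\<^sub>R (y b - y a)"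
    by (simp add: algebra_simps)
  then show "x b + c *\<^sub>R y b - (x a + c *\<^sub>R y a) = (LINT t:{a..b}|lborel. v t + c *\<^sub>R w t)"
    using v w by (simp add: e)
qed

lemma has_weak_derivative_of_vector_derivative:
  assumes d: "\<And>t. (x has_vector_derivative v t) (at t)" and v: "continuous_on UNIV v"
  shows "has_weak_derivative x v"
  unfolding has_weak_derivative_def
proof (intro allI impI conjI)
  fix a b :: real assume ab: "a \<le> b"
  have c: "continuous_on {a..b} v" using v continuous_on_subset by blast
  show "set_integrable lborel {a..b} v"
    using borel_integrable_atLeastAtMost'[OF c] .
  show "x b - x a = (LINT t:{a..b}|lborel. v t)"
    unfolding set_lebesgue_integral_def
    by (rule integral_FTC_atLeastAtMost[symmetric])
       (use ab c d in \<open>auto intro: has_vector_derivative_at_within\<close>)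
qed

lemma has_weak_derivative_borel_measurable:
  assumes "has_weak_derivative x v"
  shows "v \<in> borel_measurable borel"
proof -
  have m: "(\<lambda>t. indicator {-real n..real n} t *\<^sub>R v t) \<in> borel_measurable borel" for n
    using assms[unfolded has_weak_derivative_def, rule_format, of "-real n" "real n"]
    by (auto simp: set_integrable_def dest!: borel_measurable_integrable)
  show ?thesis
  proof (rule borel_measurable_LIMSEQ_metric[OF m])
    fix t :: real
    obtain N where "\<bar>t\<bar> \<le> real N" using real_arch_simple by blast
    then have "\<forall>\<^sub>F n in sequentially. indicator {-real n..real n} t *\<^sub>R v t = v t"
      by (intro eventually_sequentiallyI[of N]) (auto simp: indicator_def)
    then show "(\<lambda>n. indicator {-real n..real n} t *\<^sub>R v t) \<longlonglongrightarrow> v t"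
      by (rule tendsto_eventually)
  qed
qed

lemma has_weak_derivative_continuous:
  assumes "has_weak_derivative x v"
  shows "continuous_on UNIV x"
proof -
  have "continuous_on {-a<..<a} x" for a :: real
  proof (cases "a > 0")
    case True
    have i: "set_integrable lborel {-a..b} v" if "-a \<le> b" for b
      using assms that by (auto simp: has_weak_derivative_def)
    have "continuous_on {-a..a} (\<lambda>t. x (-a) + integral {-a..t} v)"
      using i[of a] True
      by (intro continuous_intros indefinite_integral_continuous_1 set_borel_integral_eq_integral) auto
    then have "continuous_on {-a<..<a} (\<lambda>t. x (-a) + integral {-a..t} v)"
      by (rule continuous_on_subset) auto
    moreover have "x t = x (-a) + integral {-a..t} v" if "t \<in> {-a<..<a}" for t
    proof -
      have "-a \<le> t" using that by auto
      then have "x t - x (-a) = (LINT t:{-a..t}|lborel. v t)"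
        using assms by (auto simp: has_weak_derivative_def)
      then show ?thesis using set_borel_integral_eq_integral(2)[OF i[OF \<open>-a \<le> t\<close>]]
        by (simp add: algebra_simps)
    qed
    ultimately show ?thesis by (metis (no_types, lifting) continuous_on_cong)
  qed simp
  then have "continuous_on (\<Union>a::real. {-a<..<a}) x"
    by (intro continuous_on_open_UN) auto
  also have "(\<Union>a::real. {-a<..<a}) = UNIV"
  proof -
    have "t \<in> (\<Union>a::real. {-a<..<a})" for t
      by (rule UN_I[of "\<bar>t\<bar> + 1"]) auto
    then show ?thesis by blast
  qed
  finally show ?thesis .
qed

section \<open>Periodic functions and the periodic extension of a weak derivative\<close>

lemma periodic_of_int:
  fixes x :: "real \<Rightarrow> 'a" and k :: int
  assumes "\<And>t. x (t + T) = x t"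
  shows "x (t + of_int k * T) = x t"
proof (induction k rule: int_induct[of _ 0])
  case (step1 i)
  then show ?case using assms[of "t + of_int i * T"] by (simp add: algebra_simps)
next
  case (step2 i)
  then show ?case using assms[of "t + of_int (i - 1) * T"] by (simp add: algebra_simps)
qed simp

lemma rmod_eq_add_int:
  fixes t T :: real
  obtains k :: int where "t rmod T = t + of_int k * T"
  by (metis rcong_def rcong_altdef rmod_rmod)

lemma periodic_rmod:
  fixes x :: "real \<Rightarrow> 'a"
  assumes "\<And>t. x (t + T) = x t"
  shows "x (t rmod T) = x t"
  using rmod_eq_add_int[of t T] periodic_of_int[of x T, OF assms] by metis

text \<open>Lower semicontinuity delivers a derivative on one period, whereas
  \<open>has_weak_derivative\<close> concerns every interval of the line. The integral equation is
  shifted by multiples of \<open>T\<close> and glued at the multiples of \<open>T\<close>.\<close>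

lemma has_weak_derivative_periodic_extension:
  fixes x v :: "real \<Rightarrow> complex^4"
  assumes T: "T > 0" and per: "\<And>t. x (t + T) = x t"
    and v: "set_integrable lborel {0..T} v"
    and x: "\<And>t. t \<in> {0..T} \<Longrightarrow> x t = x 0 + (LINT s:{0..t}|lborel. v s)"
  shows "has_weak_derivative x (\<lambda>t. v (t rmod T))"
proof -
  define w where "w t = v (t rmod T)" for t
  define P where "P a b \<longleftrightarrow> set_integrable lborel {a..b} w \<and> x b - x a = (LINT t:{a..b}|lborel. w t)"
    for a b
  have wper: "w (t + of_int k * T) = w t" for t and k :: int
  proof -
    have "(t + of_int k * T) rmod T = t rmod T"
      using rcong_altdef[of t "t + of_int k * T" T] by (simp add: rcong_def)
    then show ?thesis by (simp add: w_def)
  qed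
  have v_sub: "set_integrable lborel {a..b} v" if "0 \<le> a" "b \<le> T" for a b
    by (rule set_integrable_subset[OF v]) (use that in auto)
  have base: "P a b" if ab: "0 \<le> a" "a \<le> b" "b \<le> T" for a b
  proof -
    \<comment> \<open>Since \<open>T rmod T = 0\<close>, the extension takes the value
      \<open>v 0\<close> and not \<open>v T\<close> at the right end; the correction lives on a null
      set.\<close>
    have eq: "(\<lambda>t. indicator {a..b} t *\<^sub>R w t) =
        (\<lambda>t. indicator {a..b} t *\<^sub>R v t + indicator ({a..b} \<inter> {T}) t *\<^sub>R (v 0 - v T))"
    proof
      fix t show "indicator {a..b} t *\<^sub>R w t =
        indicator {a..b} t *\<^sub>R v t + indicator ({a..b} \<inter> {T}) t *\<^sub>R (v 0 - v T)"
        using ab T by (cases "t \<in> {a..b}"; cases "t = T") (auto simp: w_def)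
    qed
    have null: "emeasure lborel ({a..b} \<inter> {T}) = 0"
      by (metis emeasure_lborel_countable countable_empty countable_finite finite_Int finite.emptyI finite_insert)
    have i2: "integrable lborel (\<lambda>t. indicator ({a..b} \<inter> {T}) t *\<^sub>R (v 0 - v T))"
      using null by (intro integrable_scaleR_left) (auto simp: integrable_indicator_iff)
    have i1: "integrable lborel (\<lambda>t. indicator {a..b} t *\<^sub>R v t)"
      using v_sub[of a b] ab by (simp add: set_integrable_def)
    have "(LINT t:{a..b}|lborel. w t) = (LINT t:{a..b}|lborel. v t)"
      unfolding set_lebesgue_integral_def eq using i1 i2 null by (simp add: measure_def)
    also have "\<dots> = integral {a..b} v"
      using v_sub[of a b] ab by (simp add: set_borel_integral_eq_integral)
    also have "\<dots> = integral {0..b} v - integral {0..a} v"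
      using Henstock_Kurzweil_Integration.integral_combine[of 0 a b v] set_borel_integral_eq_integral(1)[OF v_sub[of 0 b]] ab
      by (simp add: algebra_simps)
    also have "\<dots> = x b - x a"
      using x[of a] x[of b] v_sub[of 0 a] v_sub[of 0 b] ab
      by (simp add: set_borel_integral_eq_integral)
    finally show ?thesis
      using i1 i2 unfolding P_def set_integrable_def eq by simp
  qed
  have combine: "P a c" if ab: "P a b" "P b c" "a \<le> b" "b \<le> c" for a b c
  proof -
    have "set_integrable lborel ({a..b} \<union> {b..c}) w"
      using ab by (intro set_integrable_Un) (auto simp: P_def)
    then have i: "set_integrable lborel {a..c} w"
      using ab by (simp add: ivl_disj_un_two_touch)
    then have "(LINT t:{a..c}|lborel. w t) = (LINT t:{a..b}|lborel. w t) + (LINT t:{b..c}|lborel. w t)"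
      using ab Henstock_Kurzweil_Integration.integral_combine[of a b c w]
      by (simp add: set_borel_integral_eq_integral P_def)
    then show ?thesis using ab i unfolding P_def by (metis add_diff_cancel_left' add_diff_eq diff_add_cancel)
  qed
  have shift: "P (a + of_int k * T) (b + of_int k * T)" if "P a b" for a b and k :: int
  proof -
    define c where "c = of_int k * T"
    have e: "indicator {a + c..b + c} (c + 1 * t) *\<^sub>R w (c + 1 * t) = indicator {a..b} t *\<^sub>R w t" for t
      using wper[of t k] by (auto simp: indicator_def c_def add.commute)
    have "set_integrable lborel {a + c..b + c} w"
      using that lborel_integrable_real_affine_iff[of 1 "\<lambda>t. indicator {a + c..b + c} t *\<^sub>R w t" c]
      unfolding e P_def set_integrable_def by simp
    moreover have "(LINT t:{a + c..b + c}|lborel. w t) = (LINT t:{a..b}|lborel. w t)"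
      using lborel_integral_real_affine[of 1 "\<lambda>t. indicator {a + c..b + c} t *\<^sub>R w t" c]
      unfolding e set_lebesgue_integral_def by simp
    ultimately show ?thesis
      using that periodic_of_int[of x T, OF per] by (simp add: P_def c_def)
  qed
  have cell: "P a b" if ab: "a \<le> b" "of_int k * T \<le> a" "b \<le> of_int (k + 1) * T" for a b and k :: int
    using shift[OF base[of "a - of_int k * T" "b - of_int k * T"], of k] ab by (simp add: algebra_simps)
  \<comment> \<open>An interval of length at most \<open>T\<close> meets at most one multiple of
    \<open>T\<close> in its interior, so two cells suffice.\<close>
  have short: "P a b" if ab: "a \<le> b" "b \<le> a + T" for a b
  proof -
    define k where "k = \<lfloor>a / T\<rfloor>"
    have k: "of_int k * T \<le> a" "a < of_int (k + 1) * T"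
      using floor_divide_lower[OF T, of a] floor_divide_upper[OF T, of a]
      by (auto simp: k_def algebra_simps)
    show ?thesis
    proof (cases "b \<le> of_int (k + 1) * T")
      case True then show ?thesis using cell k ab by auto
    next
      case False
      have "b \<le> of_int (k + 1 + 1) * T" using ab k by (simp add: algebra_simps)
      then show ?thesis
        using combine[OF cell[of a "of_int (k + 1) * T" k] cell[of "of_int (k + 1) * T" b "k + 1"]] k False
        by auto
    qed
  qed
  have "P a b" if "a \<le> b" "b \<le> a + real n * T" for n a b
    using that
  proof (induction n arbitrary: a)
    case 0
    then show ?case using short[of a b] T by simp
  next
    case (Suc n)
    show ?case
    proof (cases "b \<le> a + T")
      case True then show ?thesis using short Suc.prems by blast
    next
      case False
      then have "P (a + T) b" using Suc by (auto simp: algebra_simps)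
      then show ?thesis using combine[OF short[of a "a + T"]] False T by auto
    qed
  qed
  moreover have "\<exists>n. b \<le> a + real n * T" for a b
  proof -
    obtain n where "(b - a) / T \<le> real n" using real_arch_simple by blast
    then show ?thesis using T by (intro exI[of _ n]) (simp add: field_simps)
  qed
  ultimately show ?thesis unfolding has_weak_derivative_def w_def[symmetric] P_def by blast
qed

text \<open>The integrability known of \<open>\<eta>\<close> is that of a weak derivative, so the
  product rule is replaced by Fubini for \<open>f t \<bullet> \<eta> s\<close> on the triangle
  \<open>s \<le> t\<close>. The inner integrals are \<open>\<psi> T - \<psi> s\<close> and
  \<open>\<phi> t - \<phi> 0\<close>; the equal end values remove the boundary terms.\<close>

lemma integral_by_parts_weak_derivative:
  fixes \<phi> \<eta> \<psi> f :: "real \<Rightarrow> complex^4"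
  assumes T: "T > 0" and \<eta>: "has_weak_derivative \<phi> \<eta>"
    and \<psi>: "\<And>t. (\<psi> has_vector_derivative f t) (at t)" and f: "continuous_on UNIV f"
    and \<phi>T: "\<phi> T = \<phi> 0" and \<psi>T: "\<psi> T = \<psi> 0"
  shows "set_integrable lborel {0..T} (\<lambda>t. \<psi> t \<bullet> \<eta> t)"
    and "(LINT t:{0..T}|lborel. \<psi> t \<bullet> \<eta> t) = - (LINT t:{0..T}|lborel. f t \<bullet> \<phi> t)"
proof -
  have [measurable]: "\<eta> \<in> borel_measurable borel"
    using has_weak_derivative_borel_measurable[OF \<eta>] .
  have \<psi>c: "continuous_on UNIV \<psi>"
    by (meson \<psi> has_vector_derivative_continuous continuous_at_imp_continuous_on)
  have \<phi>c: "continuous_on UNIV \<phi>" using has_weak_derivative_continuous[OF \<eta>] .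
  have [measurable]: "f \<in> borel_measurable borel" "\<psi> \<in> borel_measurable borel" "\<phi> \<in> borel_measurable borel"
    using f \<psi>c \<phi>c by (auto intro: borel_measurable_continuous_onI)
  have si: "set_integrable lborel {a..b} \<eta>" if "a \<le> b" for a b
    using \<eta> that by (auto simp: has_weak_derivative_def)
  have cs: "\<bar>u \<bullet> w\<bar> \<le> k * norm w" if "norm u \<le> k" for u w :: "complex^4" and k
    by (rule order_trans[OF Cauchy_Schwarz_ineq2 mult_right_mono[OF that]]) simp
  have cont_bound: "\<exists>K\<ge>0. \<forall>t\<in>{0..T}. norm (g t) \<le> K" if "continuous_on UNIV g" for g :: "real \<Rightarrow> complex^4"
  proof -
    have "compact (g ` {0..T})"
      by (intro compact_continuous_image continuous_on_subset[OF that]) auto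
    then obtain K where "\<forall>t\<in>{0..T}. norm (g t) \<le> K" by (auto dest!: compact_imp_bounded simp: bounded_iff)
    then show ?thesis using T by (intro exI[of _ "max K 0"]) auto
  qed
  obtain K where K: "K \<ge> 0" "\<And>t. t \<in> {0..T} \<Longrightarrow> norm (f t) \<le> K" using cont_bound[OF f] by blast
  obtain K' where K': "K' \<ge> 0" "\<And>t. t \<in> {0..T} \<Longrightarrow> norm (\<psi> t) \<le> K'" using cont_bound[OF \<psi>c] by blast
  have in\<eta>: "integrable lborel (\<lambda>t. indicator {0..T} t * norm (\<eta> t))"
    using integrable_norm[OF si[of 0 T, unfolded set_integrable_def]] T by simp
  show 1: "set_integrable lborel {0..T} (\<lambda>t. \<psi> t \<bullet> \<eta> t)"
    unfolding set_integrable_def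
  proof (rule Bochner_Integration.integrable_bound)
    show "integrable lborel (\<lambda>t. K' * (indicator {0..T} t * norm (\<eta> t)))" using in\<eta> by simp
    have "norm (indicator {0..T} t *\<^sub>R (\<psi> t \<bullet> \<eta> t)) \<le> norm (K' * (indicator {0..T} t * norm (\<eta> t)))" for t
      using K'(1) K'(2)[of t] by (auto simp: indicator_def intro!: cs)
    then show "AE t in lborel. norm (indicator {0..T} t *\<^sub>R (\<psi> t \<bullet> \<eta> t)) \<le>
        norm (K' * (indicator {0..T} t * norm (\<eta> t)))" by simp
  qed measurable
  define F where "F s t = indicator {0..T} s * indicator {0..T} t * (if s \<le> t then f t \<bullet> \<eta> s else 0)"
    for s t
  have F_t: "has_bochner_integral lborel (F s) (indicator {0..T} s * ((\<psi> T - \<psi> s) \<bullet> \<eta> s))" for s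
  proof (cases "s \<in> {0..T}")
    case True
    have "has_bochner_integral lborel (\<lambda>t. indicator {s..T} t *\<^sub>R f t) (\<psi> T - \<psi> s)"
      by (rule has_bochner_integral_FTC_Icc)
         (use True \<psi> f in \<open>auto intro: has_vector_derivative_at_within continuous_on_subset\<close>)
    then have "has_bochner_integral lborel (\<lambda>t. (indicator {s..T} t *\<^sub>R f t) \<bullet> \<eta> s) ((\<psi> T - \<psi> s) \<bullet> \<eta> s)"
      by (rule has_bochner_integral_inner_left)
    moreover have "F s = (\<lambda>t. (indicator {s..T} t *\<^sub>R f t) \<bullet> \<eta> s)"
      using True by (auto simp: fun_eq_iff F_def indicator_def)
    ultimately show ?thesis using True by simp
  qed (auto simp: F_def[abs_def] has_bochner_integral_zero)
  have F_s: "has_bochner_integral lborel (\<lambda>s. F s t) (indicator {0..T} t * (f t \<bullet> (\<phi> t - \<phi> 0)))" for t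
  proof (cases "t \<in> {0..T}")
    case True
    then have "has_bochner_integral lborel (\<lambda>s. indicator {0..t} s *\<^sub>R \<eta> s) (\<phi> t - \<phi> 0)"
      using \<eta> by (auto simp: has_weak_derivative_def has_bochner_integral_iff set_integrable_def
          set_lebesgue_integral_def)
    then have "has_bochner_integral lborel (\<lambda>s. f t \<bullet> (indicator {0..t} s *\<^sub>R \<eta> s)) (f t \<bullet> (\<phi> t - \<phi> 0))"
      by (rule has_bochner_integral_inner_right)
    moreover have "(\<lambda>s. F s t) = (\<lambda>s. f t \<bullet> (indicator {0..t} s *\<^sub>R \<eta> s))"
      using True by (auto simp: fun_eq_iff F_def indicator_def)
    ultimately show ?thesis using True by simp
  qed (auto simp: F_def[abs_def] has_bochner_integral_zero)
  have [measurable]: "case_prod F \<in> borel_measurable (lborel \<Otimes>\<^sub>M lborel)"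
    unfolding F_def by measurable
  have "integrable (lborel \<Otimes>\<^sub>M lborel) (case_prod F)"
  proof (rule lborel_pair.Fubini_integrable)
    show "AE s in lborel. integrable lborel (\<lambda>t. case_prod F (s, t))"
      using F_t by (auto simp: has_bochner_integral_iff)
    show "integrable lborel (\<lambda>s. \<integral>t. norm (case_prod F (s, t)) \<partial>lborel)"
    proof (rule Bochner_Integration.integrable_bound)
      show "integrable lborel (\<lambda>s. T * K * (indicator {0..T} s * norm (\<eta> s)))" using in\<eta> by simp
      have "(\<integral>t. norm (F s t) \<partial>lborel) \<le> T * K * (indicator {0..T} s * norm (\<eta> s))" for s
      proof -
        have "(\<integral>t. norm (F s t) \<partial>lborel) \<le>
            (\<integral>t. indicator {0..T} t * (K * (indicator {0..T} s * norm (\<eta> s))) \<partial>lborel)"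
        proof (rule integral_mono)
          show "integrable lborel (\<lambda>t. norm (F s t))"
            using F_t[of s] by (auto simp: has_bochner_integral_iff)
          show "integrable lborel (\<lambda>t. indicator {0..T} t * (K * (indicator {0..T} s * norm (\<eta> s))))"
            using T by (intro integrable_mult_left integrable_real_indicator) auto
          show "norm (F s t) \<le> indicator {0..T} t * (K * (indicator {0..T} s * norm (\<eta> s)))" for t
            using K(1) K(2)[of t]
            by (auto simp: F_def indicator_def intro!: cs)
        qed
        also have "\<dots> = T * K * (indicator {0..T} s * norm (\<eta> s))" using T by simp
        finally show ?thesis .
      qed
      then show "AE s in lborel. norm (\<integral>t. norm (case_prod F (s, t)) \<partial>lborel) \<le>
          norm (T * K * (indicator {0..T} s * norm (\<eta> s)))"
        using K(1) T by auto
    qed measurable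
  qed measurable
  from lborel_pair.Fubini_integral[OF this]
  have "(\<integral>t. indicator {0..T} t * (f t \<bullet> (\<phi> t - \<phi> 0)) \<partial>lborel) =
      (\<integral>s. indicator {0..T} s * ((\<psi> T - \<psi> s) \<bullet> \<eta> s) \<partial>lborel)"
    using has_bochner_integral_integral_eq[OF F_t] has_bochner_integral_integral_eq[OF F_s] by simp
  also have "(\<integral>t. indicator {0..T} t * (f t \<bullet> (\<phi> t - \<phi> 0)) \<partial>lborel) = (LINT t:{0..T}|lborel. f t \<bullet> \<phi> t)"
  proof -
    have i1: "set_integrable lborel {0..T} (\<lambda>t. f t \<bullet> \<phi> t)"
      by (intro borel_integrable_atLeastAtMost' continuous_intros)
         (use f \<phi>c continuous_on_subset in blast)+
    have "has_bochner_integral lborel (\<lambda>t. indicator {0..T} t *\<^sub>R f t) (\<psi> T - \<psi> 0)"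
      by (rule has_bochner_integral_FTC_Icc)
         (use T \<psi> f in \<open>auto intro: has_vector_derivative_at_within continuous_on_subset\<close>)
    then have "has_bochner_integral lborel (\<lambda>t. (indicator {0..T} t *\<^sub>R f t) \<bullet> \<phi> 0) ((\<psi> T - \<psi> 0) \<bullet> \<phi> 0)"
      by (rule has_bochner_integral_inner_left)
    then have i2: "set_integrable lborel {0..T} (\<lambda>t. f t \<bullet> \<phi> 0)" "(LINT t:{0..T}|lborel. f t \<bullet> \<phi> 0) = 0"
      using \<psi>T by (auto simp: has_bochner_integral_iff set_integrable_def set_lebesgue_integral_def)
    have "(\<integral>t. indicator {0..T} t * (f t \<bullet> (\<phi> t - \<phi> 0)) \<partial>lborel) =
        (LINT t:{0..T}|lborel. f t \<bullet> \<phi> t - f t \<bullet> \<phi> 0)"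
      by (simp add: set_lebesgue_integral_def inner_diff_right)
    also have "\<dots> = (LINT t:{0..T}|lborel. f t \<bullet> \<phi> t)" using i1 i2 by (simp add: set_integral_diff)
    finally show ?thesis .
  qed
  also have "(\<integral>s. indicator {0..T} s * ((\<psi> T - \<psi> s) \<bullet> \<eta> s) \<partial>lborel) = - (LINT t:{0..T}|lborel. \<psi> t \<bullet> \<eta> t)"
  proof -
    have "has_bochner_integral lborel (\<lambda>s. indicator {0..T} s *\<^sub>R \<eta> s) (\<phi> T - \<phi> 0)"
      using \<eta> T by (auto simp: has_weak_derivative_def has_bochner_integral_iff set_integrable_def
          set_lebesgue_integral_def)
    then have "has_bochner_integral lborel (\<lambda>s. \<psi> T \<bullet> (indicator {0..T} s *\<^sub>R \<eta> s)) (\<psi> T \<bullet> (\<phi> T - \<phi> 0))"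
      by (rule has_bochner_integral_inner_right)
    then have i2: "set_integrable lborel {0..T} (\<lambda>t. \<psi> T \<bullet> \<eta> t)" "(LINT t:{0..T}|lborel. \<psi> T \<bullet> \<eta> t) = 0"
      using \<phi>T by (auto simp: has_bochner_integral_iff set_integrable_def set_lebesgue_integral_def)
    have "(\<integral>s. indicator {0..T} s * ((\<psi> T - \<psi> s) \<bullet> \<eta> s) \<partial>lborel) =
        (LINT t:{0..T}|lborel. \<psi> T \<bullet> \<eta> t - \<psi> t \<bullet> \<eta> t)"
      by (simp add: set_lebesgue_integral_def inner_diff_left)
    also have "\<dots> = - (LINT t:{0..T}|lborel. \<psi> t \<bullet> \<eta> t)" using 1 i2 by (simp add: set_integral_diff)
    finally show ?thesis .
  qed
  finally show "(LINT t:{0..T}|lborel. \<psi> t \<bullet> \<eta> t) = - (LINT t:{0..T}|lborel. f t \<bullet> \<phi> t)" by simp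
qed

section \<open>The action of a loop\<close>

text \<open>First-order expansion in \<open>s\<close> with a remainder that depends on
  \<open>a\<close> and \<open>b\<close> only through \<open>\<delta>\<close> and \<open>K\<close>,
  hence is uniform along a loop. The condition on \<open>s\<close> keeps
  \<open>a - s *\<^sub>R b\<close> at norm at least \<open>\<delta> / 2\<close>.\<close>

lemma inverse_norm_upper_Taylor:
  fixes a b :: "'a::real_inner"
  assumes \<delta>: "\<delta> > 0" "\<delta> \<le> norm a" and b: "norm b \<le> K" and s: "0 \<le> s" "s * K \<le> \<delta> / 2"
  shows "1 / norm (a - s *\<^sub>R b) \<le> 1 / norm a + s * (a \<bullet> b) / norm a ^ 3 + s\<^sup>2 * (3 * K\<^sup>2 / \<delta> ^ 3)"
proof -
  define p p0 where "p = norm (a - s *\<^sub>R b)" and "p0 = norm a"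
  have p0: "p0 \<ge> \<delta>" "p0 > 0" using \<delta> by (auto simp: p0_def)
  have "\<bar>p - p0\<bar> \<le> norm (s *\<^sub>R b)"
    unfolding p_def p0_def using norm_triangle_ineq3[of "a - s *\<^sub>R b" a] by simp
  also have "\<dots> \<le> s * K" using s b by (simp add: mult_left_mono)
  finally have d: "\<bar>p - p0\<bar> \<le> s * K" .
  have p: "p \<ge> \<delta> / 2" "p > 0" using d s p0 \<delta> by auto
  have d2: "(p - p0)\<^sup>2 \<le> s\<^sup>2 * K\<^sup>2"
    using power_mono[OF d, of 2] by (simp add: power_mult_distrib)
  have sq: "p\<^sup>2 = p0\<^sup>2 - 2 * s * (a \<bullet> b) + s\<^sup>2 * (b \<bullet> b)"
    unfolding p_def p0_def
    unfolding power2_norm_eq_inner by (simp add: inner_simps inner_commute power2_eq_square algebra_simps)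
  \<comment> \<open>An exact identity: the expansion is in \<open>p\<^sup>2 - p0\<^sup>2\<close>,
    which is polynomial in \<open>s\<close>, and both remainders carry the factor
    \<open>(p - p0)\<^sup>2\<close>.\<close>
  have "1 / p = 1 / p0 - (p\<^sup>2 - p0\<^sup>2) / (2 * p0 ^ 3) + (p - p0)\<^sup>2 / (2 * p0 ^ 3) + (p - p0)\<^sup>2 / (p * p0\<^sup>2)"
    using p p0 by (simp add: field_simps power2_eq_square power3_eq_cube)
  also have "(p\<^sup>2 - p0\<^sup>2) / (2 * p0 ^ 3) = - (s * (a \<bullet> b) / p0 ^ 3) + s\<^sup>2 * (b \<bullet> b) / (2 * p0 ^ 3)"
    unfolding sq using p0 by (simp add: field_simps)
  also have "1 / p0 - (- (s * (a \<bullet> b) / p0 ^ 3) + s\<^sup>2 * (b \<bullet> b) / (2 * p0 ^ 3)) \<le> 1 / p0 + s * (a \<bullet> b) / p0 ^ 3"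
    using p0 by simp
  also have "(p - p0)\<^sup>2 / (2 * p0 ^ 3) \<le> s\<^sup>2 * K\<^sup>2 / (2 * \<delta> ^ 3)"
    by (intro frac_le d2 mult_left_mono power_mono) (use p0 \<delta> in auto)
  also have "(p - p0)\<^sup>2 / (p * p0\<^sup>2) \<le> s\<^sup>2 * K\<^sup>2 / (\<delta> / 2 * \<delta>\<^sup>2)"
    by (intro frac_le d2 mult_mono power_mono) (use p p0 \<delta> in auto)
  also have "s\<^sup>2 * K\<^sup>2 / (\<delta> / 2 * \<delta>\<^sup>2) = 2 * (s\<^sup>2 * K\<^sup>2) / \<delta> ^ 3"
    using \<delta>(1) by (simp add: power2_eq_square power3_eq_cube field_simps)
  finally have "1 / p \<le> 1 / p0 + s * (a \<bullet> b) / p0 ^ 3 + s\<^sup>2 * K\<^sup>2 / (2 * \<delta> ^ 3) + 2 * (s\<^sup>2 * K\<^sup>2) / \<delta> ^ 3"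
    by simp
  \<comment> \<open>The two remainders contribute 1/2 and 2, rounded up to 3.\<close>
  also have "\<dots> \<le> 1 / p0 + s * (a \<bullet> b) / p0 ^ 3 + s\<^sup>2 * (3 * K\<^sup>2 / \<delta> ^ 3)"
  proof -
    have "0 \<le> s\<^sup>2 * K\<^sup>2 / \<delta> ^ 3" using \<delta> by simp
    moreover have "s\<^sup>2 * K\<^sup>2 / (2 * \<delta> ^ 3) = (s\<^sup>2 * K\<^sup>2 / \<delta> ^ 3) / 2"
      "2 * (s\<^sup>2 * K\<^sup>2) / \<delta> ^ 3 = 2 * (s\<^sup>2 * K\<^sup>2 / \<delta> ^ 3)"
      "s\<^sup>2 * (3 * K\<^sup>2 / \<delta> ^ 3) = 3 * (s\<^sup>2 * K\<^sup>2 / \<delta> ^ 3)" by simp_all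
    ultimately show ?thesis by linarith
  qed
  finally show ?thesis by (simp add: p_def p0_def)
qed

section \<open>Mass-weighted energies of a configuration and their derivatives\<close>

definition diagonal :: "(4 \<Rightarrow> real) \<Rightarrow> complex^4 \<Rightarrow> complex^4" where
  "diagonal c x = (\<chi> i. c i *\<^sub>R x $ i)"

lemma bounded_linear_diagonal: "bounded_linear (diagonal c)"
  by (rule linear_conv_bounded_linear[THEN iffD1])
     (auto intro!: linearI simp: diagonal_def vec_eq_iff algebra_simps)

abbreviation weighted :: "real \<Rightarrow> complex^4 \<Rightarrow> complex^4" where
  "weighted m \<equiv> diagonal (mass m)"

definition kinetic_energy :: "real \<Rightarrow> complex^4 \<Rightarrow> real" where
  "kinetic_energy m v = (\<Sum>i\<in>UNIV. 1/2 * mass m i * (norm (v $ i))\<^sup>2)"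

definition potential :: "real \<Rightarrow> complex^4 \<Rightarrow> real" where
  "potential m x = (\<Sum>(i, j)\<in>{(i, j). i < j}. mass m i * mass m j / norm (x $ i - x $ j))"

text \<open>Away from collisions this is the gradient of \<open>potential\<close> for the inner
  product weighted by the masses, so Newton's equations read x'' =
  \<open>acceleration m x\<close>.\<close>

definition acceleration :: "real \<Rightarrow> complex^4 \<Rightarrow> complex^4" where
  "acceleration m x =
     (\<chi> i. \<Sum>j\<in>UNIV - {i}. (mass m j / (norm (x $ j - x $ i)) ^ 3) *\<^sub>R (x $ j - x $ i))"

lemma mass_pos: "m > 0 \<Longrightarrow> mass m i > 0"
  by (simp add: mass_def)

lemma weighted_inner: "weighted m u \<bullet> v = (\<Sum>i\<in>UNIV. mass m i * (u $ i \<bullet> v $ i))"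
  by (simp add: diagonal_def inner_vec_def)

lemma weighted_inner_commute: "weighted m u \<bullet> v = weighted m v \<bullet> u"
  unfolding weighted_inner by (simp add: inner_commute)

lemma kinetic_energy_eq: "kinetic_energy m v = 1/2 * (weighted m v \<bullet> v)"
  by (simp add: weighted_inner kinetic_energy_def sum_distrib_left mult.assoc power2_norm_eq_inner)

lemma kinetic_energy_nonneg: "m > 0 \<Longrightarrow> kinetic_energy m v \<ge> 0"
  unfolding kinetic_energy_def by (intro sum_nonneg) (simp add: mass_pos less_imp_le)

lemma kinetic_energy_bounds:
  assumes "m > 0"
  shows "min 1 m / 2 * (norm v)\<^sup>2 \<le> kinetic_energy m v" "kinetic_energy m v \<le> max 1 m / 2 * (norm v)\<^sup>2"
proof -
  have n: "(norm v)\<^sup>2 = (\<Sum>i\<in>UNIV. (norm (v $ i))\<^sup>2)"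
    by (simp add: power2_norm_eq_inner inner_vec_def)
  show "min 1 m / 2 * (norm v)\<^sup>2 \<le> kinetic_energy m v"
    unfolding n kinetic_energy_def sum_distrib_left
    by (intro sum_mono mult_right_mono) (auto simp: mass_def)
  show "kinetic_energy m v \<le> max 1 m / 2 * (norm v)\<^sup>2"
    unfolding n kinetic_energy_def sum_distrib_left
    by (intro sum_mono mult_right_mono) (auto simp: mass_def)
qed

lemma kinetic_energy_diff:
  "kinetic_energy m (v - s *\<^sub>R w) =
     kinetic_energy m v - s * (weighted m v \<bullet> w) + s\<^sup>2 * kinetic_energy m w"
proof -
  interpret bounded_linear "weighted m" by (rule bounded_linear_diagonal)
  show ?thesis
    by (simp add: kinetic_energy_eq diff scaleR inner_simps weighted_inner_commute[of m w v]
        power2_eq_square algebra_simps)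
qed

text \<open>Each pair \<open>i < j\<close> contributes opposite forces on its two bodies; the sum
  over pairs is regrouped by the body on which the force acts. The left side is minus the derivative
  of the potential in the direction \<open>y\<close>.\<close>

lemma potential_gradient:
  "(\<Sum>(i, j)\<in>{(i, j). i < j}. mass m i * mass m j *
      (((x $ i - x $ j) \<bullet> (y $ i - y $ j)) / norm (x $ i - x $ j) ^ 3)) =
   - (weighted m (acceleration m x) \<bullet> y)"
proof -
  define g where "g i j = mass m i * mass m j * (((x $ j - x $ i) \<bullet> y $ i) / norm (x $ j - x $ i) ^ 3)"
    for i j
  have "weighted m (acceleration m x) \<bullet> y = (\<Sum>i\<in>UNIV. \<Sum>j\<in>UNIV - {i}. g i j)"
    unfolding weighted_inner acceleration_def g_def
    by (simp add: inner_sum_left sum_distrib_left mult.assoc)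
  also have "\<dots> = (\<Sum>(i, j)\<in>(SIGMA i:UNIV. UNIV - {i}). g i j)"
    by (simp add: sum.Sigma)
  also have "(SIGMA i:UNIV. UNIV - {i}) = {(i, j). i < j} \<union> {(i, j). j < (i::4)}"
    by (auto simp: neq_iff)
  also have "(\<Sum>(i, j)\<in>{(i, j). i < j} \<union> {(i, j). j < i}. g i j) =
      (\<Sum>(i, j)\<in>{(i, j). i < j}. g i j) + (\<Sum>(i, j)\<in>{(i, j). j < i}. g i j)"
    by (rule sum.union_disjoint) auto
  also have "(\<Sum>(i, j)\<in>{(i, j). j < i}. g i j) = (\<Sum>(i, j)\<in>{(i, j). i < j}. g j i)"
    by (rule sum.reindex_bij_witness[of _ prod.swap prod.swap]) auto
  also have "(\<Sum>(i, j)\<in>{(i, j). i < j}. g i j) + (\<Sum>(i, j)\<in>{(i, j). i < j}. g j i) =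
      (\<Sum>(i, j)\<in>{(i, j). i < j}. - (mass m i * mass m j *
      (((x $ i - x $ j) \<bullet> (y $ i - y $ j)) / norm (x $ i - x $ j) ^ 3)))"
    unfolding sum.distrib[symmetric]
  proof (intro sum.cong refl, clarify)
    fix i j :: 4
    have e: "x $ j - x $ i = - (x $ i - x $ j)" by simp
    show "g i j + g j i = - (mass m i * mass m j *
      (((x $ i - x $ j) \<bullet> (y $ i - y $ j)) / norm (x $ i - x $ j) ^ 3))"
      unfolding g_def e norm_minus_cancel inner_minus_left inner_diff_right
      by (simp add: algebra_simps diff_divide_distrib add_divide_distrib)
  qed
  finally show ?thesis by (simp add: sum_negf case_prod_unfold)
qed

lemma potential_upper_Taylor:
  assumes m: "m > 0" and \<delta>: "\<delta> > 0" "\<And>i j. i \<noteq> j \<Longrightarrow> \<delta> \<le> norm (x $ i - x $ j)"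
    and K: "\<And>i j. norm (y $ i - y $ j) \<le> K" and s: "0 \<le> s" "s * K \<le> \<delta> / 2"
  shows "potential m (x - s *\<^sub>R y) \<le> potential m x - s * (weighted m (acceleration m x) \<bullet> y)
     + s\<^sup>2 * (\<Sum>(i, j)\<in>{(i, j). i < (j::4)}. mass m i * mass m j * (3 * K\<^sup>2 / \<delta> ^ 3))"
proof -
  have "potential m (x - s *\<^sub>R y) \<le> (\<Sum>(i, j)\<in>{(i, j). i < j}. mass m i * mass m j *
      (1 / norm (x $ i - x $ j) + s * ((x $ i - x $ j) \<bullet> (y $ i - y $ j)) / norm (x $ i - x $ j) ^ 3
        + s\<^sup>2 * (3 * K\<^sup>2 / \<delta> ^ 3)))"
    unfolding potential_def
  proof (intro sum_mono, clarify)
    fix i j :: 4 assume "i < j"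
    then have \<delta>': "\<delta> \<le> norm (x $ i - x $ j)" using \<delta> by auto
    have e: "(x - s *\<^sub>R y) $ i - (x - s *\<^sub>R y) $ j = (x $ i - x $ j) - s *\<^sub>R (y $ i - y $ j)"
      by (simp add: algebra_simps)
    show "mass m i * mass m j / norm ((x - s *\<^sub>R y) $ i - (x - s *\<^sub>R y) $ j) \<le> mass m i * mass m j *
      (1 / norm (x $ i - x $ j) + s * ((x $ i - x $ j) \<bullet> (y $ i - y $ j)) / norm (x $ i - x $ j) ^ 3
        + s\<^sup>2 * (3 * K\<^sup>2 / \<delta> ^ 3))"
      using mult_left_mono[OF inverse_norm_upper_Taylor[OF \<delta>(1) \<delta>' K[of i j] s],
          of "mass m i * mass m j"] mass_pos[OF m]
      unfolding e by (simp add: less_imp_le)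
  qed
  also have "\<dots> = potential m x + s * (\<Sum>(i, j)\<in>{(i, j). i < j}. mass m i * mass m j *
      (((x $ i - x $ j) \<bullet> (y $ i - y $ j)) / norm (x $ i - x $ j) ^ 3))
     + s\<^sup>2 * (\<Sum>(i, j)\<in>{(i, j). i < (j::4)}. mass m i * mass m j * (3 * K\<^sup>2 / \<delta> ^ 3))"
    unfolding potential_def sum_distrib_left sum.distrib[symmetric]
    by (intro sum.cong refl) (auto simp: algebra_simps)
  finally show ?thesis unfolding potential_gradient by simp
qed

lemma continuous_on_potential:
  assumes "continuous_on A x" "collision_free x"
  shows "continuous_on A (\<lambda>t. potential m (x t))"
  unfolding potential_def case_prod_unfold
  by (intro continuous_intros assms) (use assms(2) in \<open>auto simp: collision_free_def\<close>)

lemma continuous_on_acceleration: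
  assumes "continuous_on A x" "collision_free x"
  shows "continuous_on A (\<lambda>t. acceleration m (x t))"
  unfolding acceleration_def
  by (intro continuous_intros assms) (use assms(2) in \<open>auto simp: collision_free_def\<close>)

lemma continuous_on_kinetic_energy: "continuous_on A (kinetic_energy m)"
  unfolding kinetic_energy_def by (intro continuous_intros)

lemma potential_nonneg: "m > 0 \<Longrightarrow> potential m x \<ge> 0"
  unfolding potential_def by (intro sum_nonneg) (auto simp: mass_pos less_imp_le)

section \<open>The action as an integral along a loop\<close>

lemma loops_weak_derivative:
  assumes "x \<in> loops T m"
  shows "has_weak_derivative x (weak_derivative x)"
    and "set_integrable lborel {0..T} (\<lambda>t. (norm (weak_derivative x t))\<^sup>2)"
proof -
  obtain v where v: "has_weak_derivative x v" "set_integrable lborel {0..T} (\<lambda>t. (norm (v t))\<^sup>2)"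
    using assms by (auto simp: loops_def)
  show w: "has_weak_derivative x (weak_derivative x)"
    using has_weak_derivative_weak_derivative[OF v(1)] .
  have [measurable]: "v \<in> borel_measurable borel" "weak_derivative x \<in> borel_measurable borel"
    using has_weak_derivative_borel_measurable v(1) w by auto
  have "AE t in lborel. indicator {0..T} t *\<^sub>R (norm (v t))\<^sup>2 =
      indicator {0..T} t *\<^sub>R (norm (weak_derivative x t))\<^sup>2"
    using has_weak_derivative_unique[OF v(1) w] by eventually_elim simp
  then show "set_integrable lborel {0..T} (\<lambda>t. (norm (weak_derivative x t))\<^sup>2)"
    using v(2) unfolding set_integrable_def
    by (subst (asm) integrable_cong_AE) auto
qed

lemma loops_continuous: "x \<in> loops T m \<Longrightarrow> continuous_on UNIV x"
  using loops_weak_derivative(1) has_weak_derivative_continuous by blast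

lemma set_integrable_kinetic_energy:
  fixes v :: "real \<Rightarrow> complex^4"
  assumes "m > 0" and [measurable]: "v \<in> borel_measurable borel"
    and v: "set_integrable lborel {0..T} (\<lambda>t. (norm (v t))\<^sup>2)"
  shows "set_integrable lborel {0..T} (\<lambda>t. kinetic_energy m (v t))"
  unfolding set_integrable_def
proof (rule Bochner_Integration.integrable_bound)
  have [measurable]: "kinetic_energy m \<in> borel_measurable borel"
    by (intro borel_measurable_continuous_onI continuous_on_kinetic_energy)
  show "integrable lborel (\<lambda>t. max 1 m / 2 * (indicator {0..T} t *\<^sub>R (norm (v t))\<^sup>2))"
    using v unfolding set_integrable_def by simp
  have "(\<lambda>t. kinetic_energy m (v t)) \<in> borel_measurable lborel"
    using measurable_compose[of v lborel borel "kinetic_energy m" borel] by simp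
  then show "(\<lambda>t. indicator {0..T} t *\<^sub>R kinetic_energy m (v t)) \<in> borel_measurable lborel"
    by (intro borel_measurable_scaleR borel_measurable_indicator) (auto intro: borel_closed)
  have "norm (indicator {0..T} t *\<^sub>R kinetic_energy m (v t)) \<le>
      norm (max 1 m / 2 * (indicator {0..T} t *\<^sub>R (norm (v t))\<^sup>2))" for t
    using kinetic_energy_bounds(2)[OF assms(1), of "v t"] kinetic_energy_nonneg[OF assms(1), of "v t"]
    by (auto simp: indicator_def)
  then show "AE t in lborel. norm (indicator {0..T} t *\<^sub>R kinetic_energy m (v t)) \<le>
      norm (max 1 m / 2 * (indicator {0..T} t *\<^sub>R (norm (v t))\<^sup>2))" by simp
qed

lemma action_integrand_kinetic:
  "m > 0 \<Longrightarrow> (\<Sum>i\<in>UNIV. ennreal (1/2 * mass m i * (norm (v $ i))\<^sup>2)) = ennreal (kinetic_energy m v)"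
  unfolding kinetic_energy_def by (rule sum_ennreal) (simp add: mass_pos less_imp_le)

text \<open>In contrast to \<^const>\<open>potential\<close>, where \<open>x / 0 = 0\<close>, this is \<open>\<infinity>\<close> at a collision; that makes it
  continuous.\<close>

definition collision_potential :: "real \<Rightarrow> complex^4 \<Rightarrow> ennreal" where
  "collision_potential m x =
     (\<Sum>(i, j)\<in>{(i, j). i < j}. ennreal (mass m i * mass m j) / ennreal (norm (x $ i - x $ j)))"

lemma continuous_on_collision_potential: "continuous_on UNIV (collision_potential m)"
  unfolding collision_potential_def case_prod_unfold divide_ennreal_def
  by (intro continuous_on_sum ennreal_continuous_on_cmult continuous_on_inverse_ennreal
      continuous_on_ennreal continuous_intros) auto

lemma collision_potential_measurable [measurable]: "collision_potential m \<in> borel_measurable borel"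
  by (rule borel_measurable_continuous_onI[OF continuous_on_collision_potential])

text \<open>Every loop has finite kinetic part, so an infinite action comes from the potential part
  alone. Any weak derivative \<open>v\<close> is allowed, which lets explicit derivatives of limits
  and competitors be inserted.\<close>

lemma action_split:
  assumes m: "m > 0" and x: "x \<in> loops T m" and v: "has_weak_derivative x v"
  shows "set_integrable lborel {0..T} (\<lambda>t. kinetic_energy m (v t))"
    and "action T m x = ennreal (LINT t:{0..T}|lborel. kinetic_energy m (v t)) +
      (\<integral>\<^sup>+t\<in>{0..T}. collision_potential m (x t) \<partial>lborel)"
proof -
  note w = loops_weak_derivative[OF x]
  have [measurable]: "v \<in> borel_measurable borel" "weak_derivative x \<in> borel_measurable borel"
    "x \<in> borel_measurable borel" "kinetic_energy m \<in> borel_measurable borel"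
    using has_weak_derivative_borel_measurable v w(1) loops_continuous[OF x] continuous_on_kinetic_energy
    by (auto intro: borel_measurable_continuous_onI)
  have ae: "AE t in lborel. v t = weak_derivative x t" by (rule has_weak_derivative_unique[OF v w(1)])
  have "AE t in lborel. indicator {0..T} t *\<^sub>R kinetic_energy m (v t) =
      indicator {0..T} t *\<^sub>R kinetic_energy m (weak_derivative x t)"
    using ae by eventually_elim simp
  then show i: "set_integrable lborel {0..T} (\<lambda>t. kinetic_energy m (v t))"
    using set_integrable_kinetic_energy[OF m _ w(2)] unfolding set_integrable_def
    by (subst integrable_cong_AE) auto
  have "action T m x = (\<integral>\<^sup>+t. ennreal (indicator {0..T} t *\<^sub>R kinetic_energy m (v t)) +
      collision_potential m (x t) * indicator {0..T} t \<partial>lborel)"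
    unfolding action_def
  proof (rule nn_integral_cong_AE)
    show "AE t in lborel. ((\<Sum>i\<in>UNIV. ennreal (1/2 * mass m i * (norm (weak_derivative x t $ i))\<^sup>2)) +
         (\<Sum>(i, j)\<in>{(i, j). i < j}. ennreal (mass m i * mass m j) / ennreal (norm (x t $ i - x t $ j)))) *
         indicator {0..T} t =
        ennreal (indicator {0..T} t *\<^sub>R kinetic_energy m (v t)) +
          collision_potential m (x t) * indicator {0..T} t"
      using ae
    proof eventually_elim
      case (elim t)
      then show ?case
        unfolding action_integrand_kinetic[OF m] collision_potential_def
        by (simp add: indicator_def distrib_right)
    qed
  qed
  also have "\<dots> = (\<integral>\<^sup>+t. ennreal (indicator {0..T} t *\<^sub>R kinetic_energy m (v t)) \<partial>lborel) +
      (\<integral>\<^sup>+t\<in>{0..T}. collision_potential m (x t) \<partial>lborel)"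
    by (rule nn_integral_add) measurable
  also have "(\<integral>\<^sup>+t. ennreal (indicator {0..T} t *\<^sub>R kinetic_energy m (v t)) \<partial>lborel) =
      ennreal (LINT t:{0..T}|lborel. kinetic_energy m (v t))"
    unfolding set_lebesgue_integral_def using i
    by (intro nn_integral_eq_integral) (auto simp: set_integrable_def kinetic_energy_nonneg m)
  finally show "action T m x = ennreal (LINT t:{0..T}|lborel. kinetic_energy m (v t)) +
      (\<integral>\<^sup>+t\<in>{0..T}. collision_potential m (x t) \<partial>lborel)" .
qed

lemma collision_potential_eq_potential:
  assumes "m > 0" "\<And>i j. i \<noteq> j \<Longrightarrow> x $ i \<noteq> x $ j"
  shows "collision_potential m x = ennreal (potential m x)"
proof -
  have "collision_potential m x =
      (\<Sum>p\<in>{(i, j). i < j}. ennreal (mass m (fst p) * mass m (snd p) / norm (x $ fst p - x $ snd p)))"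
    unfolding collision_potential_def
  proof (intro sum.cong refl, clarify)
    fix i j :: 4 assume "i < j"
    then have "x $ i \<noteq> x $ j" using assms(2) by auto
    then show "ennreal (mass m i * mass m j) / ennreal (norm (x $ i - x $ j)) =
        ennreal (mass m (fst (i, j)) * mass m (snd (i, j)) / norm (x $ fst (i, j) - x $ snd (i, j)))"
      using mass_pos[OF assms(1)] by (simp add: divide_ennreal less_imp_le)
  qed
  also have "\<dots> = ennreal (potential m x)"
    unfolding potential_def case_prod_unfold
    by (rule sum_ennreal) (use mass_pos[OF assms(1)] in \<open>simp add: less_imp_le\<close>)
  finally show ?thesis .
qed

text \<open>Without collisions the potential is continuous along the loop, and the action becomes a
  real integral that can be expanded and subtracted.\<close>

lemma action_collision_free:
  assumes m: "m > 0" and x: "x \<in> loops T m" "collision_free x" and v: "has_weak_derivative x v"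
  shows "set_integrable lborel {0..T} (\<lambda>t. kinetic_energy m (v t) + potential m (x t))"
    and "action T m x = ennreal (LINT t:{0..T}|lborel. kinetic_energy m (v t) + potential m (x t))"
proof -
  note split = action_split[OF m x(1) v]
  have i: "set_integrable lborel {0..T} (\<lambda>t. potential m (x t))"
    by (rule borel_integrable_atLeastAtMost'[OF continuous_on_potential[OF
        continuous_on_subset[OF loops_continuous[OF x(1)] subset_UNIV] x(2)]])
  show "set_integrable lborel {0..T} (\<lambda>t. kinetic_energy m (v t) + potential m (x t))"
    using split(1) i by simp
  have "collision_potential m (x t) * indicator {0..T} t = ennreal (indicator {0..T} t *\<^sub>R potential m (x t))"
    for t
    using x(2) m by (auto simp: collision_potential_eq_potential collision_free_def indicator_def)
  then have "(\<integral>\<^sup>+t\<in>{0..T}. collision_potential m (x t) \<partial>lborel) = ennreal (LINT t:{0..T}|lborel. potential m (x t))"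
    unfolding set_lebesgue_integral_def using i
    by (simp only:, intro nn_integral_eq_integral) (auto simp: set_integrable_def potential_nonneg m)
  moreover have "0 \<le> (LINT t:{0..T}|lborel. kinetic_energy m (v t))" "0 \<le> (LINT t:{0..T}|lborel. potential m (x t))"
    unfolding set_lebesgue_integral_def
    by (intro Bochner_Integration.integral_nonneg; simp add: kinetic_energy_nonneg potential_nonneg m)+
  ultimately show "action T m x = ennreal (LINT t:{0..T}|lborel. kinetic_energy m (v t) + potential m (x t))"
    using split i by (simp add: ennreal_plus)
qed

section \<open>Comparison with a twice differentiable loop\<close>

lemma set_integrable_inner_L2:
  fixes u w :: "real \<Rightarrow> 'a::euclidean_space"
  assumes [measurable]: "u \<in> borel_measurable borel" "w \<in> borel_measurable borel" "A \<in> sets borel"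
    and u: "set_integrable lborel A (\<lambda>t. (norm (u t))\<^sup>2)"
    and w: "set_integrable lborel A (\<lambda>t. (norm (w t))\<^sup>2)"
  shows "set_integrable lborel A (\<lambda>t. u t \<bullet> w t)"
  unfolding set_integrable_def
proof (rule Bochner_Integration.integrable_bound)
  show "integrable lborel (\<lambda>t. indicator A t *\<^sub>R (norm (u t))\<^sup>2 + indicator A t *\<^sub>R (norm (w t))\<^sup>2)"
    using u w unfolding set_integrable_def by simp
  have "\<bar>u t \<bullet> w t\<bar> \<le> (norm (u t))\<^sup>2 + (norm (w t))\<^sup>2" for t
  proof -
    have "\<bar>u t \<bullet> w t\<bar> \<le> norm (u t) * norm (w t)" by (rule Cauchy_Schwarz_ineq2)
    also have "\<dots> \<le> (norm (u t))\<^sup>2 + (norm (w t))\<^sup>2"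
      using zero_le_power2[of "norm (u t) - norm (w t)"] zero_le_power2[of "norm (u t)"]
        zero_le_power2[of "norm (w t)"] unfolding power2_diff by linarith
    finally show ?thesis .
  qed
  then show "AE t in lborel. norm (indicator A t *\<^sub>R (u t \<bullet> w t)) \<le>
      norm (indicator A t *\<^sub>R (norm (u t))\<^sup>2 + indicator A t *\<^sub>R (norm (w t))\<^sup>2)"
    by (auto simp: indicator_def)
qed measurable

lemma set_integrable_square_diff:
  fixes u w :: "real \<Rightarrow> 'a::euclidean_space"
  assumes [measurable]: "u \<in> borel_measurable borel" "w \<in> borel_measurable borel" "A \<in> sets borel"
    and u: "set_integrable lborel A (\<lambda>t. (norm (u t))\<^sup>2)"
    and w: "set_integrable lborel A (\<lambda>t. (norm (w t))\<^sup>2)"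
  shows "set_integrable lborel A (\<lambda>t. (norm (u t - w t))\<^sup>2)"
proof -
  have "(norm (u t - w t))\<^sup>2 = (norm (u t))\<^sup>2 + (norm (w t))\<^sup>2 - 2 * (u t \<bullet> w t)" for t
    by (simp add: power2_norm_eq_inner inner_simps inner_commute)
  then show ?thesis
    using u w set_integrable_inner_L2[OF assms] by simp
qed

lemma periodic_continuous_bounded:
  fixes g :: "real \<Rightarrow> 'a::real_normed_vector"
  assumes T: "T > 0" and g: "continuous_on UNIV g" "\<And>t. g (t + T) = g t"
  obtains K where "K > 0" "\<And>t. norm (g t) \<le> K"
proof -
  have "compact (g ` {0..T})"
    by (intro compact_continuous_image continuous_on_subset[OF g(1)]) auto
  then obtain K where K: "\<forall>t\<in>{0..T}. norm (g t) \<le> K"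
    by (auto dest!: compact_imp_bounded simp: bounded_iff)
  have "norm (g t) \<le> max K 1" for t
  proof -
    have "t rmod T \<in> {0..T}" using T rmod_less[OF T] rmod_nonneg[of T t] by (auto intro: less_imp_le)
    then have "norm (g (t rmod T)) \<le> K" using K by blast
    then show ?thesis using periodic_rmod[of g T t, OF g(2)] by simp
  qed
  then show ?thesis using that[of "max K 1"] by auto
qed

text \<open>The reciprocal of each mutual distance is continuous and periodic, hence
  bounded.\<close>

lemma collision_free_distance:
  fixes x :: "real \<Rightarrow> complex^4"
  assumes T: "T > 0" and x: "continuous_on UNIV x" "\<And>t. x (t + T) = x t" "collision_free x"
  obtains \<delta> where "\<delta> > 0" "\<And>t i j. i \<noteq> j \<Longrightarrow> \<delta> \<le> norm (x t $ i - x t $ j)"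
proof -
  have ex: "\<exists>\<delta>>0. \<forall>t. \<delta> \<le> norm (x t $ i - x t $ j)" if ij: "i \<noteq> j" for i j
  proof -
    have c: "continuous_on UNIV (\<lambda>t. 1 / norm (x t $ i - x t $ j))"
      using x ij by (intro continuous_intros) (auto simp: collision_free_def)
    obtain K where K: "K > 0" "\<And>t. norm (1 / norm (x t $ i - x t $ j)) \<le> K"
      by (rule periodic_continuous_bounded[OF T c]) (use x(2) in auto)
    have "1 / K \<le> norm (x t $ i - x t $ j)" for t
    proof -
      have "norm (x t $ i - x t $ j) > 0" using x(3) ij by (auto simp: collision_free_def)
      then show ?thesis using K(1) K(2)[of t] by (simp add: field_simps)
    qed
    then show ?thesis using K by (intro exI[of _ "1 / K"]) auto
  qed
  \<comment> \<open>The value 1 on the diagonal keeps the minimum over all index pairs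
    positive.\<close>
  define d where "d i j = (if i = j then 1 else SOME \<delta>. \<delta> > 0 \<and> (\<forall>t. \<delta> \<le> norm (x t $ i - x t $ j)))"
    for i j
  have d: "d i j > 0 \<and> (i \<noteq> j \<longrightarrow> (\<forall>t. d i j \<le> norm (x t $ i - x t $ j)))" for i j
    unfolding d_def using someI_ex[OF ex[of i j]] by auto
  define \<delta> where "\<delta> = Min ((\<lambda>(i, j). d i j) ` UNIV)"
  have "\<delta> > 0" unfolding \<delta>_def using d by (subst Min_gr_iff) auto
  moreover have "\<delta> \<le> d i j" for i j unfolding \<delta>_def by (rule Min_le) auto
  ultimately show ?thesis using that[of \<delta>] d by (meson order_trans)
qed

text \<open>The competitor \<open>F2\<close> solves \<open>F2'' = acceleration (x)\<close>. Varying \<open>x\<close> in the direction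
  \<open>F2 - x\<close> and integrating by parts bounds the kinetic energy of \<open>x - F2\<close> by zero.\<close>

lemma minimizer_eq_competitor_plus_const:
  fixes x F1 F2 :: "real \<Rightarrow> complex^4"
  assumes T: "T > 0" and m: "m > 0" and x: "x \<in> loops T m" "collision_free x"
    and F2: "\<And>t. (F2 has_vector_derivative F1 t) (at t)" "\<And>t. F2 (t + T) = F2 t"
    and F1: "\<And>t. (F1 has_vector_derivative acceleration m (x t)) (at t)" "\<And>t. F1 (t + T) = F1 t"
    and min: "\<And>s. (\<lambda>t. x t - s *\<^sub>R (x t - F2 t)) \<in> loops T m"
      "\<And>s. action T m x \<le> action T m (\<lambda>t. x t - s *\<^sub>R (x t - F2 t))"
  shows "x t = F2 t + (x 0 - F2 0)"
proof -
  interpret W: bounded_linear "weighted m" by (rule bounded_linear_diagonal)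
  define v where "v = weak_derivative x"
  have v: "has_weak_derivative x v" and v2: "set_integrable lborel {0..T} (\<lambda>t. (norm (v t))\<^sup>2)"
    unfolding v_def using loops_weak_derivative[OF x(1)] by auto
  have xT: "x (t + T) = x t" for t using x(1) by (auto simp: loops_def)
  have xc: "continuous_on UNIV x" using loops_continuous[OF x(1)] .
  have F1c: "continuous_on UNIV F1" and F2c: "continuous_on UNIV F2"
    by (meson F1 F2 has_vector_derivative_continuous continuous_at_imp_continuous_on)+
  define \<phi> where "\<phi> t = x t - F2 t" for t
  define \<eta> where "\<eta> t = v t - F1 t" for t
  have hF2: "has_weak_derivative F2 F1" by (rule has_weak_derivative_of_vector_derivative[OF F2(1) F1c])
  have h\<phi>: "has_weak_derivative \<phi> \<eta>"
    using has_weak_derivative_linear_combination[OF v hF2, of "-1"] by (simp add: \<phi>_def[abs_def] \<eta>_def[abs_def])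
  have \<phi>c: "continuous_on UNIV \<phi>" using has_weak_derivative_continuous[OF h\<phi>] .
  have \<phi>T: "\<phi> (t + T) = \<phi> t" for t by (simp add: \<phi>_def xT F2)
  have [measurable]: "v \<in> borel_measurable borel" "F1 \<in> borel_measurable borel" "\<eta> \<in> borel_measurable borel"
    using has_weak_derivative_borel_measurable v hF2 h\<phi> by auto
  have "set_integrable lborel {0..T} (\<lambda>t. (norm (F1 t))\<^sup>2)"
    by (intro borel_integrable_atLeastAtMost' continuous_intros continuous_on_subset[OF F1c]) auto
  then have \<eta>2: "set_integrable lborel {0..T} (\<lambda>t. (norm (\<eta> t))\<^sup>2)"
    unfolding \<eta>_def using v2 by (intro set_integrable_square_diff) auto
  define f where "f t = weighted m (acceleration m (x t))" for t
  have fc: "continuous_on UNIV f"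
    unfolding f_def by (intro W.continuous_on continuous_on_acceleration xc x(2))
  have \<psi>: "((\<lambda>t. weighted m (F1 t)) has_vector_derivative f t) (at t)" for t
    unfolding f_def using F1(1) by (rule W.has_vector_derivative)
  note parts = integral_by_parts_weak_derivative[OF T h\<phi> \<psi> fc]
  have eT: "\<phi> T = \<phi> 0" "weighted m (F1 T) = weighted m (F1 0)" using \<phi>T[of 0] F1(2)[of 0] by auto
  have p1: "set_integrable lborel {0..T} (\<lambda>t. weighted m (F1 t) \<bullet> \<eta> t)"
    and p2: "(LINT t:{0..T}|lborel. weighted m (F1 t) \<bullet> \<eta> t) = - (LINT t:{0..T}|lborel. f t \<bullet> \<phi> t)"
    using parts eT by auto
  have i\<eta>: "set_integrable lborel {0..T} (\<lambda>t. kinetic_energy m (\<eta> t))"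
    by (rule set_integrable_kinetic_energy[OF m _ \<eta>2]) simp
  have if\<phi>: "set_integrable lborel {0..T} (\<lambda>t. f t \<bullet> \<phi> t)"
    by (intro borel_integrable_atLeastAtMost' continuous_intros continuous_on_subset[OF fc]
        continuous_on_subset[OF \<phi>c]) auto
  have kin_\<eta>: "2 * kinetic_energy m (\<eta> t) = weighted m (v t) \<bullet> \<eta> t - weighted m (F1 t) \<bullet> \<eta> t" for t
  proof -
    have "weighted m (\<eta> t) = weighted m (v t) - weighted m (F1 t)" by (simp add: \<eta>_def W.diff)
    then show ?thesis by (simp add: kinetic_energy_eq inner_diff_left)
  qed
  have iv\<eta>: "set_integrable lborel {0..T} (\<lambda>t. weighted m (v t) \<bullet> \<eta> t)"
  proof -
    have "weighted m (v t) \<bullet> \<eta> t = weighted m (F1 t) \<bullet> \<eta> t + 2 * kinetic_energy m (\<eta> t)" for t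
      by (simp add: kin_\<eta>)
    then show ?thesis using p1 i\<eta> by simp
  qed
  obtain \<delta> where \<delta>: "\<delta> > 0" "\<And>t i j. i \<noteq> j \<Longrightarrow> \<delta> \<le> norm (x t $ i - x t $ j)"
    using collision_free_distance[OF T xc xT x(2)] by blast
  obtain K0 where K0: "K0 > 0" "\<And>t. norm (\<phi> t) \<le> K0"
    using periodic_continuous_bounded[OF T \<phi>c \<phi>T] by blast
  define K where "K = 2 * K0"
  have K: "norm (\<phi> t $ i - \<phi> t $ j) \<le> K" for t i j
  proof -
    have "norm (\<phi> t $ i - \<phi> t $ j) \<le> norm (\<phi> t $ i) + norm (\<phi> t $ j)" by (rule norm_triangle_ineq4)
    also have "\<dots> \<le> K" unfolding K_def using K0(2)[of t] Finite_Cartesian_Product.norm_nth_le[of "\<phi> t" i]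
        Finite_Cartesian_Product.norm_nth_le[of "\<phi> t" j] by linarith
    finally show ?thesis .
  qed
  define C where "C = (\<Sum>(i, j)\<in>{(i, j). i < (j::4)}. mass m i * mass m j * (3 * K\<^sup>2 / \<delta> ^ 3))"
  \<comment> \<open>\<open>- I\<close> is the derivative at \<open>s = 0\<close> of the action along
    \<open>x - s *\<^sub>R \<phi>\<close>, and \<open>D\<close> bounds the coefficient of
    \<open>s\<^sup>2\<close>. Minimality of \<open>x\<close> will give \<open>I \<le> s * D\<close>,
    and \<open>s\<close> tends to 0 from the right.\<close>
  define I where "I = (LINT t:{0..T}|lborel. weighted m (v t) \<bullet> \<eta> t + f t \<bullet> \<phi> t)"
  define D where "D = (LINT t:{0..T}|lborel. kinetic_energy m (\<eta> t)) + T * C"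
  have step: "I \<le> s * D" if s: "0 < s" "s * K \<le> \<delta> / 2" for s
  proof -
    define y where "y t = x t - s *\<^sub>R \<phi> t" for t
    have y: "y \<in> loops T m" "action T m x \<le> action T m y"
      using min[of s] by (simp_all add: y_def[abs_def] \<phi>_def)
    \<comment> \<open>Relative displacements of at most \<open>\<delta> / 2\<close> cannot close
      gaps of at least \<open>\<delta>\<close>.\<close>
    have ycf: "collision_free y"
      unfolding collision_free_def
    proof (intro allI impI notI)
      fix t and i j :: 4 assume ij: "i \<noteq> j" and "y t $ i = y t $ j"
      then have "x t $ i - x t $ j = s *\<^sub>R (\<phi> t $ i - \<phi> t $ j)"
        by (simp add: y_def algebra_simps)
      then have "norm (x t $ i - x t $ j) = s * norm (\<phi> t $ i - \<phi> t $ j)" using s by simp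
      also have "\<dots> \<le> s * K" using K s by (intro mult_left_mono) auto
      finally show False using \<delta>(1) \<delta>(2)[OF ij, of t] s by linarith
    qed
    have hy: "has_weak_derivative y (\<lambda>t. v t - s *\<^sub>R \<eta> t)"
      using has_weak_derivative_linear_combination[OF v h\<phi>, of "- s"] by (simp add: y_def[abs_def])
    note ax = action_collision_free[OF m x v] and ay = action_collision_free[OF m y(1) ycf hy]
    let ?R = "\<lambda>t. (kinetic_energy m (v t) + potential m (x t)) - s * (weighted m (v t) \<bullet> \<eta> t + f t \<bullet> \<phi> t)
        + s\<^sup>2 * (kinetic_energy m (\<eta> t) + C)"
    have iC: "set_integrable lborel {0..T} (\<lambda>t. C)"
      by (intro borel_integrable_atLeastAtMost' continuous_intros)
    have iR: "set_integrable lborel {0..T} ?R"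
      using ax(1) iv\<eta> if\<phi> i\<eta> iC by simp
    have nn: "0 \<le> (LINT t:{0..T}|lborel. kinetic_energy m (v t - s *\<^sub>R \<eta> t) + potential m (y t))"
      unfolding set_lebesgue_integral_def
      by (intro Bochner_Integration.integral_nonneg) (simp add: kinetic_energy_nonneg potential_nonneg m)
    have "(LINT t:{0..T}|lborel. kinetic_energy m (v t) + potential m (x t)) \<le>
        (LINT t:{0..T}|lborel. kinetic_energy m (v t - s *\<^sub>R \<eta> t) + potential m (y t))"
      using y(2) unfolding ax(2) ay(2) by (simp add: ennreal_le_iff nn)
    also have "\<dots> \<le> (LINT t:{0..T}|lborel. ?R t)"
    proof (rule set_integral_mono[OF ay(1) iR])
      fix t
      show "kinetic_energy m (v t - s *\<^sub>R \<eta> t) + potential m (y t) \<le> ?R t"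
        using potential_upper_Taylor[OF m \<delta>(1) \<delta>(2) K less_imp_le[OF s(1)] s(2), of t t]
        unfolding kinetic_energy_diff y_def C_def[symmetric] f_def[symmetric]
        by (simp add: algebra_simps)
    qed
    also have "\<dots> = (LINT t:{0..T}|lborel. kinetic_energy m (v t) + potential m (x t)) - s * I + s\<^sup>2 * D"
    proof -
      have "(LINT t:{0..T}|lborel. C) = T * C"
        unfolding set_lebesgue_integral_def using T by simp
      then show ?thesis
        unfolding I_def D_def using ax(1) iv\<eta> if\<phi> i\<eta> iC by simp
    qed
    finally have "s * I \<le> s * (s * D)" by (simp add: power2_eq_square mult.assoc)
    then show ?thesis using s by simp
  qed
  have "I \<le> 0"
  proof (rule tendsto_lowerbound)
    show "((\<lambda>s. s * D) \<longlongrightarrow> 0) (at_right 0)" by (auto intro!: tendsto_eq_intros)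
    have "K > 0" using K0 by (simp add: K_def)
    then show "\<forall>\<^sub>F s in at_right 0. I \<le> s * D"
      unfolding eventually_at_right_field
      by (intro exI[of _ "\<delta> / (2 * K)"]) (use step \<delta>(1) in \<open>auto simp: field_simps\<close>)
  qed simp
  \<comment> \<open>Integration by parts replaces the force term by the momentum of
    \<open>F1\<close>; since \<open>\<eta>\<close> is itself \<open>v - F1\<close>, a full square
    results.\<close>
  moreover have "I = (LINT t:{0..T}|lborel. 2 * kinetic_energy m (\<eta> t))"
  proof -
    have "I = (LINT t:{0..T}|lborel. weighted m (v t) \<bullet> \<eta> t) + (LINT t:{0..T}|lborel. f t \<bullet> \<phi> t)"
      unfolding I_def using iv\<eta> if\<phi> by simp
    also have "\<dots> = (LINT t:{0..T}|lborel. weighted m (v t) \<bullet> \<eta> t - weighted m (F1 t) \<bullet> \<eta> t)"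
      using iv\<eta> p1 p2 by simp
    also have "\<dots> = (LINT t:{0..T}|lborel. 2 * kinetic_energy m (\<eta> t))"
      by (simp add: kin_\<eta>)
    finally show ?thesis .
  qed
  ultimately have "(LINT t:{0..T}|lborel. kinetic_energy m (\<eta> t)) \<le> 0" by simp
  moreover have "(LINT t:{0..T}|lborel. kinetic_energy m (\<eta> t)) \<ge> 0"
    unfolding set_lebesgue_integral_def
    by (intro Bochner_Integration.integral_nonneg) (simp add: kinetic_energy_nonneg m)
  ultimately have z: "(\<integral>t. indicator {0..T} t *\<^sub>R kinetic_energy m (\<eta> t) \<partial>lborel) = 0"
    by (simp add: set_lebesgue_integral_def)
  have ae: "AE t in lborel. indicator {0..T} t *\<^sub>R kinetic_energy m (\<eta> t) = 0"
    using z i\<eta> by (subst (asm) integral_nonneg_eq_0_iff_AE)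
      (auto simp: set_integrable_def kinetic_energy_nonneg m)
  have \<phi>0: "\<phi> t = \<phi> 0" if t: "t \<in> {0..T}" for t
  proof -
    have "AE s in lborel. indicator {0..t} s *\<^sub>R \<eta> s = 0"
      using ae
    proof eventually_elim
      case (elim s)
      show ?case
      proof (cases "s \<in> {0..t}")
        case True
        then have "kinetic_energy m (\<eta> s) = 0" using elim t by auto
        then have "min 1 m / 2 * (norm (\<eta> s))\<^sup>2 \<le> 0"
          using kinetic_energy_bounds(1)[OF m, of "\<eta> s"] by simp
        then have "\<eta> s = 0" using m by (auto simp: mult_le_0_iff min_def split: if_splits)
        then show ?thesis by simp
      qed simp
    qed
    then have "(LINT s:{0..t}|lborel. \<eta> s) = 0"
      unfolding set_lebesgue_integral_def by (rule integral_eq_zero_AE)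
    moreover have "\<phi> t - \<phi> 0 = (LINT s:{0..t}|lborel. \<eta> s)"
      using h\<phi> t by (auto simp: has_weak_derivative_def)
    ultimately show ?thesis by simp
  qed
  have "\<phi> t = \<phi> 0"
    using \<phi>0[of "t rmod T"] periodic_rmod[of \<phi> T t, OF \<phi>T] rmod_less[OF T, of t] rmod_nonneg[of T t] T
    by auto
  then show ?thesis by (simp add: \<phi>_def algebra_simps)
qed

lemma loops_linear_combination:
  assumes x: "x \<in> loops T m" and y: "y \<in> loops T m"
  shows "(\<lambda>t. x t + c *\<^sub>R y t) \<in> loops T m"
proof -
  note v = loops_weak_derivative[OF x] and w = loops_weak_derivative[OF y]
  have [measurable]: "weak_derivative x \<in> borel_measurable borel" "weak_derivative y \<in> borel_measurable borel"
    using v(1) w(1) has_weak_derivative_borel_measurable by auto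
  have "set_integrable lborel {0..T} (\<lambda>t. c\<^sup>2 *\<^sub>R (norm (weak_derivative y t))\<^sup>2)"
    using w(2) by simp
  then have "set_integrable lborel {0..T} (\<lambda>t. (norm (- c *\<^sub>R weak_derivative y t))\<^sup>2)"
    by (simp add: power_mult_distrib)
  then have "set_integrable lborel {0..T} (\<lambda>t. (norm (weak_derivative x t - (- c *\<^sub>R weak_derivative y t)))\<^sup>2)"
    using v(2) by (intro set_integrable_square_diff) auto
  moreover have "has_weak_derivative (\<lambda>t. x t + c *\<^sub>R y t) (\<lambda>t. weak_derivative x t + c *\<^sub>R weak_derivative y t)"
    by (rule has_weak_derivative_linear_combination[OF v(1) w(1)])
  moreover have "x t + c *\<^sub>R y t \<in> configurations m" for t
  proof -
    have "(\<Sum>i\<in>UNIV. mass m i *\<^sub>R (x t + c *\<^sub>R y t) $ i) =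
        (\<Sum>i\<in>UNIV. mass m i *\<^sub>R x t $ i) + c *\<^sub>R (\<Sum>i\<in>UNIV. mass m i *\<^sub>R y t $ i)"
      by (simp add: scaleR_sum_right sum.distrib[symmetric] scaleR_add_right mult.commute)
    then show ?thesis using x y by (simp add: loops_def configurations_def)
  qed
  ultimately show ?thesis using x y unfolding loops_def by auto
qed

lemma loops_of_vector_derivative:
  assumes "\<And>t. (y has_vector_derivative v t) (at t)" "continuous_on UNIV v"
    and "\<And>t. y (t + T) = y t" "\<And>t. y t \<in> configurations m"
  shows "y \<in> loops T m"
proof -
  have "set_integrable lborel {0..T} (\<lambda>t. (norm (v t))\<^sup>2)"
    by (intro borel_integrable_atLeastAtMost' continuous_intros continuous_on_subset[OF assms(2)]) auto
  then show ?thesis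
    using has_weak_derivative_of_vector_derivative[OF assms(1,2)] assms(3,4) by (auto simp: loops_def)
qed

section \<open>Periodic antiderivatives\<close>

lemma zero_vector_derivative_const:
  fixes g :: "real \<Rightarrow> 'a::real_normed_vector"
  assumes "\<And>t. (g has_vector_derivative 0) (at t)"
  shows "g t = g s"
  using has_vector_derivative_zero_constant[of UNIV g] assms by (metis UNIV_I convex_UNIV)

lemma continuous_has_antiderivative:
  fixes f :: "real \<Rightarrow> 'a::euclidean_space"
  assumes "continuous_on UNIV f"
  obtains F where "\<And>t. (F has_vector_derivative f t) (at t)"
  using einterval_antiderivative[of "-\<infinity>" "\<infinity>" f] assms
  by (auto simp: continuous_on_eq_continuous_at)

text \<open>\<open>F\<close> is \<open>G\<close> minus its mean \<open>k\<close> over a period, and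
  a periodic antiderivative \<open>H\<close> is exactly the witness that this mean has become
  zero.\<close>

lemma periodic_antiderivative_normalization:
  fixes f G :: "real \<Rightarrow> 'a::euclidean_space"
  assumes T: "T > 0" and G: "\<And>t. (G has_vector_derivative f t) (at t)" "\<And>t. G (t + T) = G t"
  obtains F H where "\<And>t. (F has_vector_derivative f t) (at t)" "\<And>t. F (t + T) = F t"
    "\<And>t. (H has_vector_derivative F t) (at t)" "\<And>t. H (t + T) = H t"
proof -
  have Gc: "continuous_on UNIV G"
    by (meson G has_vector_derivative_continuous continuous_at_imp_continuous_on)
  obtain H where H: "\<And>t. (H has_vector_derivative G t) (at t)"
    using continuous_has_antiderivative[OF Gc] by blast
  define k where "k = (1 / T) *\<^sub>R (H T - H 0)"
  have "((\<lambda>t. H (t + T) - H t) has_vector_derivative (G (t + T) - G t)) (at t)" for t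
  proof -
    have "((\<lambda>t. t + T) has_vector_derivative 1) (at t)" by (auto intro!: derivative_eq_intros)
    then have "(H \<circ> (\<lambda>t. t + T) has_vector_derivative 1 *\<^sub>R G (t + T)) (at t)"
      by (intro vector_diff_chain_at H)
    then show ?thesis by (intro has_vector_derivative_diff H) (simp add: o_def)
  qed
  then have "((\<lambda>t. H (t + T) - H t) has_vector_derivative 0) (at t)" for t by (simp add: G)
  from zero_vector_derivative_const[OF this] have HT: "H (t + T) - H t = T *\<^sub>R k" for t
    using T by (simp add: k_def) (metis add_0)
  show ?thesis
  proof (rule that[of "\<lambda>t. G t - k" "\<lambda>t. H t - t *\<^sub>R k"])
    show "((\<lambda>t. G t - k) has_vector_derivative f t) (at t)" for t
      by (auto intro!: derivative_eq_intros G)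
    show "((\<lambda>t. H t - t *\<^sub>R k) has_vector_derivative G t - k) (at t)" for t
      by (auto intro!: derivative_eq_intros H)
    show "H (t + T) - (t + T) *\<^sub>R k = H t - t *\<^sub>R k" for t
      using HT[of t] by (simp add: algebra_simps)
  qed (simp add: G)
qed

text \<open>A periodic function with constant derivative has derivative 0. This applies first to
  \<open>g\<close> and then to \<open>h\<close>, whose existence expresses that \<open>g\<close> has
  mean zero.\<close>

lemma periodic_second_antiderivative_unique:
  fixes g dg h :: "real \<Rightarrow> 'a::real_normed_vector"
  assumes T: "T > 0" and g: "\<And>t. (g has_vector_derivative dg t) (at t)" "\<And>t. g (t + T) = g t"
    and dg: "\<And>t. (dg has_vector_derivative 0) (at t)"
    and h: "\<And>t. (h has_vector_derivative g t) (at t)" "\<And>t. h (t + T) = h t"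
  shows "g t = 0"
proof -
  have affine: "c = 0" if p: "\<And>t. (p has_vector_derivative c) (at t)" "\<And>t. p (t + T) = p t"
    for p :: "real \<Rightarrow> 'a" and c
  proof -
    have "((\<lambda>t. p t - t *\<^sub>R c) has_vector_derivative 0) (at t)" for t
      by (auto intro!: derivative_eq_intros p)
    from zero_vector_derivative_const[OF this, of T 0] show "c = 0"
      using p(2)[of 0] T by simp
  qed
  have "dg t = dg 0" for t using zero_vector_derivative_const[OF dg] .
  then have "dg 0 = 0" using affine[of g "dg 0"] g by metis
  then have "dg t = 0" for t using \<open>\<And>t. dg t = dg 0\<close> by simp
  then have gc: "g t = g 0" for t using zero_vector_derivative_const[of g] g(1) by metis
  then have "g 0 = 0" using affine[of h "g 0"] h by metis
  then show ?thesis using gc by metis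
qed

text \<open>The two sides have the same second derivative, because reversing time twice gives the
  factor \<open>e * e = 1\<close>. Their difference is periodic with mean zero (witnessed by
  \<open>F3\<close>), so it vanishes.\<close>

lemma second_antiderivative_equivariant:
  fixes f F1 F2 F3 :: "real \<Rightarrow> 'a::real_normed_vector" and A :: "'a \<Rightarrow> 'a"
  assumes T: "T > 0" and A: "bounded_linear A" and e: "e = 1 \<or> e = - 1"
    and F1: "\<And>t. (F1 has_vector_derivative f t) (at t)"
    and F2: "\<And>t. (F2 has_vector_derivative F1 t) (at t)" "\<And>t. F2 (t + T) = F2 t"
    and F3: "\<And>t. (F3 has_vector_derivative F2 t) (at t)" "\<And>t. F3 (t + T) = F3 t"
    and eq: "\<And>t. f t = A (f (e * t + c))"
  shows "F2 t = A (F2 (e * t + c))"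
proof -
  interpret bounded_linear A by fact
  have chain: "((\<lambda>t. A (p (e * t + c))) has_vector_derivative e *\<^sub>R A (p' (e * t + c))) (at t)"
    if p: "\<And>t. (p has_vector_derivative p' t) (at t)" for p p' :: "real \<Rightarrow> 'a" and t
  proof -
    have "((\<lambda>t. e * t + c) has_real_derivative e) (at t)" by (auto intro!: derivative_eq_intros)
    then have "(p \<circ> (\<lambda>t. e * t + c) has_vector_derivative e *\<^sub>R p' (e * t + c)) (at t)"
      by (intro vector_diff_chain_at p) (simp add: has_real_derivative_iff_has_vector_derivative)
    then have "((\<lambda>t. A ((p \<circ> (\<lambda>t. e * t + c)) t)) has_vector_derivative A (e *\<^sub>R p' (e * t + c))) (at t)"
      by (rule has_vector_derivative)
    then show ?thesis by (simp add: scaleR o_def)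
  qed
  have ee: "e * e = 1" using e by auto
  have per: "p (e * (t + T) + c) = p (e * t + c)" if "\<And>t. p (t + T) = p t" for p :: "real \<Rightarrow> 'a" and t
    using e that[of "t + c"] that[of "- t - T + c"] by (auto simp: algebra_simps)
  have "F2 t - A (F2 (e * t + c)) = 0"
  proof (rule periodic_second_antiderivative_unique[OF T,
      where g = "\<lambda>t. F2 t - A (F2 (e * t + c))" and dg = "\<lambda>t. F1 t - e *\<^sub>R A (F1 (e * t + c))"
        and h = "\<lambda>t. F3 t - e *\<^sub>R A (F3 (e * t + c))"])
    show "((\<lambda>t. F2 t - A (F2 (e * t + c))) has_vector_derivative (F1 t - e *\<^sub>R A (F1 (e * t + c)))) (at t)" for t
      by (intro has_vector_derivative_diff F2 chain)
    show "((\<lambda>t. F1 t - e *\<^sub>R A (F1 (e * t + c))) has_vector_derivative 0) (at t)" for t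
    proof -
      have "((\<lambda>t. F1 t - e *\<^sub>R A (F1 (e * t + c))) has_vector_derivative
          (f t - e *\<^sub>R (e *\<^sub>R A (f (e * t + c))))) (at t)"
        by (intro has_vector_derivative_diff F1 chain
            bounded_linear.has_vector_derivative[OF bounded_linear_scaleR_right])
      moreover have "f t - e *\<^sub>R (e *\<^sub>R A (f (e * t + c))) = 0"
        using eq[of t] ee by simp
      ultimately show ?thesis by metis
    qed
    have "((\<lambda>t. F3 t - e *\<^sub>R A (F3 (e * t + c))) has_vector_derivative
        (F2 t - e *\<^sub>R (e *\<^sub>R A (F2 (e * t + c))))) (at t)" for t
      by (intro has_vector_derivative_diff F3 chain
          bounded_linear.has_vector_derivative[OF bounded_linear_scaleR_right])
    then show "((\<lambda>t. F3 t - e *\<^sub>R A (F3 (e * t + c))) has_vector_derivative (F2 t - A (F2 (e * t + c)))) (at t)" for t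
      using ee by simp
    show "F2 (t + T) - A (F2 (e * (t + T) + c)) = F2 t - A (F2 (e * t + c))" for t
      using per[of F2] F2 by simp
    show "F3 (t + T) - e *\<^sub>R A (F3 (e * (t + T) + c)) = F3 t - e *\<^sub>R A (F3 (e * t + c))" for t
      using per[of F3] F3 by simp
  qed
  then show ?thesis by simp
qed

section \<open>The symmetry group\<close>

lemma bounded_linear_conf_act:
  assumes "orthogonal_transformation (\<rho> g)"
  shows "bounded_linear (conf_act \<rho> \<sigma> g)"
proof -
  have l: "linear (\<rho> g)" using assms by (rule orthogonal_transformation_linear)
  show ?thesis
    by (rule linear_conv_bounded_linear[THEN iffD1])
       (auto intro!: linearI simp: conf_act_def vec_eq_iff linear_add[OF l] linear_cmul[OF l])
qed

text \<open>Orthogonal maps preserve distances and carry difference vectors along; the relabelling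
  is a reindexing of the force sum because it exchanges bodies of equal mass.\<close>

lemma acceleration_conf_act:
  assumes \<rho>: "orthogonal_transformation (\<rho> g)" and \<sigma>: "bij (\<sigma> g)" and mass: "\<And>i. mass m (\<sigma> g i) = mass m i"
  shows "acceleration m (conf_act \<rho> \<sigma> g x) = conf_act \<rho> \<sigma> g (acceleration m x)"
proof (rule vec_eq_iff[THEN iffD2], rule allI)
  fix i
  have l: "linear (\<rho> g)" using \<rho> by (rule orthogonal_transformation_linear)
  define k where "k = inv_into UNIV (\<sigma> g) i"
  have i: "i = \<sigma> g k" using \<sigma> by (simp add: k_def bij_is_surj surj_f_inv_f)
  have inv_s: "inv_into UNIV (\<sigma> g) (\<sigma> g j) = j" for j using \<sigma> by (simp add: bij_is_inj)
  have bij: "bij_betw (\<sigma> g) (UNIV - {k}) (UNIV - {i})"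
    using bij_betw_DiffI[OF \<sigma>, of "{k}" "{i}"] i[symmetric] by simp
  have "acceleration m (conf_act \<rho> \<sigma> g x) $ i =
      (\<Sum>j\<in>UNIV - {i}. (mass m j / norm (\<rho> g (x $ inv_into UNIV (\<sigma> g) j) - \<rho> g (x $ k)) ^ 3) *\<^sub>R
        (\<rho> g (x $ inv_into UNIV (\<sigma> g) j) - \<rho> g (x $ k)))"
    by (simp add: acceleration_def conf_act_def k_def)
  also have "\<dots> = (\<Sum>j\<in>UNIV - {k}. (mass m j / norm (\<rho> g (x $ j) - \<rho> g (x $ k)) ^ 3) *\<^sub>R
        (\<rho> g (x $ j) - \<rho> g (x $ k)))"
    by (subst sum.reindex_bij_betw[OF bij, symmetric]) (simp add: inv_s mass)
  also have "\<dots> = (\<Sum>j\<in>UNIV - {k}. (mass m j / norm (x $ j - x $ k) ^ 3) *\<^sub>R \<rho> g (x $ j - x $ k))"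
    by (simp add: linear_diff[OF l, symmetric] orthogonal_transformation_norm[OF \<rho>])
  also have "\<dots> = conf_act \<rho> \<sigma> g (acceleration m x) $ i"
    by (simp add: conf_act_def acceleration_def k_def linear_sum[OF l] linear_cmul[OF l])
  finally show "acceleration m (conf_act \<rho> \<sigma> g x) $ i = conf_act \<rho> \<sigma> g (acceleration m x) $ i" .
qed

text \<open>In a finite group products of generators reach everything, so no closure under inverses
  is demanded: the identity arises as \<open>h1 h1\<close>, the powers of the rotation from
  \<open>h1 h2\<close>.\<close>

lemma sym_grp_induct:
  assumes L: "L > 0" and mult: "\<And>g h. \<lbrakk>g \<in> carrier (sym_grp L); h \<in> carrier (sym_grp L); P g; P h\<rbrakk>
      \<Longrightarrow> P (g \<otimes>\<^bsub>sym_grp L\<^esub> h)"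
    and gen: "P (h1 L)" "P (h2 L)" "P (h3 L)" and g: "g \<in> carrier (sym_grp L)"
  shows "P g"
proof -
  note h = h_in_carrier[OF L]
  have mult_eq: "((k, a), c) \<otimes>\<^bsub>sym_grp L\<^esub> ((l, b), d) =
      (((k + (if a then - l else l)) mod int L, a \<noteq> b), (c + d) mod 2)" for k l c d a b
    by (simp add: sym_grp_def dihedral_group_def mult_integer_mod_group)
  have car: "((k, a), c) \<in> carrier (sym_grp L) \<longleftrightarrow> 0 \<le> k \<and> k < int L \<and> (c = 0 \<or> c = 1)" for k a c
    by (auto simp: sym_grp_def dihedral_group_def carrier_integer_mod_group)
  \<comment> \<open>The rotation \<open>h1 h2\<close>. Writing \<open>1 mod int L\<close> covers
    \<open>L = 1\<close>, where it is the identity.\<close>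
  have r: "P ((1 mod int L, False), 0)"
    using mult[OF h(1,2) gen(1,2)] by (simp add: h1_def h2_def mult_eq mod_simps)
  have rk: "P ((int k mod int L, False), 0)" for k
  proof (induction k)
    case 0
    show ?case using mult[OF h(1,1) gen(1,1)] by (simp add: h1_def mult_eq)
  next
    case (Suc k)
    have "P (((int k mod int L, False), 0) \<otimes>\<^bsub>sym_grp L\<^esub> ((1 mod int L, False), 0))"
      using L by (intro mult Suc r) (simp_all add: car)
    then show ?case by (simp add: mult_eq mod_simps add.commute)
  qed
  have rf: "P ((int k mod int L, True), 0)" for k
  proof -
    have "P (((int k mod int L, False), 0) \<otimes>\<^bsub>sym_grp L\<^esub> h1 L)"
      using L by (intro mult rk gen h) (simp_all add: car)
    then show ?thesis by (simp add: h1_def mult_eq)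
  qed
  have base: "P ((int k mod int L, a), 0)" for k a using rk rf by (cases a) auto
  have base1: "P ((int k mod int L, a), 1)" for k a
  proof -
    have "P (((int k mod int L, a), 0) \<otimes>\<^bsub>sym_grp L\<^esub> h3 L)"
      using L by (intro mult base gen h) (simp_all add: car)
    then show ?thesis by (cases a) (simp_all add: h3_def mult_eq)
  qed
  obtain k a c where kac: "g = ((k, a), c)" by (metis prod.exhaust)
  then have "int (nat k) mod int L = k" "c = 0 \<or> c = 1" using g by (auto simp: car)
  then show ?thesis using base[of "nat k" a] base1[of "nat k" a] kac by metis
qed

text \<open>Splitting \<open>z\<close> along and across the line gives twice the projection minus
  \<open>z\<close>; with \<open>u\<close> of norm 1, twice \<open>u \<bullet> z\<close> is
  \<open>u * cnj z + cnj u * z\<close>. In this form a product of two reflections is visibly a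
  complex multiplication.\<close>

lemma reflection_formula:
  assumes l: "line_through_origin l" and R: "reflection_along l R" and u: "u \<in> l" "norm u = 1"
  shows "R z = u\<^sup>2 * cnj z"
proof -
  have sub: "subspace l" and dim: "dim l = 1" using l by (auto simp: line_through_origin_def)
  have lin: "linear R" and fixp: "\<And>z. z \<in> l \<Longrightarrow> R z = z"
    and neg: "\<And>z. (\<forall>w\<in>l. w \<bullet> z = 0) \<Longrightarrow> R z = - z"
    using R unfolding reflection_along_def by blast+
  have "u \<noteq> 0" using u by auto
  have span: "span {u} = l"
  proof (rule subspace_dim_equal)
    show "span {u} \<subseteq> l" using u(1) sub by (intro span_minimal) auto
    show "dim l \<le> dim (span {u})" using dim \<open>u \<noteq> 0\<close> by simp
  qed (use sub in auto)
  define c where "c = u \<bullet> z"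
  have "\<forall>w\<in>l. w \<bullet> (z - c *\<^sub>R u) = 0"
  proof
    fix w assume "w \<in> l"
    then obtain k where "w = k *\<^sub>R u" using span by (auto simp: span_singleton)
    then show "w \<bullet> (z - c *\<^sub>R u) = 0"
      using norm_eq_1[of u] u(2) by (simp add: c_def inner_diff_right)
  qed
  then have 1: "R (z - c *\<^sub>R u) = - (z - c *\<^sub>R u)" by (rule neg)
  have 2: "R (c *\<^sub>R u) = c *\<^sub>R u" by (rule fixp[OF subspace_scale[OF sub u(1)]])
  have "R z = R (z - c *\<^sub>R u) + R (c *\<^sub>R u)"
    using linear_add[OF lin, of "z - c *\<^sub>R u" "c *\<^sub>R u"] by simp
  also have "\<dots> = (2 * c) *\<^sub>R u - z" unfolding 1 2
    by (simp add: scaleR_2 flip: scaleR_scaleR)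
  also have "\<dots> = u\<^sup>2 * cnj z"
  proof -
    have 1: "(2 * c) *\<^sub>R 1 = u * cnj z + cnj u * z"
      by (simp add: complex_eq_iff c_def inner_complex_def)
    have "(2 * c) *\<^sub>R u = u * ((2 * c) *\<^sub>R 1)" by simp
    then have "(2 * c) *\<^sub>R u = u * (u * cnj z + cnj u * z)" unfolding 1 .
    also have "\<dots> = u\<^sup>2 * cnj z + u * cnj u * z"
      by (simp add: power2_eq_square distrib_left mult.assoc)
    also have "u * cnj u = 1" using u(2) by (simp add: complex_norm_square[symmetric])
    finally show ?thesis by simp
  qed
  finally show ?thesis .
qed

section \<open>The symmetry equations of the four-body problem\<close>

locale four_body_symmetry =
  fixes T m :: real and q L :: nat and l1 l2 :: "complex set"
    and \<tau> :: "(int \<times> bool) \<times> int \<Rightarrow> real \<Rightarrow> real"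
    and \<rho> :: "(int \<times> bool) \<times> int \<Rightarrow> complex \<Rightarrow> complex"
    and \<sigma> :: "(int \<times> bool) \<times> int \<Rightarrow> 4 \<Rightarrow> 4"
  assumes T: "T > 0" and m: "m > 0" and q: "q > 2" and L: "L = lcm 2 q"
    and \<tau>: "\<tau> \<in> hom (sym_grp L) (BijGroup (circle T))"
    and \<tau>1: "\<forall>t\<in>circle T. \<tau> (h1 L) t = (- t) rmod T"
    and \<tau>2: "\<forall>t\<in>circle T. \<tau> (h2 L) t = (T / real L - t) rmod T"
    and \<tau>3: "\<forall>t\<in>circle T. \<tau> (h3 L) t = t"
    and \<sigma>: "\<sigma> \<in> hom (sym_grp L) (BijGroup UNIV)"
    and \<sigma>1: "\<sigma> (h1 L) = Transposition.transpose 1 2 \<circ> Transposition.transpose 3 4"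
    and \<sigma>2: "\<sigma> (h2 L) = Transposition.transpose 1 2"
    and \<sigma>3: "\<sigma> (h3 L) = Transposition.transpose 1 2 \<circ> Transposition.transpose 3 4"
    and l1: "line_through_origin l1" and l2: "line_through_origin l2"
    and angle: "lines_meet_at_angle l1 l2 (pi / real q)"
    and \<rho>: "\<rho> \<in> hom (sym_grp L) O2"
    and \<rho>1: "reflection_along l1 (\<rho> (h1 L))"
    and \<rho>2: "reflection_along l2 (\<rho> (h2 L))"
    and \<rho>3: "\<rho> (h3 L) = (\<lambda>z. cis pi * z)"
begin

abbreviation "S \<equiv> fixed_loops T m (sym_grp L) \<tau> \<rho> \<sigma>"
abbreviation "A1 \<equiv> conf_act \<rho> \<sigma> (h1 L)"
abbreviation "A2 \<equiv> conf_act \<rho> \<sigma> (h2 L)"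
abbreviation "A3 \<equiv> conf_act \<rho> \<sigma> (h3 L)"

lemma L_pos: "L > 0"
  using q by (simp add: L lcm_pos_nat)

lemma \<tau>_circle: "g \<in> carrier (sym_grp L) \<Longrightarrow> t \<in> circle T \<Longrightarrow> \<tau> g t \<in> circle T"
  using \<tau> by (auto simp: hom_def BijGroup_def Bij_def bij_betw_def)

lemma \<tau>_mult: "g \<in> carrier (sym_grp L) \<Longrightarrow> h \<in> carrier (sym_grp L) \<Longrightarrow> t \<in> circle T \<Longrightarrow>
    \<tau> (g \<otimes>\<^bsub>sym_grp L\<^esub> h) t = \<tau> g (\<tau> h t)"
  using hom_mult[OF \<tau>, of g h] hom_in_carrier[OF \<tau>, of g] hom_in_carrier[OF \<tau>, of h]
  by (simp add: BijGroup_def compose_def)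

lemma \<sigma>_bij: "g \<in> carrier (sym_grp L) \<Longrightarrow> bij (\<sigma> g)"
  using \<sigma> by (auto simp: hom_def BijGroup_def Bij_def)

lemma \<sigma>_mult: "g \<in> carrier (sym_grp L) \<Longrightarrow> h \<in> carrier (sym_grp L) \<Longrightarrow>
    \<sigma> (g \<otimes>\<^bsub>sym_grp L\<^esub> h) = \<sigma> g \<circ> \<sigma> h"
  using hom_mult[OF \<sigma>, of g h] hom_in_carrier[OF \<sigma>, of g] hom_in_carrier[OF \<sigma>, of h]
  by (simp add: BijGroup_def compose_def fun_eq_iff)

lemma \<rho>_orthogonal: "g \<in> carrier (sym_grp L) \<Longrightarrow> orthogonal_transformation (\<rho> g)"
  using \<rho> by (auto simp: hom_def O2_def)

lemma \<rho>_mult: "g \<in> carrier (sym_grp L) \<Longrightarrow> h \<in> carrier (sym_grp L) \<Longrightarrow>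
    \<rho> (g \<otimes>\<^bsub>sym_grp L\<^esub> h) = \<rho> g \<circ> \<rho> h"
  using \<rho> by (auto simp: hom_def O2_def)

lemma rmod_circle: "t rmod T \<in> circle T"
  using T by (auto simp: circle_def rmod_less rmod_nonneg)

lemma rmod_id: "t \<in> circle T \<Longrightarrow> t rmod T = t"
  using T by (auto simp: circle_def)

text \<open>Inverting the time argument and the index reverses the order of composition, which makes
  this an action from the left. Values of \<open>\<tau>\<close> are prescribed on
  \<open>circle T\<close> only, hence the care that every time argument lies there.\<close>

lemma loop_act_mult:
  assumes g: "g \<in> carrier (sym_grp L)" and h: "h \<in> carrier (sym_grp L)"
  shows "loop_act T (sym_grp L) \<tau> \<rho> \<sigma> (g \<otimes>\<^bsub>sym_grp L\<^esub> h) x =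
    loop_act T (sym_grp L) \<tau> \<rho> \<sigma> g (loop_act T (sym_grp L) \<tau> \<rho> \<sigma> h x)"
proof
  fix t
  interpret group "sym_grp L" by (rule group_sym_grp[OF L_pos])
  have c: "\<tau> (inv\<^bsub>sym_grp L\<^esub> g) (t rmod T) \<in> circle T"
    using \<tau>_circle rmod_circle g by auto
  have "inv_into UNIV (\<sigma> g \<circ> \<sigma> h) i = inv_into UNIV (\<sigma> h) (inv_into UNIV (\<sigma> g) i)" for i
    using o_inv_distrib[of "\<sigma> g" "\<sigma> h"] \<sigma>_bij g h by (simp add: fun_eq_iff)
  then show "loop_act T (sym_grp L) \<tau> \<rho> \<sigma> (g \<otimes>\<^bsub>sym_grp L\<^esub> h) x t =
      loop_act T (sym_grp L) \<tau> \<rho> \<sigma> g (loop_act T (sym_grp L) \<tau> \<rho> \<sigma> h x) t"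
    using g h c rmod_circle
    by (simp add: loop_act_def conf_act_def vec_eq_iff inv_mult_group \<tau>_mult \<sigma>_mult \<rho>_mult rmod_id)
qed

lemma inv_generators:
  "inv\<^bsub>sym_grp L\<^esub> (h1 L) = h1 L" "inv\<^bsub>sym_grp L\<^esub> (h2 L) = h2 L" "inv\<^bsub>sym_grp L\<^esub> (h3 L) = h3 L"
proof -
  interpret group "sym_grp L" by (rule group_sym_grp[OF L_pos])
  note h = h_in_carrier[OF L_pos]
  have "h1 L \<otimes>\<^bsub>sym_grp L\<^esub> h1 L = \<one>\<^bsub>sym_grp L\<^esub>" "h2 L \<otimes>\<^bsub>sym_grp L\<^esub> h2 L = \<one>\<^bsub>sym_grp L\<^esub>"
    "h3 L \<otimes>\<^bsub>sym_grp L\<^esub> h3 L = \<one>\<^bsub>sym_grp L\<^esub>"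
    by (simp_all add: h1_def h2_def h3_def sym_grp_def dihedral_group_def mult_integer_mod_group)
  then show "inv\<^bsub>sym_grp L\<^esub> (h1 L) = h1 L" "inv\<^bsub>sym_grp L\<^esub> (h2 L) = h2 L" "inv\<^bsub>sym_grp L\<^esub> (h3 L) = h3 L"
    using inv_equality h by auto
qed

text \<open>Each generator is its own inverse, and periodicity of \<open>x\<close> absorbs the
  reductions modulo \<open>T\<close>; the symmetry becomes a set of equations on the whole
  line.\<close>

lemma loop_act_generators:
  assumes x: "\<And>t. x (t + T) = x t"
  shows "loop_act T (sym_grp L) \<tau> \<rho> \<sigma> (h1 L) x t = A1 (x (- t))"
    and "loop_act T (sym_grp L) \<tau> \<rho> \<sigma> (h2 L) x t = A2 (x (T / real L - t))"
    and "loop_act T (sym_grp L) \<tau> \<rho> \<sigma> (h3 L) x t = A3 (x t)"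
proof -
  obtain k :: int where k: "t rmod T = t + of_int k * T" by (rule rmod_eq_add_int)
  have "x (- (t rmod T)) = x (- t)" "x (T / real L - t rmod T) = x (T / real L - t)"
    using periodic_of_int[of x T "- t" "- k", OF x] periodic_of_int[of x T "T / real L - t" "- k", OF x]
    by (simp_all add: k algebra_simps)
  then show "loop_act T (sym_grp L) \<tau> \<rho> \<sigma> (h1 L) x t = A1 (x (- t))"
    "loop_act T (sym_grp L) \<tau> \<rho> \<sigma> (h2 L) x t = A2 (x (T / real L - t))"
    "loop_act T (sym_grp L) \<tau> \<rho> \<sigma> (h3 L) x t = A3 (x t)"
    using rmod_circle \<tau>1 \<tau>2 \<tau>3 periodic_rmod[of x T, OF x]
    by (simp_all add: loop_act_def inv_generators)
qed

text \<open>By \<open>loop_act_mult\<close> the elements that fix \<open>x\<close> are closed under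
  products, so the three generators decide.\<close>

lemma fixed_loops_iff:
  "x \<in> S \<longleftrightarrow> x \<in> loops T m \<and> (\<forall>t. x t = A1 (x (- t))) \<and> (\<forall>t. x t = A2 (x (T / real L - t))) \<and>
     (\<forall>t. x t = A3 (x t))"
proof (cases "x \<in> loops T m")
  case True
  then have per: "\<And>t. x (t + T) = x t" by (auto simp: loops_def)
  note gen = loop_act_generators[of x, OF per]
  let ?P = "\<lambda>g. loop_act T (sym_grp L) \<tau> \<rho> \<sigma> g x = x"
  have "(\<forall>g\<in>carrier (sym_grp L). ?P g) \<longleftrightarrow> ?P (h1 L) \<and> ?P (h2 L) \<and> ?P (h3 L)"
  proof (intro iffI conjI ballI)
    fix g assume h: "?P (h1 L) \<and> ?P (h2 L) \<and> ?P (h3 L)" and g: "g \<in> carrier (sym_grp L)"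
    show "?P g"
    proof (rule sym_grp_induct[OF L_pos, of ?P, OF _ _ _ _ g])
      fix g h assume "g \<in> carrier (sym_grp L)" "h \<in> carrier (sym_grp L)" "?P g" "?P h"
      then show "?P (g \<otimes>\<^bsub>sym_grp L\<^esub> h)" by (simp only: loop_act_mult)
    qed (use h in blast)+
  qed (use h_in_carrier[OF L_pos] in blast)+
  moreover have "?P (h1 L) \<longleftrightarrow> (\<forall>t. x t = A1 (x (- t)))"
    "?P (h2 L) \<longleftrightarrow> (\<forall>t. x t = A2 (x (T / real L - t)))" "?P (h3 L) \<longleftrightarrow> (\<forall>t. x t = A3 (x t))"
    unfolding fun_eq_iff gen by (intro all_cong1 eq_commute)+
  ultimately show ?thesis using True unfolding fixed_loops_def by blast
qed (simp add: fixed_loops_def)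

lemma fixed_loopsD:
  assumes "x \<in> S"
  shows "x t = A1 (x (- t))" "x t = A2 (x (T / real L - t))" "x t = A3 (x t)" "x \<in> loops T m"
proof -
  note h = assms[unfolded fixed_loops_iff]
  show "x t = A1 (x (- t))" by (rule h[THEN conjunct2, THEN conjunct1, rule_format])
  show "x t = A2 (x (T / real L - t))"
    by (rule h[THEN conjunct2, THEN conjunct2, THEN conjunct1, rule_format])
  show "x t = A3 (x t)" by (rule h[THEN conjunct2, THEN conjunct2, THEN conjunct2, rule_format])
  show "x \<in> loops T m" by (rule h[THEN conjunct1])
qed

lemma bounded_linear_A: "bounded_linear A1" "bounded_linear A2" "bounded_linear A3"
  by (intro bounded_linear_conf_act \<rho>_orthogonal h_in_carrier[OF L_pos])+

lemma transposition_inv: "inv_into UNIV (Transposition.transpose (1::4) 2 \<circ> Transposition.transpose 3 4) =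
    Transposition.transpose 1 2 \<circ> Transposition.transpose 3 4"
  "inv_into UNIV (Transposition.transpose (1::4) 2) = Transposition.transpose 1 2"
proof -
  show "inv_into UNIV (Transposition.transpose (1::4) 2 \<circ> Transposition.transpose 3 4) =
      Transposition.transpose 1 2 \<circ> Transposition.transpose 3 4"
    by (rule inv_unique_comp) (auto simp: fun_eq_iff Transposition.transpose_def)
qed simp

lemma distinct_4: "(1::4) \<noteq> 2" "(1::4) \<noteq> 3" "(1::4) \<noteq> 4" "(2::4) \<noteq> 3" "(2::4) \<noteq> 4" "(3::4) \<noteq> 4"
  by simp_all

lemma A_components:
  "A1 x $ 1 = \<rho> (h1 L) (x $ 2)" "A1 x $ 2 = \<rho> (h1 L) (x $ 1)"
  "A1 x $ 3 = \<rho> (h1 L) (x $ 4)" "A1 x $ 4 = \<rho> (h1 L) (x $ 3)"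
  "A2 x $ 1 = \<rho> (h2 L) (x $ 2)" "A2 x $ 2 = \<rho> (h2 L) (x $ 1)"
  "A2 x $ 3 = \<rho> (h2 L) (x $ 3)" "A2 x $ 4 = \<rho> (h2 L) (x $ 4)"
  "A3 x $ 1 = - (x $ 2)" "A3 x $ 2 = - (x $ 1)" "A3 x $ 3 = - (x $ 4)" "A3 x $ 4 = - (x $ 3)"
  by (simp_all add: conf_act_def \<sigma>1 \<sigma>2 \<sigma>3 transposition_inv \<rho>3 Transposition.transpose_def)

lemma acceleration_A:
  "acceleration m (A1 x) = A1 (acceleration m x)" "acceleration m (A2 x) = A2 (acceleration m x)"
  "acceleration m (A3 x) = A3 (acceleration m x)"
  using h_in_carrier[OF L_pos]
  by (intro acceleration_conf_act \<rho>_orthogonal \<sigma>_bij;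
      simp add: \<sigma>1 \<sigma>2 \<sigma>3 mass_def Transposition.transpose_def)+

text \<open>Opposite bodies have equal masses, so central symmetry alone puts the centre of mass at
  0. Limits and competitors thereby satisfy this constraint automatically.\<close>

lemma configurations_A3:
  assumes "x = A3 x"
  shows "x \<in> configurations m"
proof -
  have "x $ 2 = - (x $ 1)" "x $ 4 = - (x $ 3)"
    using arg_cong[OF assms, of "\<lambda>y. y $ 2"] arg_cong[OF assms, of "\<lambda>y. y $ 4"]
    unfolding A_components .
  then show ?thesis by (simp add: configurations_def sum_4 mass_def)
qed

text \<open>The product of the reflections multiplies by the square of \<open>v * cnj u\<close>, a
  unit number with real part \<open>cos (pi / real q)\<close>. For \<open>q > 2\<close> this lies
  strictly between 0 and 1, which excludes the square roots of 1 and of -1.\<close>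

lemma rotation_factor:
  obtains d where "\<And>z. \<rho> (h2 L) (\<rho> (h1 L) z) = d * z" "norm d = 1" "d \<noteq> 1" "d \<noteq> -1"
proof -
  obtain u v where uv: "u \<in> l1" "v \<in> l2" "norm u = 1" "norm v = 1" "arccos (u \<bullet> v) = pi / real q"
    using angle by (auto simp: lines_meet_at_angle_def)
  define d where "d = v * cnj u"
  have "\<bar>u \<bullet> v\<bar> \<le> 1" using Cauchy_Schwarz_ineq2[of u v] uv by simp
  then have "u \<bullet> v = cos (pi / real q)" using uv(5) by (metis cos_arccos_abs)
  then have Re_d: "Re d = cos (pi / real q)" by (simp add: d_def inner_complex_def algebra_simps)
  have "0 < pi / real q" "pi / real q < pi / 2" using q by (simp_all add: field_simps)
  moreover from this have "pi / real q \<le> pi" using pi_gt_zero by linarith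
  ultimately have "0 < Re d" "Re d < 1"
    unfolding Re_d using cos_monotone_0_pi[of 0 "pi / real q"] by (auto intro: cos_gt_zero_pi)
  moreover have "d\<^sup>2 = 1 \<Longrightarrow> d = 1 \<or> d = -1" by (simp add: power2_eq_1_iff)
  moreover have "d\<^sup>2 = -1 \<Longrightarrow> d = \<i> \<or> d = -\<i>"
    using power2_eq_iff[of d \<i>] by simp
  ultimately have ne: "d\<^sup>2 \<noteq> 1" "d\<^sup>2 \<noteq> -1" by auto
  show ?thesis
  proof (rule that[of "d\<^sup>2"])
    show "\<rho> (h2 L) (\<rho> (h1 L) z) = d\<^sup>2 * z" for z
      using reflection_formula[OF l1 \<rho>1 uv(1,3), of z]
        reflection_formula[OF l2 \<rho>2 uv(2,4), of "\<rho> (h1 L) z"]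
      by (simp add: d_def power_mult_distrib)
    show "norm (d\<^sup>2) = 1" using uv by (simp add: d_def norm_mult norm_power)
    show "d\<^sup>2 \<noteq> 1" "d\<^sup>2 \<noteq> -1" by (rule ne)+
  qed
qed

text \<open>Two time reflections compose to the shift by \<open>T / real L\<close>. Bodies 1 and 2
  are exchanged by both generators, hence return to their places; bodies 3 and 4 are exchanged by
  \<open>h1\<close> alone, and central symmetry turns this exchange into the sign in
  \<open>- d\<close>.\<close>

lemma shift_components:
  assumes x1: "\<And>t. x t = A1 (x (- t))" and x2: "\<And>t. x t = A2 (x (T / real L - t))" and x3: "\<And>t. x t = A3 (x t)"
    and d: "\<And>z. \<rho> (h2 L) (\<rho> (h1 L) z) = d * z"
  shows "x (t + T / real L) = A2 (A1 (x t))"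
    and "x (t + T / real L) $ 1 = d * x t $ 1" "x (t + T / real L) $ 2 = d * x t $ 2"
    and "x (t + T / real L) $ 3 = - d * x t $ 3" "x (t + T / real L) $ 4 = - d * x t $ 4"
proof -
  have "x (t + T / real L) = A2 (x (- t))" using x2[of "t + T / real L"] by simp
  also have "x (- t) = A1 (x t)" using x1[of "- t"] by simp
  finally show e: "x (t + T / real L) = A2 (A1 (x t))" .
  have "x t $ 4 = - (x t $ 3)" using arg_cong[OF x3[of t], of "\<lambda>y. y $ 4"] unfolding A_components .
  then show "x (t + T / real L) $ 1 = d * x t $ 1" "x (t + T / real L) $ 2 = d * x t $ 2"
    "x (t + T / real L) $ 3 = - d * x t $ 3" "x (t + T / real L) $ 4 = - d * x t $ 4"
    unfolding e by (simp_all add: A_components d)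
qed

lemma not_homographic:
  assumes x: "x \<in> S" and cf: "collision_free x"
  shows "\<not> homographic x"
proof
  assume "homographic x"
  then obtain s where s: "\<And>t i. x t $ i = s t * x 0 $ i" by (auto simp: homographic_def)
  note sym = fixed_loopsD[OF x]
  obtain d where d: "\<And>z. \<rho> (h2 L) (\<rho> (h1 L) z) = d * z" "norm d = 1"
    using rotation_factor by metis
  have "x 0 $ 2 = - (x 0 $ 1)" "x 0 $ 4 = - (x 0 $ 3)"
    using arg_cong[OF sym(3)[of 0], of "\<lambda>y. y $ 2"] arg_cong[OF sym(3)[of 0], of "\<lambda>y. y $ 4"]
    unfolding A_components .
  \<comment> \<open>An antipodal pair that does not collide avoids the origin, so its position can
    be cancelled from the equations for \<open>s\<close>.\<close>
  moreover have "x 0 $ 1 \<noteq> x 0 $ 2" "x 0 $ 3 \<noteq> x 0 $ 4" using cf by (auto simp: collision_free_def)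
  ultimately have ne: "x 0 $ 1 \<noteq> 0" "x 0 $ 3 \<noteq> 0" by auto
  have "s (T / real L) * x 0 $ 1 = d * x 0 $ 1" "s (T / real L) * x 0 $ 3 = - d * x 0 $ 3"
    using shift_components(2,4)[OF sym(1-3) d(1), of 0] s[of "T / real L" 1] s[of "T / real L" 3]
    by simp_all
  then have "s (T / real L) = d" "s (T / real L) = - d" using ne by simp_all
  then show False using d(2) by auto
qed

end

section \<open>Existence of minimizers\<close>

text \<open>The Hoelder estimate of exponent 1/2 for H1 functions, with the square root linearized
  by Young's inequality; the weight \<open>l\<close> is left open for the applications.\<close>

lemma loops_increment_bound:
  assumes x: "x \<in> loops T m" and ab: "0 \<le> a" "a \<le> b" "b \<le> T" and l: "l > 0"
  shows "norm (x b - x a) \<le>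
    (l * (LINT t:{0..T}|lborel. (norm (weak_derivative x t))\<^sup>2) + (b - a) / l) / 2"
proof -
  define v where "v = weak_derivative x"
  have v: "has_weak_derivative x v" and v2: "set_integrable lborel {0..T} (\<lambda>t. (norm (v t))\<^sup>2)"
    using loops_weak_derivative[OF x] by (auto simp: v_def)
  have vi: "set_integrable lborel {a..b} v" and xv: "x b - x a = (LINT t:{a..b}|lborel. v t)"
    using v ab by (auto simp: has_weak_derivative_def)
  have v2': "set_integrable lborel {a..b} (\<lambda>t. (norm (v t))\<^sup>2)"
    by (rule set_integrable_subset[OF v2]) (use ab in auto)
  define k where "k = 1 / l"
  have ci: "set_integrable lborel {a..b} (\<lambda>t. k)"
    by (intro borel_integrable_atLeastAtMost' continuous_intros)
  have "norm (x b - x a) \<le> (LINT t:{a..b}|lborel. norm (v t))"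
    unfolding xv set_lebesgue_integral_def
    by (rule order_trans[OF integral_norm_bound]) simp
  also have "\<dots> \<le> (LINT t:{a..b}|lborel. (l * (norm (v t))\<^sup>2 + k) / 2)"
  proof (rule set_integral_mono)
    show "set_integrable lborel {a..b} (\<lambda>t. norm (v t))"
      using vi by (rule set_integrable_norm)
    show "set_integrable lborel {a..b} (\<lambda>t. (l * (norm (v t))\<^sup>2 + k) / 2)"
      using v2' ci by simp
  qed (use le_weighted_square[OF l] in \<open>auto simp: k_def\<close>)
  also have "\<dots> = (l * (LINT t:{a..b}|lborel. (norm (v t))\<^sup>2) + (b - a) * k) / 2"
  proof -
    have c: "(LINT t:{a..b}|lborel. k) = (b - a) * k"
      unfolding set_lebesgue_integral_def using ab by simp
    have "(LINT t:{a..b}|lborel. (l * (norm (v t))\<^sup>2 + k) / 2) =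
        (LINT t:{a..b}|lborel. l * (norm (v t))\<^sup>2 + k) / 2" by simp
    also have "\<dots> = (l * (LINT t:{a..b}|lborel. (norm (v t))\<^sup>2) + (b - a) * k) / 2"
      using v2' ci by (subst set_integral_add(2)) (simp_all add: c)
    finally show ?thesis .
  qed
  also have "(LINT t:{a..b}|lborel. (norm (v t))\<^sup>2) \<le> (LINT t:{0..T}|lborel. (norm (v t))\<^sup>2)"
    unfolding set_lebesgue_integral_def using v2 v2' ab
    by (intro integral_mono) (auto simp: set_integrable_def indicator_def)
  finally show ?thesis using l by (simp add: v_def k_def)
qed

text \<open>In coordinates scaled by the square roots of the masses the kinetic energy is half a
  Euclidean square norm, the form that the lower semicontinuity theorem treats.\<close>

lemma kinetic_energy_diagonal:
  assumes "m > 0"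
  shows "kinetic_energy m v = (norm (diagonal (\<lambda>i. sqrt (mass m i)) v))\<^sup>2 / 2"
  using mass_pos[OF assms]
  by (simp add: kinetic_energy_def power2_norm_eq_inner inner_vec_def diagonal_def sum_divide_distrib
      less_imp_le flip: mult.assoc)

lemma kinetic_energy_lower_semicontinuous:
  fixes x :: "nat \<Rightarrow> real \<Rightarrow> complex^4"
  assumes T: "T > 0" and m: "m > 0" and x: "\<And>n. x n \<in> loops T m"
    and c: "(\<lambda>n. LINT t:{0..T}|lborel. kinetic_energy m (weak_derivative (x n) t)) \<longlonglongrightarrow> C"
    and per: "\<And>t. y (t + T) = y t"
    and unif: "\<And>e. e > 0 \<Longrightarrow> \<exists>N. \<forall>n\<ge>N. \<forall>t\<in>{0..T}. norm (x n t - y t) \<le> e"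
  obtains v where "has_weak_derivative y v" "set_integrable lborel {0..T} (\<lambda>t. (norm (v t))\<^sup>2)"
    "(LINT t:{0..T}|lborel. kinetic_energy m (v t)) \<le> C"
proof -
  define D where "D = diagonal (\<lambda>i. sqrt (mass m i))"
  define D' where "D' = diagonal (\<lambda>i. 1 / sqrt (mass m i))"
  interpret D: bounded_linear D unfolding D_def by (rule bounded_linear_diagonal)
  interpret D': bounded_linear D' unfolding D'_def by (rule bounded_linear_diagonal)
  have ne: "mass m i \<noteq> 0" for i using mass_pos[OF m, of i] by simp
  have DD': "D (D' z) = z" "D' (D z) = z" for z
    using ne by (simp_all add: D_def D'_def diagonal_def vec_eq_iff)
  have kin: "kinetic_energy m z = (norm (D z))\<^sup>2 / 2" for z
    unfolding D_def by (rule kinetic_energy_diagonal[OF m])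
  have D_int: "set_integrable lborel A (\<lambda>t. D (f t))" "(LINT t:A|lborel. D (f t)) = D (LINT t:A|lborel. f t)"
    if "set_integrable lborel A f" for A and f :: "real \<Rightarrow> complex^4"
    using that integrable_bounded_linear[OF D.bounded_linear_axioms, of lborel "\<lambda>t. indicator A t *\<^sub>R f t"]
      integral_bounded_linear[OF D.bounded_linear_axioms, of lborel "\<lambda>t. indicator A t *\<^sub>R f t"]
    by (simp_all add: set_integrable_def set_lebesgue_integral_def D.scaleR)
  have D'_int: "set_integrable lborel A (\<lambda>t. D' (f t))" "(LINT t:A|lborel. D' (f t)) = D' (LINT t:A|lborel. f t)"
    if "set_integrable lborel A f" for A and f :: "real \<Rightarrow> complex^4"
    using that integrable_bounded_linear[OF D'.bounded_linear_axioms, of lborel "\<lambda>t. indicator A t *\<^sub>R f t"]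
      integral_bounded_linear[OF D'.bounded_linear_axioms, of lborel "\<lambda>t. indicator A t *\<^sub>R f t"]
    by (simp_all add: set_integrable_def set_lebesgue_integral_def D'.scaleR)
  define u where "u n t = D (weak_derivative (x n) t)" for n t
  define c where "c n = (LINT t:{0..T}|lborel. kinetic_energy m (weak_derivative (x n) t))" for n
  note w = loops_weak_derivative[OF x]
  have wi: "set_integrable lborel {0..t} (weak_derivative (x n))"
    "x n t - x n 0 = (LINT s:{0..t}|lborel. weak_derivative (x n) s)" if "0 \<le> t" for n t
    using w(1)[of n] that by (auto simp: has_weak_derivative_def)
  have u2: "(norm (u n t))\<^sup>2 = 2 * kinetic_energy m (weak_derivative (x n) t)" for n t
    by (simp add: kin u_def)
  obtain B where B: "B > 0" "\<And>z. norm (D z) \<le> norm z * B" using D.pos_bounded by blast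
  obtain v where v: "set_integrable lborel {0..T} v" "set_integrable lborel {0..T} (\<lambda>t. (norm (v t))\<^sup>2)"
    "(LINT t:{0..T}|lborel. (norm (v t))\<^sup>2) \<le> 2 * C"
    and yv: "\<And>t. t \<in> {0..T} \<Longrightarrow> D (y t) = D (y 0) + (LINT s:{0..t}|lborel. v s)"
  proof (rule weak_derivative_lower_semicontinuous[OF T, of u "\<lambda>n t. D (x n t)" "\<lambda>n. 2 * c n" "2 * C" "\<lambda>t. D (y t)"])
    show "set_integrable lborel {0..T} (u n)" for n
      unfolding u_def using T wi by (intro D_int) auto
    show "set_integrable lborel {0..T} (\<lambda>t. (norm (u n t))\<^sup>2)" for n
      unfolding u2 using action_split(1)[OF m x w(1)] by simp
    show "D (x n t) = D (x n 0) + (LINT s:{0..t}|lborel. u n s)" if "t \<in> {0..T}" for n t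
    proof -
      have "0 \<le> t" using that by simp
      then have "D (x n t - x n 0) = (LINT s:{0..t}|lborel. u n s)"
        unfolding u_def by (simp only: wi(2) D_int(2)[OF wi(1)])
      then show ?thesis by (simp add: D.diff algebra_simps)
    qed
    show "(LINT t:{0..T}|lborel. (norm (u n t))\<^sup>2) \<le> 2 * c n" for n
      unfolding u2 c_def by simp
    show "(\<lambda>n. 2 * c n) \<longlonglongrightarrow> 2 * C" using c unfolding c_def by (intro tendsto_intros)
    fix e :: real assume "e > 0"
    then obtain N where N: "\<forall>n\<ge>N. \<forall>t\<in>{0..T}. norm (x n t - y t) \<le> e / B"
      using unif[of "e / B"] B(1) by auto
    have "norm (D (x n t) - D (y t)) \<le> e" if "n \<ge> N" "t \<in> {0..T}" for n t
    proof -
      have "norm (D (x n t) - D (y t)) \<le> norm (x n t - y t) * B"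
        using B(2)[of "x n t - y t"] by (simp add: D.diff)
      also have "\<dots> \<le> e / B * B" using N that B(1) by (intro mult_right_mono) auto
      finally show ?thesis using B(1) by simp
    qed
    then show "\<exists>N. \<forall>n\<ge>N. \<forall>t\<in>{0..T}. norm (D (x n t) - D (y t)) \<le> e" by blast
  qed (rule that)
  define w where "w t = D' (v t)" for t
  have w_int: "set_integrable lborel {0..T} w" unfolding w_def by (rule D'_int(1)[OF v(1)])
  have yw: "y t = y 0 + (LINT s:{0..t}|lborel. w s)" if t: "t \<in> {0..T}" for t
  proof -
    have "set_integrable lborel {0..t} v" by (rule set_integrable_subset[OF v(1)]) (use t in auto)
    then have "(LINT s:{0..t}|lborel. w s) = D' (LINT s:{0..t}|lborel. v s)"
      unfolding w_def by (rule D'_int(2))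
    then show ?thesis using arg_cong[OF yv[OF t], of D'] by (simp add: DD' D'.add)
  qed
  have h: "has_weak_derivative y (\<lambda>t. w (t rmod T))"
    by (rule has_weak_derivative_periodic_extension[OF T per w_int yw])
  have wm: "(\<lambda>t. w (t rmod T)) \<in> borel_measurable borel"
    by (rule has_weak_derivative_borel_measurable[OF h])
  \<comment> \<open>On \<open>{0..T}\<close> the periodic extension can differ from \<open>w\<close>
    at the end point \<open>T\<close> only.\<close>
  have ae: "AE t in lborel. indicator {0..T} t *\<^sub>R g (w (t rmod T)) = indicator {0..T} t *\<^sub>R g (w t)"
    for g :: "complex^4 \<Rightarrow> real"
    using AE_lborel_singleton[of T]
  proof eventually_elim
    case (elim t)
    then show ?case using T by (cases "t \<in> {0..T}") auto
  qed
  have kw: "kinetic_energy m (w t) = (norm (v t))\<^sup>2 / 2" for t by (simp add: kin w_def DD')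
  have iw: "integrable lborel (\<lambda>t. indicator {0..T} t *\<^sub>R kinetic_energy m (w t))"
    using v(2) unfolding kw set_integrable_def by simp
  have km: "(\<lambda>t. indicator {0..T} t *\<^sub>R kinetic_energy m (w (t rmod T))) \<in> borel_measurable lborel"
    using measurable_compose[OF wm borel_measurable_continuous_onI[OF continuous_on_kinetic_energy]]
    by (intro borel_measurable_scaleR borel_measurable_indicator) auto
  have kin_int: "integrable lborel (\<lambda>t. indicator {0..T} t *\<^sub>R kinetic_energy m (w (t rmod T)))"
    using iw km ae[of "kinetic_energy m"] by (subst integrable_cong_AE) auto
  have "set_integrable lborel {0..T} (\<lambda>t. (norm (w (t rmod T)))\<^sup>2)"
    unfolding set_integrable_def
  proof (rule Bochner_Integration.integrable_bound)
    show "integrable lborel (\<lambda>t. 2 / min 1 m * (indicator {0..T} t *\<^sub>R kinetic_energy m (w (t rmod T))))"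
      using kin_int by simp
    show "(\<lambda>t. indicator {0..T} t *\<^sub>R (norm (w (t rmod T)))\<^sup>2) \<in> borel_measurable lborel"
      using wm by (intro borel_measurable_scaleR borel_measurable_indicator) auto
    have "(norm z)\<^sup>2 \<le> 2 / min 1 m * kinetic_energy m z" for z
      using kinetic_energy_bounds(1)[OF m, of z] m by (simp add: field_simps)
    then show "AE t in lborel. norm (indicator {0..T} t *\<^sub>R (norm (w (t rmod T)))\<^sup>2) \<le>
        norm (2 / min 1 m * (indicator {0..T} t *\<^sub>R kinetic_energy m (w (t rmod T))))"
      using m by (auto simp: indicator_def kinetic_energy_nonneg)
  qed
  moreover have "(LINT t:{0..T}|lborel. kinetic_energy m (w (t rmod T))) \<le> C"
  proof -
    have "(LINT t:{0..T}|lborel. kinetic_energy m (w (t rmod T))) = (LINT t:{0..T}|lborel. kinetic_energy m (w t))"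
      unfolding set_lebesgue_integral_def using iw km ae[of "kinetic_energy m"]
      by (intro integral_cong_AE) auto
    also have "\<dots> = (LINT t:{0..T}|lborel. (norm (v t))\<^sup>2) / 2" unfolding kw by simp
    finally show ?thesis using v(3) by simp
  qed
  ultimately show ?thesis using that h by blast
qed

section \<open>Coercivity, compactness and the direct method for symmetric loops\<close>

context four_body_symmetry
begin

lemma fixed_loops_linear_combination:
  assumes "x \<in> S" "y \<in> S"
  shows "(\<lambda>t. x t + c *\<^sub>R y t) \<in> S"
proof -
  interpret a1: bounded_linear A1 by (rule bounded_linear_A)
  interpret a2: bounded_linear A2 by (rule bounded_linear_A)
  interpret a3: bounded_linear A3 by (rule bounded_linear_A)
  show ?thesis
    unfolding fixed_loops_iff a1.add a1.scaleR a2.add a2.scaleR a3.add a3.scaleR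
      fixed_loopsD(1-3)[OF assms(1), symmetric] fixed_loopsD(1-3)[OF assms(2), symmetric]
    by (simp add: loops_linear_combination fixed_loopsD(4) assms)
qed

text \<open>On centrally symmetric configurations the map \<open>y \<mapsto> A2 (A1 y) - y\<close>
  multiplies each component by \<open>d - 1\<close> or by \<open>- d - 1\<close>, and both factors
  are nonzero.\<close>

lemma rotation_coercive:
  "\<exists>c>0. \<forall>y. y = A3 y \<longrightarrow> norm y \<le> c * norm (A2 (A1 y) - y)"
proof -
  obtain d where d: "\<And>z. \<rho> (h2 L) (\<rho> (h1 L) z) = d * z" "norm d = 1" "d \<noteq> 1" "d \<noteq> -1"
    using rotation_factor by metis
  define k where "k = min (norm (d - 1)) (norm (- d - 1))"
  have "- d - 1 \<noteq> 0" using d(4) by (metis add.inverse_inverse eq_iff_diff_eq_0 neg_equal_iff_equal)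
  then have k: "k > 0" using d(3) by (simp add: k_def)
  \<comment> \<open>The 4 counts the bodies: the norm is estimated by the sum of the norms of the
    components.\<close>
  have "norm y \<le> 4 / k * norm (A2 (A1 y) - y)" if y: "y = A3 y" for y
  proof -
    have y4: "y $ 4 = - (y $ 3)" using arg_cong[OF y, of "\<lambda>y. y $ 4"] unfolding A_components .
    have comp: "norm (y $ i) \<le> 1 / k * norm (A2 (A1 y) - y)" for i
    proof -
      have "\<exists>e\<in>{d, - d}. A2 (A1 y) $ i = e * y $ i"
        using exhaust_4[of i] d(1) y4 by (auto simp: A_components)
      then obtain e where e: "e = d \<or> e = - d" "A2 (A1 y) $ i = e * y $ i" by blast
      have "k * norm (y $ i) \<le> norm (e - 1) * norm (y $ i)"
        using e(1) by (intro mult_right_mono) (auto simp: k_def)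
      also have "\<dots> = norm ((A2 (A1 y) - y) $ i)"
        using e(2) by (simp add: norm_mult[symmetric] left_diff_distrib)
      also have "\<dots> \<le> norm (A2 (A1 y) - y)" by (rule Finite_Cartesian_Product.norm_nth_le)
      finally show ?thesis using k by (simp add: field_simps)
    qed
    have "norm y \<le> (\<Sum>i\<in>UNIV. norm (y $ i))"
      unfolding norm_vec_def by (rule L2_set_le_sum) simp
    also have "\<dots> \<le> (\<Sum>i\<in>(UNIV :: 4 set). 1 / k * norm (A2 (A1 y) - y))"
      by (rule sum_mono) (rule comp)
    finally show ?thesis by simp
  qed
  moreover have "4 / k > 0" using k by simp
  ultimately show ?thesis by blast
qed

lemma fixed_loops_bound:
  obtains c where "c > 0"
    "\<And>x t. x \<in> S \<Longrightarrow> norm (x t) \<le> c * ((LINT t:{0..T}|lborel. (norm (weak_derivative x t))\<^sup>2) + T)"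
proof -
  obtain c where c: "c > 0" "\<And>y. y = A3 y \<Longrightarrow> norm y \<le> c * norm (A2 (A1 y) - y)"
    using rotation_coercive by blast
  have "norm (x t) \<le> c * ((LINT t:{0..T}|lborel. (norm (weak_derivative x t))\<^sup>2) + T)" if x: "x \<in> S" for x t
  proof -
    define E where "E = (LINT t:{0..T}|lborel. (norm (weak_derivative x t))\<^sup>2)"
    have E0: "E \<ge> 0" unfolding E_def set_lebesgue_integral_def
      by (intro Bochner_Integration.integral_nonneg) simp
    note D = fixed_loopsD[OF x]
    have per: "x (t + T) = x t" for t using D(4) by (auto simp: loops_def)
    \<comment> \<open>Weight 1 in \<open>loops_increment_bound\<close> gives
      \<open>(E + (b - a)) / 2\<close>; the rest is slack.\<close>
    have osc: "norm (x b - x a) \<le> E + T" if "a \<in> {0..T}" "b \<in> {0..T}" for a b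
    proof -
      have "norm (x b - x a) \<le> E + T" if "0 \<le> a" "a \<le> b" "b \<le> T" for a b
        using loops_increment_bound[OF D(4) that, of 1] that E0 T by (simp add: E_def)
      then show ?thesis using that by (metis atLeastAtMost_iff linear norm_minus_commute)
    qed
    have dom: "s rmod T \<in> {0..T}" for s
      using rmod_circle[of s] by (auto simp: circle_def)
    have "x (t + T / real L) = A2 (A1 (x t))"
      using D(2)[of "t + T / real L"] D(1)[of "- t"] by simp
    then have "norm (x t) \<le> c * norm (x (t + T / real L) - x t)"
      using c(2)[OF D(3)] by simp
    also have "norm (x (t + T / real L) - x t) \<le> E + T"
      using osc[OF dom[of t] dom[of "t + T / real L"]] periodic_rmod[of x T, OF per] by simp
    finally show ?thesis using c(1) by (simp add: E_def)
  qed
  then show ?thesis using that c(1) by blast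
qed

lemma zero_in_fixed_loops: "(\<lambda>_. 0) \<in> S"
proof -
  have A0: "A1 0 = 0" "A2 0 = 0" "A3 0 = 0"
    using bounded_linear_A[THEN bounded_linear.linear, THEN linear_0] by auto
  have "(\<lambda>_. 0) \<in> loops T m"
    by (rule loops_of_vector_derivative[of _ "\<lambda>_. 0"]) (auto simp: configurations_def)
  then show ?thesis unfolding fixed_loops_iff by (simp add: A0)
qed

text \<open>Periodicity and symmetry pass to pointwise limits because the maps \<open>A1\<close>,
  \<open>A2\<close>, \<open>A3\<close> are continuous; a square integrable weak derivative does not
  come for free and is supplied by lower semicontinuity.\<close>

lemma fixed_loops_limit:
  assumes x: "\<And>n. x n \<in> S" and lim: "\<And>t. (\<lambda>n. x n t) \<longlonglongrightarrow> y t" and y: "has_weak_derivative y v"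
    "set_integrable lborel {0..T} (\<lambda>t. (norm (v t))\<^sup>2)"
  shows "y \<in> S"
proof -
  have eq: "y t = A (y s)" if A: "bounded_linear A" and e: "\<And>n. x n t = A (x n s)" for A t s
  proof (rule LIMSEQ_unique[OF lim[of t]])
    show "(\<lambda>n. x n t) \<longlonglongrightarrow> A (y s)"
      using bounded_linear.tendsto[OF A lim[of s]] e by simp
  qed
  have per: "y (t + T) = y t" for t
  proof (rule LIMSEQ_unique[OF lim[of "t + T"]])
    have "x n (t + T) = x n t" for n using fixed_loopsD(4)[OF x] by (auto simp: loops_def)
    then show "(\<lambda>n. x n (t + T)) \<longlonglongrightarrow> y t" using lim[of t] by simp
  qed
  have sym: "y t = A1 (y (- t))" "y t = A2 (y (T / real L - t))" "y t = A3 (y t)" for t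
    by (rule eq[OF bounded_linear_A(1) fixed_loopsD(1)[OF x]]
        eq[OF bounded_linear_A(2) fixed_loopsD(2)[OF x]]
        eq[OF bounded_linear_A(3) fixed_loopsD(3)[OF x]])+
  have "y \<in> loops T m"
    unfolding loops_def using per y configurations_A3[OF sym(3)] by blast
  then show ?thesis unfolding fixed_loops_iff using sym by blast
qed

lemma fixed_loops_compact:
  assumes x: "\<And>n. x n \<in> S"
    and E: "\<And>n. (LINT t:{0..T}|lborel. (norm (weak_derivative (x n) t))\<^sup>2) \<le> E"
  obtains r y where "strict_mono (r :: nat \<Rightarrow> nat)" "\<And>t. y (t + T) = y t"
    "\<And>e. e > 0 \<Longrightarrow> \<exists>N. \<forall>n\<ge>N. \<forall>t. norm (x (r n) t - y t) \<le> e"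
proof -
  obtain c where c: "c > 0" "\<And>x t. x \<in> S \<Longrightarrow>
      norm (x t) \<le> c * ((LINT t:{0..T}|lborel. (norm (weak_derivative x t))\<^sup>2) + T)"
    using fixed_loops_bound by metis
  have bnd: "norm (x n t) \<le> c * (E + T)" for n t
    by (rule order_trans[OF c(2)[OF x]]) (use c(1) E in \<open>auto intro!: mult_left_mono\<close>)
  have E0: "E \<ge> 0"
    by (rule order_trans[OF _ E[of 0]])
       (auto simp: set_lebesgue_integral_def intro!: Bochner_Integration.integral_nonneg)
  have inc: "norm (x n b - x n a) \<le> (l * E + (b - a) / l) / 2"
    if "0 \<le> a" "a \<le> b" "b \<le> T" "l > 0" for n a b l
    by (rule order_trans[OF loops_increment_bound[OF fixed_loopsD(4)[OF x] that]])
       (use E that(4) in \<open>auto intro!: mult_left_mono\<close>)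
  have equi: "\<exists>d>0. \<forall>n b. b \<in> {0..T} \<and> norm (a - b) < d \<longrightarrow> norm (x n a - x n b) < e"
    if a: "a \<in> {0..T}" and e: "e > 0" for a e
  proof -
    \<comment> \<open>Makes \<open>l * E \<le> e\<close>, while \<open>norm (a - b) < l * e\<close>
      makes the other term smaller than \<open>e\<close>; half the sum is then below
      \<open>e\<close>. The 1 covers \<open>E = 0\<close>.\<close>
    define l where "l = e / (E + 1)"
    have l: "l > 0" "l * E \<le> e" using e E0 by (auto simp: l_def field_simps)
    have "norm (x n a - x n b) < e" if "b \<in> {0..T}" "norm (a - b) < l * e" for n b
    proof -
      have q: "(\<bar>a - b\<bar>) / l < e" using that l(1) by (simp add: field_simps)
      consider "a \<le> b" | "b \<le> a" by linarith
      then show ?thesis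
      proof cases
        case 1
        then show ?thesis using inc[of a b l n] a that l q by (simp add: norm_minus_commute)
      next
        case 2
        then show ?thesis using inc[of b a l n] a that l q by simp
      qed
    qed
    then show ?thesis using l(1) e by (intro exI[of _ "l * e"]) auto
  qed
  obtain g r where g: "continuous_on {0..T} g" and r: "strict_mono (r :: nat \<Rightarrow> nat)"
    and conv: "\<And>e. 0 < e \<Longrightarrow> \<exists>N. \<forall>n t. n \<ge> N \<and> t \<in> {0..T} \<longrightarrow> norm (x (r n) t - g t) < e"
    by (rule Arzela_Ascoli[of "{0..T}" x "c * (E + T)"]) (use bnd equi in auto)
  \<comment> \<open>The limit is known on one period; since all \<open>x n\<close> are periodic,
    uniform convergence spreads to the whole line.\<close>
  define y where "y t = g (t rmod T)" for t
  have xper: "x n (t + T) = x n t" for n t using fixed_loopsD(4)[OF x] by (auto simp: loops_def)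
  have "\<exists>N. \<forall>n\<ge>N. \<forall>t. norm (x (r n) t - y t) \<le> e" if e: "e > 0" for e
  proof -
    obtain N where N: "\<And>n t. n \<ge> N \<Longrightarrow> t \<in> {0..T} \<Longrightarrow> norm (x (r n) t - g t) < e"
      using conv[OF e] by blast
    have "norm (x (r n) t - y t) \<le> e" if "n \<ge> N" for n t
    proof -
      have "t rmod T \<in> {0..T}" using rmod_circle[of t] by (auto simp: circle_def)
      then have "norm (x (r n) (t rmod T) - g (t rmod T)) < e" by (rule N[OF that])
      then show ?thesis
        using periodic_rmod[of "x (r n)" T t, OF xper] by (simp add: y_def)
    qed
    then show ?thesis by blast
  qed
  moreover have "y (t + T) = y t" for t
  proof -
    have "(t + T) rmod T = t rmod T"
      using rcong_altdef[of t "t + T" T] by (auto simp: rcong_def intro!: exI[of _ 1])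
    then show ?thesis by (simp add: y_def)
  qed
  ultimately show ?thesis using that r by blast
qed

lemma minimizer_exists:
  assumes ex: "\<exists>x\<in>S. action T m x < \<infinity>"
  shows "\<exists>x. minimizer_on T m S x"
proof -
  define a where "a = (INF x\<in>S. action T m x)"
  define \<alpha> where "\<alpha> = enn2real a"
  have "a < \<infinity>" using ex by (auto simp: a_def INF_less_iff)
  then have a: "a = ennreal \<alpha>" by (simp add: \<alpha>_def less_top)
  have \<alpha>0: "\<alpha> \<ge> 0" by (simp add: \<alpha>_def)
  have "\<exists>x. x \<in> S \<and> action T m x < ennreal (\<alpha> + 1 / real (Suc n))" for n
  proof -
    have "a < ennreal (\<alpha> + 1 / real (Suc n))" unfolding a using \<alpha>0
      by (intro ennreal_lessI add_nonneg_pos) (auto intro: add_nonneg_pos)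
    then show ?thesis by (auto simp: a_def INF_less_iff)
  qed
  then obtain x where xS: "\<And>n. x n \<in> S" and xa: "\<And>n. action T m (x n) < ennreal (\<alpha> + 1 / real (Suc n))"
    by metis
  define K where "K n = (LINT t:{0..T}|lborel. kinetic_energy m (weak_derivative (x n) t))" for n
  define P where "P z = (\<integral>\<^sup>+t\<in>{0..T}. collision_potential m (z t) \<partial>lborel)" for z
  note xl = fixed_loopsD(4)[OF xS]
  have split: "action T m (x n) = ennreal (K n) + P (x n)" for n
    unfolding K_def P_def by (rule action_split(2)[OF m xl loops_weak_derivative(1)[OF xl]])
  have K0: "K n \<ge> 0" for n unfolding K_def set_lebesgue_integral_def
    by (intro Bochner_Integration.integral_nonneg) (simp add: kinetic_energy_nonneg m)
  have Pn: "K n \<le> \<alpha> + 1 / real (Suc n)" "P (x n) \<le> ennreal (\<alpha> + 1 / real (Suc n) - K n)" for n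
  proof -
    have le: "ennreal (K n) + P (x n) \<le> ennreal (\<alpha> + 1 / real (Suc n))"
      using xa[of n] unfolding split by simp
    have "ennreal (K n) \<le> ennreal (K n) + P (x n)" by simp
    also note le
    finally show *: "K n \<le> \<alpha> + 1 / real (Suc n)" using \<alpha>0 by (subst (asm) ennreal_le_iff) auto
    have "ennreal (\<alpha> + 1 / real (Suc n)) = ennreal (K n) + ennreal (\<alpha> + 1 / real (Suc n) - K n)"
      using * K0[of n] by (subst ennreal_plus[symmetric]) auto
    then show "P (x n) \<le> ennreal (\<alpha> + 1 / real (Suc n) - K n)"
      using le by (simp add: ennreal_add_left_cancel_le)
  qed
  have "bounded (range K)"
  proof (rule boundedI)
    fix k assume "k \<in> range K"
    then obtain n where n: "k = K n" by blast
    have "1 / real (Suc n) \<le> 1" by simp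
    then have "K n \<le> \<alpha> + 1" using Pn(1)[of n] by linarith
    then show "norm k \<le> \<alpha> + 1" using K0[of n] n by simp
  qed
  \<comment> \<open>Once the kinetic parts converge to \<open>\<kappa>\<close>, the bounds on the
    potential parts tend to \<open>\<alpha> - \<kappa>\<close>, so the two separate lower
    semicontinuity estimates add up exactly to the infimum \<open>\<alpha>\<close>.\<close>
  then obtain \<kappa> r1 where r1: "strict_mono (r1 :: nat \<Rightarrow> nat)" "(K \<circ> r1) \<longlonglongrightarrow> \<kappa>"
    using bounded_imp_convergent_subsequence by blast
  have E: "(LINT t:{0..T}|lborel. (norm (weak_derivative (x (r1 n)) t))\<^sup>2) \<le> 2 / min 1 m * (\<alpha> + 1)" for n
  proof -
    note ik = action_split(1)[OF m xl loops_weak_derivative(1)[OF xl], of "r1 n"]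
    have "(LINT t:{0..T}|lborel. (norm (weak_derivative (x (r1 n)) t))\<^sup>2) \<le>
        (LINT t:{0..T}|lborel. 2 / min 1 m * kinetic_energy m (weak_derivative (x (r1 n)) t))"
    proof (rule set_integral_mono[OF loops_weak_derivative(2)[OF xl]])
      show "set_integrable lborel {0..T} (\<lambda>t. 2 / min 1 m * kinetic_energy m (weak_derivative (x (r1 n)) t))"
        using ik by simp
      show "(norm z)\<^sup>2 \<le> 2 / min 1 m * kinetic_energy m z" for z
        using kinetic_energy_bounds(1)[OF m, of z] m by (simp add: field_simps)
    qed
    also have "\<dots> = 2 / min 1 m * K (r1 n)" by (simp add: K_def)
    also have "K (r1 n) \<le> \<alpha> + 1"
    proof -
      have "1 / real (Suc (r1 n)) \<le> 1" by simp
      then show ?thesis using Pn(1)[of "r1 n"] by linarith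
    qed
    finally show ?thesis using m by (simp add: mult_left_mono divide_right_mono)
  qed
  obtain r2 y where r2: "strict_mono (r2 :: nat \<Rightarrow> nat)" and yper: "\<And>t. y (t + T) = y t"
    and unif: "\<And>e. e > 0 \<Longrightarrow> \<exists>N. \<forall>n\<ge>N. \<forall>t. norm (x (r1 (r2 n)) t - y t) \<le> e"
    using fixed_loops_compact[of "\<lambda>n. x (r1 n)", OF xS E] by metis
  define r where "r n = r1 (r2 n)" for n
  have r: "strict_mono r" unfolding r_def using r1(1) r2 by (simp add: strict_mono_def)
  have Kr: "(\<lambda>n. K (r n)) \<longlonglongrightarrow> \<kappa>"
    using LIMSEQ_subseq_LIMSEQ[OF r1(2) r2] by (simp add: r_def o_def)
  obtain v where v: "has_weak_derivative y v" "set_integrable lborel {0..T} (\<lambda>t. (norm (v t))\<^sup>2)"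
    "(LINT t:{0..T}|lborel. kinetic_energy m (v t)) \<le> \<kappa>"
  proof (rule kinetic_energy_lower_semicontinuous[OF T m, of "\<lambda>n. x (r n)" \<kappa> y])
    show "\<exists>N. \<forall>n\<ge>N. \<forall>t\<in>{0..T}. norm (x (r n) t - y t) \<le> e" if "e > 0" for e
      using unif[OF that] unfolding r_def by blast
  qed (use xl Kr yper in \<open>auto simp: K_def\<close>)
  have lim: "(\<lambda>n. x (r n) t) \<longlonglongrightarrow> y t" for t
  proof (rule LIMSEQ_I)
    fix e :: real assume "e > 0"
    then obtain N where "\<forall>n\<ge>N. \<forall>t. norm (x (r n) t - y t) \<le> e / 2"
      using unif[of "e / 2"] unfolding r_def by auto
    moreover have "e / 2 < e" using \<open>e > 0\<close> by simp
    ultimately have "\<forall>n\<ge>N. norm (x (r n) t - y t) < e" by (meson le_less_trans)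
    then show "\<exists>N. \<forall>n\<ge>N. norm (x (r n) t - y t) < e" by blast
  qed
  have yS: "y \<in> S" by (rule fixed_loops_limit[OF xS lim v(1,2)])
  note yl = fixed_loopsD(4)[OF yS]
  have meas: "(\<lambda>t. collision_potential m (z t) * indicator {0..T} t) \<in> borel_measurable lborel"
    if "z \<in> loops T m" for z
  proof -
    have [measurable]: "z \<in> borel_measurable borel"
      by (rule borel_measurable_continuous_onI[OF loops_continuous[OF that]])
    show ?thesis by measurable
  qed
  \<comment> \<open>\<open>collision_potential\<close> is continuous also at collisions of
    \<open>y\<close>, so the integrands converge at every time, possibly to
    \<open>\<infinity>\<close>.\<close>
  have "P y \<le> (\<integral>\<^sup>+t. liminf (\<lambda>n. collision_potential m (x (r n) t) * indicator {0..T} t) \<partial>lborel)"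
    unfolding P_def
  proof (rule nn_integral_mono)
    fix t
    have "(\<lambda>n. collision_potential m (x (r n) t)) \<longlonglongrightarrow> collision_potential m (y t)"
      using continuous_on_tendsto_compose[OF continuous_on_collision_potential lim[of t]] by simp
    then have "(\<lambda>n. collision_potential m (x (r n) t) * indicator {0..T} t) \<longlonglongrightarrow>
        collision_potential m (y t) * indicator {0..T} t"
      by (cases "t \<in> {0..T}") auto
    then show "collision_potential m (y t) * indicator {0..T} t \<le>
        liminf (\<lambda>n. collision_potential m (x (r n) t) * indicator {0..T} t)"
      using lim_imp_Liminf[of sequentially] by fastforce
  qed
  also have "\<dots> \<le> liminf (\<lambda>n. P (x (r n)))"
    unfolding P_def by (intro nn_integral_liminf meas xl)
  also have "\<dots> \<le> liminf (\<lambda>n. ennreal (\<alpha> + 1 / real (Suc (r n)) - K (r n)))"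
    by (intro Liminf_mono always_eventually allI Pn)
  also have "\<dots> = ennreal (\<alpha> - \<kappa>)"
  proof (intro lim_imp_Liminf tendsto_ennrealI)
    have "(\<lambda>n. 1 / real (Suc (r n))) \<longlonglongrightarrow> 0"
      using LIMSEQ_subseq_LIMSEQ[OF LIMSEQ_inverse_real_of_nat r] by (simp add: o_def inverse_eq_divide)
    then have "(\<lambda>n. \<alpha> + 1 / real (Suc (r n)) - K (r n)) \<longlonglongrightarrow> \<alpha> + 0 - \<kappa>"
      by (intro tendsto_intros Kr)
    then show "(\<lambda>n. \<alpha> + 1 / real (Suc (r n)) - K (r n)) \<longlonglongrightarrow> \<alpha> - \<kappa>" by simp
  qed simp
  finally have Py: "P y \<le> ennreal (\<alpha> - \<kappa>)" .
  \<comment> \<open>\<open>ennreal\<close> truncates at 0; these bounds make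
    \<open>ennreal \<kappa>\<close> and \<open>ennreal (\<alpha> - \<kappa>)\<close> add up to
    \<open>ennreal \<alpha>\<close>.\<close>
  have \<kappa>: "0 \<le> \<kappa>" "\<kappa> \<le> \<alpha>"
  proof -
    show "0 \<le> \<kappa>" by (rule LIMSEQ_le_const[OF Kr]) (use K0 in auto)
    have "(\<lambda>n. 1 / real (Suc (r n))) \<longlonglongrightarrow> 0"
      using LIMSEQ_subseq_LIMSEQ[OF LIMSEQ_inverse_real_of_nat r] by (simp add: o_def inverse_eq_divide)
    then have "(\<lambda>n. \<alpha> + 1 / real (Suc (r n))) \<longlonglongrightarrow> \<alpha> + 0"
      by (intro tendsto_intros)
    then show "\<kappa> \<le> \<alpha>" using LIMSEQ_le[OF Kr] Pn(1) by simp
  qed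
  have "action T m y = ennreal (LINT t:{0..T}|lborel. kinetic_energy m (v t)) + P y"
    unfolding P_def by (rule action_split(2)[OF m yl v(1)])
  also have "\<dots> \<le> ennreal \<kappa> + ennreal (\<alpha> - \<kappa>)"
    by (intro add_mono Py ennreal_leI v(3))
  also have "\<dots> = a" unfolding a using \<kappa> by (subst ennreal_plus[symmetric]) auto
  finally have "action T m y \<le> a" .
  then have "\<forall>z\<in>S. action T m y \<le> action T m z"
    unfolding a_def by (meson INF_lower order_trans)
  then show ?thesis using yS unfolding minimizer_on_def by blast
qed

section \<open>From collision-free minimizers to solutions\<close>

lemma minimizer_is_newton_solution:
  assumes x: "minimizer_on T m S x" and cf: "collision_free x"
  shows "newton_solution m x"
proof -
  have xS: "x \<in> S" and min: "\<And>y. y \<in> S \<Longrightarrow> action T m x \<le> action T m y"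
    using x by (auto simp: minimizer_on_def)
  note D = fixed_loopsD[OF xS]
  have per: "x (t + T) = x t" for t using D(4) by (auto simp: loops_def)
  define f where "f t = acceleration m (x t)" for t
  have fc: "continuous_on UNIV f"
    unfolding f_def by (rule continuous_on_acceleration[OF loops_continuous[OF D(4)] cf])
  have fper: "f (t + T) = f t" for t by (simp add: f_def per)
  have f1: "f t = A1 (f (- t))" for t
    unfolding f_def acceleration_A(1)[symmetric] by (rule arg_cong[OF D(1)])
  have f2: "f t = A2 (f (T / real L - t))" for t
    unfolding f_def acceleration_A(2)[symmetric] by (rule arg_cong[OF D(2)])
  have f3: "f t = A3 (f t)" for t
    unfolding f_def acceleration_A(3)[symmetric] by (rule arg_cong[OF D(3)])
  obtain G where G: "\<And>t. (G has_vector_derivative f t) (at t)"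
    using continuous_has_antiderivative[OF fc] by blast
  interpret a1: bounded_linear A1 by (rule bounded_linear_A)
  interpret a2: bounded_linear A2 by (rule bounded_linear_A)
  interpret a3: bounded_linear A3 by (rule bounded_linear_A)
  have shift: "((\<lambda>t. G (t + c)) has_vector_derivative f (t + c)) (at t)" for c t
  proof -
    have "((\<lambda>t. t + c) has_vector_derivative 1) (at t)" by (auto intro!: derivative_eq_intros)
    then have "(G \<circ> (\<lambda>t. t + c) has_vector_derivative 1 *\<^sub>R f (t + c)) (at t)"
      by (intro vector_diff_chain_at G)
    then show ?thesis by (simp add: o_def)
  qed
  \<comment> \<open>The integral of the acceleration over a period, which obstructs periodicity of
    \<open>G\<close>. It inherits every symmetry \<open>f (t + c) = A (f t)\<close>, so
    \<open>rotation_coercive\<close> forces it to be 0.\<close>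
  define M where "M = G T - G 0"
  have M: "G (t + T) - G t = M" for t
  proof -
    have "((\<lambda>t. G (t + T) - G t) has_vector_derivative 0) (at t)" for t
      using has_vector_derivative_diff[OF shift[of T t] G[of t]] by (simp add: fper)
    from zero_vector_derivative_const[OF this, of t 0] show ?thesis by (simp add: M_def)
  qed
  have const: "G (t + c) - A (G t) = G c - A (G 0)"
    if A: "bounded_linear A" and e: "\<And>t. f (t + c) = A (f t)" for A c t
  proof -
    have "((\<lambda>t. G (t + c) - A (G t)) has_vector_derivative 0) (at t)" for t
      using has_vector_derivative_diff[OF shift[of c t] bounded_linear.has_vector_derivative[OF A G[of t]]]
      by (simp add: e)
    from zero_vector_derivative_const[OF this, of t 0] show ?thesis by simp
  qed
  have inv: "M = A M" if A: "bounded_linear A" and e: "\<And>t. f (t + c) = A (f t)" for A c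
  proof -
    have "M = G (T + c) - G c" using M[of c] by (simp add: add.commute)
    also have "\<dots> = A (G T) - A (G 0)" using const[OF A e, of T] by (simp add: algebra_simps)
    also have "\<dots> = A M" using bounded_linear.linear[OF A] by (simp add: M_def linear_diff)
    finally show ?thesis .
  qed
  have "bounded_linear (\<lambda>y. A2 (A1 y))"
    using bounded_linear_compose[OF bounded_linear_A(2,1)] .
  moreover have "f (t + T / real L) = A2 (A1 (f t))" for t
    using f2[of "t + T / real L"] f1[of "- t"] by simp
  ultimately have M1: "M = A2 (A1 M)" by (rule inv)
  have M3: "M = A3 M" by (rule inv[OF bounded_linear_A(3), of 0]) (unfold add_0_right, rule f3)
  have "M = 0"
  proof -
    obtain c where "\<And>y. y = A3 y \<Longrightarrow> norm y \<le> c * norm (A2 (A1 y) - y)"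
      using rotation_coercive by blast
    from this[OF M3] show ?thesis unfolding M1[symmetric] by simp
  qed
  then have Gper: "G (t + T) = G t" for t using M[of t] by simp
  obtain F1 H where F1: "\<And>t. (F1 has_vector_derivative f t) (at t)" "\<And>t. F1 (t + T) = F1 t"
    and H: "\<And>t. (H has_vector_derivative F1 t) (at t)" "\<And>t. H (t + T) = H t"
    using periodic_antiderivative_normalization[OF T G Gper] by metis
  \<comment> \<open>The first normalization gave the velocity \<open>F1\<close> mean zero, the
    second does so for the position \<open>F2\<close>, with \<open>F3\<close> as witness. Without
    mean zero, \<open>F2\<close> would be fixed only up to a constant and need not be
    symmetric.\<close>
  obtain F2 F3 where F2: "\<And>t. (F2 has_vector_derivative F1 t) (at t)" "\<And>t. F2 (t + T) = F2 t"
    and F3: "\<And>t. (F3 has_vector_derivative F2 t) (at t)" "\<And>t. F3 (t + T) = F3 t"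
    using periodic_antiderivative_normalization[OF T H] by metis
  note equi = second_antiderivative_equivariant[OF T _ _ F1(1) F2 F3]
  have s1: "F2 t = A1 (F2 (- t))" for t
  proof -
    have "f t = A1 (f (- 1 * t + 0))" for t using f1[of t] by simp
    from equi[OF bounded_linear_A(1) _ this, of t] show ?thesis by simp
  qed
  have s2: "F2 t = A2 (F2 (T / real L - t))" for t
  proof -
    have "f t = A2 (f (- 1 * t + T / real L))" for t using f2[of t] by simp
    from equi[OF bounded_linear_A(2) _ this, of t] show ?thesis by simp
  qed
  have s3: "F2 t = A3 (F2 t)" for t
  proof -
    have "f t = A3 (f (1 * t + 0))" for t unfolding mult_1 add_0_right by (rule f3)
    from equi[OF bounded_linear_A(3) _ this, of t] show ?thesis unfolding mult_1 add_0_right by simp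
  qed
  have F1c: "continuous_on UNIV F1"
    by (meson F1 has_vector_derivative_continuous continuous_at_imp_continuous_on)
  have "F2 \<in> loops T m"
    by (rule loops_of_vector_derivative[OF F2(1) F1c F2(2) configurations_A3[OF s3]])
  then have F2S: "F2 \<in> S" unfolding fixed_loops_iff using s1 s2 s3 by blast
  have comp: "(\<lambda>t. x t - s *\<^sub>R (x t - F2 t)) \<in> S" for s
  proof -
    have "(\<lambda>t. x t + (- s) *\<^sub>R (x t + (-1) *\<^sub>R F2 t)) \<in> S"
      by (intro fixed_loops_linear_combination xS F2S)
    then show ?thesis by simp
  qed
  \<comment> \<open>So far \<open>x\<close> was only of class H1; this equality makes it twice
    differentiable with second derivative \<open>f\<close>.\<close>
  have xF: "x t = F2 t + (x 0 - F2 0)" for t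
    by (rule minimizer_eq_competitor_plus_const[OF T m D(4) cf F2 F1[unfolded f_def]
          fixed_loopsD(4)[OF comp] min[OF comp]])
  have dx: "(x has_vector_derivative F1 t) (at t)" for t
  proof -
    have "((\<lambda>t. F2 t + (x 0 - F2 0)) has_vector_derivative F1 t) (at t)"
      by (auto intro!: derivative_eq_intros F2)
    moreover have "x = (\<lambda>t. F2 t + (x 0 - F2 0))" by (rule ext) (rule xF)
    ultimately show ?thesis by metis
  qed
  have "mass m i *\<^sub>R f t $ i = (\<Sum>j\<in>UNIV - {i}. (mass m i * mass m j / (norm (x t $ j - x t $ i)) ^ 3) *\<^sub>R
      (x t $ j - x t $ i))" for t i
    by (simp add: f_def acceleration_def scaleR_sum_right)
  then show ?thesis unfolding newton_solution_def using dx F1(1) by blast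
qed

end

theorem mainTheorem9:
  fixes T m :: real and q L :: nat and l1 l2 :: "complex set"
    and \<tau> :: "(int \<times> bool) \<times> int \<Rightarrow> real \<Rightarrow> real"
    and \<rho> :: "(int \<times> bool) \<times> int \<Rightarrow> complex \<Rightarrow> complex"
    and \<sigma> :: "(int \<times> bool) \<times> int \<Rightarrow> 4 \<Rightarrow> 4"
  assumes "T > 0" and "m > 0" and "q > 2" and "L = lcm 2 q"
    and "\<tau> \<in> hom (sym_grp L) (BijGroup (circle T))"
    and "\<forall>t\<in>circle T. \<tau> (h1 L) t = (- t) rmod T"
    and "\<forall>t\<in>circle T. \<tau> (h2 L) t = (T / real L - t) rmod T"
    and "\<forall>t\<in>circle T. \<tau> (h3 L) t = t"
    and "\<sigma> \<in> hom (sym_grp L) (BijGroup UNIV)"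
    and "\<sigma> (h1 L) = Transposition.transpose 1 2 \<circ> Transposition.transpose 3 4"
    and "\<sigma> (h2 L) = Transposition.transpose 1 2"
    and "\<sigma> (h3 L) = Transposition.transpose 1 2 \<circ> Transposition.transpose 3 4"
    and "line_through_origin l1" and "line_through_origin l2"
    and "lines_meet_at_angle l1 l2 (pi / real q)"
    and "\<rho> \<in> hom (sym_grp L) O2"
    and "reflection_along l1 (\<rho> (h1 L))"
    and "reflection_along l2 (\<rho> (h2 L))"
    and "\<rho> (h3 L) = (\<lambda>z. cis pi * z)"
    and "\<forall>x. local_minimum_on T m (fixed_loops T m (sym_grp L) \<tau> \<rho> \<sigma>) x \<longrightarrow> collision_free x"
  shows "(\<exists>x. minimizer_on T m (fixed_loops T m (sym_grp L) \<tau> \<rho> \<sigma>) x) \<and>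
    (\<forall>x. minimizer_on T m (fixed_loops T m (sym_grp L) \<tau> \<rho> \<sigma>) x \<longrightarrow>
       collision_free x \<and> (\<forall>t. x (t + T) = x t) \<and> newton_solution m x \<and> \<not> homographic x)"
proof -
  interpret four_body_symmetry T m q L l1 l2 \<tau> \<rho> \<sigma>
    by unfold_locales (fact assms)+
  \<comment> \<open>A global minimizer is a local minimum for any radius, for instance 1, so the
    hypothesis on local minima applies.\<close>
  have cf: "collision_free x" if "minimizer_on T m S x" for x
    using that assms(20) unfolding minimizer_on_def local_minimum_on_def by (meson zero_less_one)
  \<comment> \<open>If every action were infinite, the zero loop would be a local minimum with collisions.\<close>
  have "\<exists>x\<in>S. action T m x < \<infinity>"
  proof (rule ccontr)
    assume "\<not> (\<exists>x\<in>S. action T m x < \<infinity>)"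
    then have "\<forall>y\<in>S. action T m y = \<infinity>" using top.not_eq_extremum by auto
    then have "minimizer_on T m S (\<lambda>_. 0)"
      using zero_in_fixed_loops by (simp add: minimizer_on_def)
    then have "collision_free (\<lambda>_. 0)" by (rule cf)
    then show False using distinct_4(1) by (auto simp: collision_free_def)
  qed
  then have "\<exists>x. minimizer_on T m S x" by (rule minimizer_exists)
  moreover have "collision_free x \<and> (\<forall>t. x (t + T) = x t) \<and> newton_solution m x \<and> \<not> homographic x"
    if x: "minimizer_on T m S x" for x
  proof -
    have "x \<in> S" using x by (simp add: minimizer_on_def)
    then show ?thesis
      using cf[OF x] minimizer_is_newton_solution[OF x cf[OF x]] not_homographic
        fixed_loopsD(4)[of x] by (auto simp: loops_def)
  qed
  ultimately show ?thesis by blast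
qed

end
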